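(* A finite abelian group acts effectively on a smooth cubic fourfold over $\mathbb{C}$ if and only if it is (isomorphic to) a subgroup of one of the following groups: $$(\mathbb Z/3\mathbb Z)^{\oplus 5},\quad (\mathbb Z/3\mathbb Z)^{\oplus 4}\oplus \mathbb Z/2\mathbb Z,\quad (\mathbb Z/3\mathbb Z)^{\oplus 3}\oplus \mathbb Z/4\mathbb Z,\quad (\mathbb Z/3\mathbb Z)^{\oplus 3}\oplus (\mathbb Z/2\mathbb Z)^{\oplus 2},$$ $$(\mathbb Z/3\mathbb Z)^{\oplus 2}\oplus \mathbb Z/8\mathbb Z,\quad (\mathbb Z/3\mathbb Z)^{\oplus 2}\oplus \mathbb Z/2\mathbb Z\oplus \mathbb Z/4\mathbb Z,\quad (\mathbb Z/3\mathbb Z)^{\oplus 2}\oplus (\mathbb Z/2\mathbb Z)^{\oplus 3},\quad \mathbb Z/3\mathbb Z\oplus \mathbb Z/16\mathbb Z,$$ $$\mathbb Z/3\mathbb Z\oplus \mathbb Z/2\mathbb Z\oplus \mathbb Z/8\mathbb Z,\quad \mathbb Z/3\mathbb Z\oplus (\mathbb Z/4\mathbb Z)^{\oplus 2},\quad \mathbb Z/32\mathbb Z,$$ $$(\mathbb Z/3\mathbb Z)^{\oplus 2}\oplus \mathbb Z/9\mathbb Z,\quad \mathbb Z/2\mathbb Z\oplus \mathbb Z/3\mathbb Z\oplus \mathbb Z/9\mathbb Z,\quad \mathbb Z/4\mathbb Z\oplus \mathbb Z/9\mathbb Z,$$ $$(\mathbb Z/3\mathbb Z)^{\oplus 2}\oplus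 \mathbb Z/5\mathbb Z,\quad \mathbb Z/2\mathbb Z\oplus \mathbb Z/3\mathbb Z\oplus \mathbb Z/5\mathbb Z,\quad \mathbb Z/3\mathbb Z\oplus \mathbb Z/7\mathbb Z,\quad \mathbb Z/3\mathbb Z\oplus \mathbb Z/11\mathbb Z.$$
   Context: The base field is $\mathbb{C}$. A smooth cubic fourfold is a smooth hypersurface $X\subset\mathbb P^5$ of degree $3$. A group $G$ acts effectively on a smooth cubic fourfold (is an "automorphism group" of a cubic fourfold) if there are a group monomorphism $\phi\colon G\hookrightarrow \mathrm{Aut}(\mathbb P^5)=PGL(6)$ and a smooth cubic hypersurface $X\subset\mathbb P^5$ with $\phi(G)(X)\subset X$. (For cubic fourfolds the group of linear automorphisms of $X$ coincides with the full automorphism group of $X$ as an abstract variety.) *)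

theory Defs
  imports "HOL-Analysis.Cartesian_Space" "HOL-Library.Numeral_Type"
    "HOL-Algebra.Elementary_Groups" "HOL-Algebra.Product_Groups"
begin

section \<open>The projective linear group and its action on projective space\<close>

definition GL :: "(complex ^ 'n ^ 'n) monoid" where
  "GL = \<lparr>carrier = {A. invertible A}, mult = (**), one = mat 1\<rparr>"

definition scalar_matrices :: "(complex ^ 'n ^ 'n) set" where
  "scalar_matrices = {mat c | c. c \<noteq> 0}"

definition PGL :: "(complex ^ 'n ^ 'n) set monoid" where
  "PGL = GL Mod scalar_matrices"

text \<open>With index type \<open>'n\<close> this is the projective space of dimension \<open>CARD('n) - 1\<close>: its points are
  the lines through the origin of \<open>complex ^ 'n\<close>. Note that \<^const>\<open>vec.span\<close> is the complex span.\<close>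

definition proj_space :: "(complex ^ 'n) set set" where
  "proj_space = {vec.span {x} | x. x \<noteq> 0}"

text \<open>An element \<open>M\<close> of \<^const>\<open>PGL\<close> is a coset of matrices differing by nonzero scalars, so all of
  them map a line \<open>p\<close> onto the same line.\<close>

definition proj_act :: "(complex ^ 'n ^ 'n) set \<Rightarrow> (complex ^ 'n) set \<Rightarrow> (complex ^ 'n) set" where
  "proj_act M p = (\<Union>A\<in>M. (\<lambda>x. A *v x) ` p)"


section \<open>Smooth hypersurfaces\<close>

text \<open>A form of degree \<open>d\<close> is given by its coefficients \<open>c m\<close>, where \<open>m\<close> ranges over the exponent
  vectors of total degree \<open>d\<close>; the values of \<open>c\<close> at other exponent vectors are irrelevant.\<close>

definition exponents :: "nat \<Rightarrow> ('n::finite \<Rightarrow> nat) set" where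
  "exponents d = {m. (\<Sum>i\<in>UNIV. m i) = d}"

definition form_eval :: "nat \<Rightarrow> (('n::finite \<Rightarrow> nat) \<Rightarrow> complex) \<Rightarrow> complex ^ 'n \<Rightarrow> complex" where
  "form_eval d c x = (\<Sum>m\<in>exponents d. c m * (\<Prod>j\<in>UNIV. (x $ j) ^ m j))"

text \<open>The partial derivative with respect to the \<open>i\<close>-th variable, computed termwise. If \<open>m i = 0\<close>
  the term vanishes because of the factor \<open>of_nat (m i)\<close>.\<close>

definition form_partial ::
  "nat \<Rightarrow> (('n::finite \<Rightarrow> nat) \<Rightarrow> complex) \<Rightarrow> 'n \<Rightarrow> complex ^ 'n \<Rightarrow> complex" where
  "form_partial d c i x =
     (\<Sum>m\<in>exponents d. c m * of_nat (m i) * (\<Prod>j\<in>UNIV. (x $ j) ^ (m(i := m i - 1)) j))"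

definition hypersurface :: "nat \<Rightarrow> (('n::finite \<Rightarrow> nat) \<Rightarrow> complex) \<Rightarrow> (complex ^ 'n) set set" where
  "hypersurface d c = {p \<in> proj_space. \<forall>x\<in>p. form_eval d c x = 0}"

text \<open>The Jacobian criterion. In particular the zero form is not smooth.\<close>

definition smooth_form :: "nat \<Rightarrow> (('n::finite \<Rightarrow> nat) \<Rightarrow> complex) \<Rightarrow> bool" where
  "smooth_form d c \<longleftrightarrow>
     (\<forall>x. x \<noteq> 0 \<longrightarrow> form_eval d c x = 0 \<longrightarrow> (\<exists>i. form_partial d c i x \<noteq> 0))"

definition smooth_cubic_fourfold :: "(complex ^ 6) set set \<Rightarrow> bool" where
  "smooth_cubic_fourfold X \<longleftrightarrow> (\<exists>c. smooth_form 3 c \<and> X = hypersurface 3 c)"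

definition acts_effectively_on_cubic_fourfold :: "('a, 'b) monoid_scheme \<Rightarrow> bool" where
  "acts_effectively_on_cubic_fourfold G \<longleftrightarrow>
     (\<exists>\<phi> X. \<phi> \<in> hom G (PGL :: (complex ^ 6 ^ 6) set monoid) \<and> inj_on \<phi> (carrier G) \<and>
        smooth_cubic_fourfold X \<and> (\<forall>g\<in>carrier G. proj_act (\<phi> g) ` X \<subseteq> X))"


section \<open>Finite abelian groups\<close>

text \<open>The direct sum of the cyclic groups of orders \<open>ns ! 0, ns ! 1, \<dots>\<close>\<close>

definition cyclic_sum :: "nat list \<Rightarrow> (nat \<Rightarrow> int) monoid" where
  "cyclic_sum ns = product_group {..<length ns} (\<lambda>i. integer_mod_group (ns ! i))"

definition isomorphic_to_subgroup ::
  "('a, 'c) monoid_scheme \<Rightarrow> ('b, 'd) monoid_scheme \<Rightarrow> bool" where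
  "isomorphic_to_subgroup G K \<longleftrightarrow> (\<exists>H. subgroup H K \<and> G \<cong> K\<lparr>carrier := H\<rparr>)"

end

theory Submission
  imports Defs "HOL-Library.Multiset" "HOL-Library.Function_Algebras"
    "HOL-Algebra.Multiplicative_Group" "HOL-Computational_Algebra.Primes"
    "HOL-Computational_Algebra.Fundamental_Theorem_Algebra"
begin

text \<open>
  A finite abelian group is isomorphic to a subgroup of a sum of cyclic groups of orders \<open>ns\<close> if and
  only if it has characters of orders dividing these which jointly separate its points. This is the property
  \<open>embeds_in\<close>, and both directions of the theorem are statements about characters.

  From an action to the list. Let \<open>G\<close> act on the fourfold \<open>F = 0\<close>. A matrix \<open>A\<close> over \<open>g\<close> maps zeros of \<open>F\<close>
  to zeros of \<open>F\<close>; as a smooth form is determined by its zeros up to a factor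
  (\<open>proportional_if_vanishing\<close>), \<open>A\<close> can be rescaled such that \<open>F \<circ> A = F\<close>. These lifts are unique up to
  cube roots of unity. They form a projective representation whose commutators are cube roots
  of unity (the locale \<open>cubic_representation\<close>).

  If the lifts commute, they are diagonal in a suitable basis, and only the set \<open>R\<close> of the monomials of
  \<open>F\<close> in the corresponding coordinates \<open>x\<^sub>i\<close> matters: eigenvalues satisfy \<open>t\<^sub>i t\<^sub>j t\<^sub>k = 1\<close>
  for each monomial \<open>x\<^sub>i x\<^sub>j x\<^sub>k\<close> of \<open>F\<close>. Smoothness enters through \<open>monomial_exists\<close>: if no monomial
  \<open>x\<^sub>i x\<^sub>k x\<^sub>l\<close> with \<open>i, k \<in> S\<close> and \<open>l \<notin> U\<close> occurs and \<open>U\<close> has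
  at most two elements and fewer than \<open>S\<close>, then on the linear
  space with coordinates \<open>x\<^sub>i\<close>, \<open>i \<in> S\<close>, only the quadrics \<open>\<partial>F/\<partial>x\<^sub>l\<close>, \<open>l \<in> U\<close>, do not vanish
  identically, and they have a common zero, a singular point. For singletons \<open>S\<close> and empty \<open>U\<close> this
  gives a map \<open>\<sigma>\<close> such that \<open>x\<^sub>i\<^sup>2 x\<^bsub>\<sigma> i\<^esub>\<close> occurs, so \<open>t\<^bsub>\<sigma> i\<^esub>\<close> is the inverse square of
  \<open>t\<^sub>i\<close>. On a cycle of \<open>\<sigma>\<close> of length \<open>p\<close> the eigenvalues therefore have order dividing
  3, 3, 9, 15, 33, 63 for \<open>p = 1, \<dots>, 6\<close>. The elements which are scalar on
  all cycles form a 2-group \<open>K\<close>, of order at most \<open>2 ^ (6 - c)\<close> where \<open>c\<close> is the number of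
  periodic indices, because each further index costs one square root. Going through the possible
  cycles, the characters of odd order coming from them and the cyclic factors of \<open>K\<close> give a subgroup
  of one of the listed groups, apart from a few combinations which the order of \<open>K\<close> alone would
  permit. These are excluded by smoothness: \<open>two_rank_bound\<close> and
  \<open>two_rank_order_32\<close> bound the 2-rank of a large \<open>K\<close>, and \<open>conflict_at_cycle\<close> shows that long cycles
  with few further indices leave little room for elements of even order.

  If the lifts of two elements do not commute, each eigenspace of their common centralizer \<open>Z\<close> in \<open>G\<close> has
  dimension at least 3 (\<open>eigenvector_class_size\<close>). So \<open>Z\<close> has at most two weights, their quotient
  embeds \<open>Z\<close> into the square or the cube roots of unity, and \<open>G\<close> is a subgroup of a
  group of type 3, 3, 2 or a 3-group of order at most 27 and exponent at most 9.

  From the list to an action. If \<open>s\<close> is injective on the set of indices which it moves, then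
  \<open>\<Sum>\<^sub>i x\<^sub>i\<^sup>2 x\<^bsub>s i\<^esub>\<close> is smooth (\<open>smooth_graph_form\<close>), and its diagonal symmetries are given by
  linear congruences. For each of the eighteen groups a suitable \<open>s\<close> and the weights of a
  faithful diagonal action are written down in \<open>certificates\<close>.
\<close>

section \<open>Characters of finite abelian groups\<close>

definition character :: "('a, 'b) monoid_scheme \<Rightarrow> ('a \<Rightarrow> complex) \<Rightarrow> bool" where
  "character G \<xi> \<longleftrightarrow> (\<forall>x\<in>carrier G. \<xi> x \<noteq> 0) \<and>
     (\<forall>x\<in>carrier G. \<forall>y\<in>carrier G. \<xi> (x \<otimes>\<^bsub>G\<^esub> y) = \<xi> x * \<xi> y)"

text \<open>The multiset pairs every character with a bound for its order, so that the same order may occur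
  several times. This amounts to an embedding into the sum of the cyclic groups of orders in \<open>M\<close>, without
  fixing the sequence of the summands.\<close>

definition embeds_in :: "('a, 'b) monoid_scheme \<Rightarrow> nat multiset \<Rightarrow> bool" where
  "embeds_in G M \<longleftrightarrow> (\<exists>C. image_mset snd C = M \<and> (\<forall>\<xi> n. (\<xi>, n) \<in># C \<longrightarrow> character G \<xi>) \<and>
    (\<forall>\<xi> n x. (\<xi>, n) \<in># C \<longrightarrow> x \<in> carrier G \<longrightarrow> \<xi> x ^ n = 1) \<and>
    (\<forall>x. x \<in> carrier G \<longrightarrow> (\<forall>\<xi> n. (\<xi>, n) \<in># C \<longrightarrow> \<xi> x = 1) \<longrightarrow> x = \<one>\<^bsub>G\<^esub>))"

lemma character_one:
  assumes "group G" "character G \<xi>" shows "\<xi> \<one>\<^bsub>G\<^esub> = 1"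
proof -
  interpret group G by fact
  have "\<xi> (\<one>\<^bsub>G\<^esub> \<otimes>\<^bsub>G\<^esub> \<one>\<^bsub>G\<^esub>) = \<xi> \<one>\<^bsub>G\<^esub> * \<xi> \<one>\<^bsub>G\<^esub>" "\<xi> \<one>\<^bsub>G\<^esub> \<noteq> 0"
    using assms(2) unfolding character_def by blast+
  then show ?thesis by simp
qed

lemma character_pow:
  assumes "group G" "character G \<xi>" "x \<in> carrier G"
  shows "\<xi> (x [^]\<^bsub>G\<^esub> (k::nat)) = \<xi> x ^ k"
proof -
  interpret group G by fact
  show ?thesis
    by (induction k) (use assms in \<open>auto simp: character_one character_def\<close>)
qed

lemma character_inv:
  assumes "group G" "character G \<xi>" "x \<in> carrier G"
  shows "\<xi> (inv\<^bsub>G\<^esub> x) = inverse (\<xi> x)"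
proof -
  interpret group G by fact
  have "\<xi> (inv\<^bsub>G\<^esub> x \<otimes>\<^bsub>G\<^esub> x) = \<xi> (inv\<^bsub>G\<^esub> x) * \<xi> x"
    using assms unfolding character_def by blast
  then show ?thesis
    using assms character_one[OF assms(1,2)] by (simp add: l_inv field_simps inverse_eq_divide character_def)
qed

lemma character_power: "character G \<xi> \<Longrightarrow> character G (\<lambda>x. \<xi> x ^ k)"
  by (auto simp: character_def power_mult_distrib)

lemma character_1: "character G (\<lambda>x. 1)"
  by (auto simp: character_def)

lemma character_prod:
  "(\<And>i. i \<in> I \<Longrightarrow> character G (f i)) \<Longrightarrow> character G (\<lambda>x. \<Prod>i\<in>I. f i x)"
  by (induction I rule: infinite_finite_induct) (auto simp: character_def)

lemma embeds_inI:
  assumes "\<And>\<xi> n. (\<xi>, n) \<in># C \<Longrightarrow> character G \<xi>"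
    and "\<And>\<xi> n x. (\<xi>, n) \<in># C \<Longrightarrow> x \<in> carrier G \<Longrightarrow> \<xi> x ^ n = 1"
    and "\<And>x. x \<in> carrier G \<Longrightarrow> (\<And>\<xi> n. (\<xi>, n) \<in># C \<Longrightarrow> \<xi> x = 1) \<Longrightarrow> x = \<one>\<^bsub>G\<^esub>"
  shows "embeds_in G (image_mset snd C)"
  unfolding embeds_in_def
proof (rule exI[of _ C], intro conjI allI impI)
  fix x assume "x \<in> carrier G" "\<forall>\<xi> n. (\<xi>, n) \<in># C \<longrightarrow> \<xi> x = 1"
  then show "x = \<one>\<^bsub>G\<^esub>" by (intro assms(3)) auto
qed (rule refl assms; assumption)+

lemma embeds_in_mono:
  assumes "embeds_in G M" "M \<subseteq># N" shows "embeds_in G N"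
proof -
  obtain C where C': "image_mset snd C = M" "\<forall>\<xi> n. (\<xi>, n) \<in># C \<longrightarrow> character G \<xi>"
    "\<forall>\<xi> n x. (\<xi>, n) \<in># C \<longrightarrow> x \<in> carrier G \<longrightarrow> \<xi> x ^ n = 1"
    "\<forall>x. x \<in> carrier G \<longrightarrow> (\<forall>\<xi> n. (\<xi>, n) \<in># C \<longrightarrow> \<xi> x = 1) \<longrightarrow> x = \<one>\<^bsub>G\<^esub>"
    using assms(1) unfolding embeds_in_def by blast
  note C = C'[rule_format]
  have "embeds_in G (image_mset snd (C + image_mset (\<lambda>n. (\<lambda>x. 1, n)) (N - M)))"
  proof (rule embeds_inI)
    fix x assume "x \<in> carrier G"
      and "\<And>\<xi> n. (\<xi>, n) \<in># C + image_mset (\<lambda>n. (\<lambda>x. 1, n)) (N - M) \<Longrightarrow> \<xi> x = 1"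
    then show "x = \<one>\<^bsub>G\<^esub>" using C(4)[of x] by auto
  qed (use C(2,3) in \<open>auto simp: character_1\<close>)
  also have "image_mset snd (C + image_mset (\<lambda>n. (\<lambda>x. 1, n)) (N - M)) = N"
    using assms(2) C(1) by (simp add: multiset.map_comp o_def)
  finally show ?thesis .
qed

subsection \<open>Joint characters and subgroups of sums of cyclic groups\<close>

text \<open>The isomorphism between the integers modulo \<open>n\<close> and the \<open>n\<close>-th roots of unity, used to pass between
  characters and coordinates in \<open>cyclic_sum\<close>.\<close>

definition unity_root :: "nat \<Rightarrow> int \<Rightarrow> complex" where
  "unity_root n k = cis (2 * pi * of_int k / of_nat n)"

lemma unity_root_add: "unity_root n (k + l) = unity_root n k * unity_root n l"
  by (simp add: unity_root_def cis_mult distrib_left add_divide_distrib)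

lemma unity_root_mult_self: "n > 0 \<Longrightarrow> unity_root n (int n * q) = 1"
  using cis_multiple_2pi[of "of_int q"] by (simp add: unity_root_def mult.assoc)

lemma unity_root_mod: "n > 0 \<Longrightarrow> unity_root n (k mod int n) = unity_root n k"
proof -
  assume "n > 0"
  have "unity_root n k = unity_root n (int n * (k div int n) + k mod int n)" by simp
  then have "unity_root n k = unity_root n (int n * (k div int n)) * unity_root n (k mod int n)"
    by (metis unity_root_add)
  then show ?thesis using \<open>n > 0\<close> by (simp add: unity_root_mult_self)
qed

lemma unity_root_power: "unity_root n k ^ m = unity_root n (int m * k)"
  by (simp add: unity_root_def DeMoivre ac_simps)

lemma unity_root_eq_1: "n > 0 \<Longrightarrow> 0 \<le> k \<Longrightarrow> k < int n \<Longrightarrow> unity_root n k = 1 \<Longrightarrow> k = 0"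
proof -
  assume a: "n > 0" "0 \<le> k" "k < int n" "unity_root n k = 1"
  have "inj_on (\<lambda>k. cis (2 * pi * real k / real n)) {..<n}"
    using bij_betw_roots_unity[OF a(1)] by (simp add: bij_betw_def)
  moreover have "nat k \<in> {..<n}" "0 \<in> {..<n}" using a by auto
  moreover have "cis (2 * pi * real (nat k) / real n) = cis (2 * pi * real 0 / real n)"
    using a by (simp add: unity_root_def)
  ultimately have "nat k = 0" by (blast dest: inj_onD)
  then show ?thesis using a by simp
qed

lemma unity_root_surj:
  assumes "n > 0" "z ^ n = 1" obtains k where "0 \<le> k" "k < int n" "z = unity_root n k"
proof -
  have "z \<in> (\<lambda>k. cis (2 * pi * real k / real n)) ` {..<n}"
    using bij_betw_roots_unity[OF assms(1)] assms(2) by (simp add: bij_betw_def)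
  then obtain k where "k < n" "z = cis (2 * pi * real k / real n)" by auto
  then show ?thesis by (intro that[of "int k"]) (auto simp: unity_root_def)
qed

lemma list_of_image_mset:
  "image_mset f C = mset ns \<Longrightarrow> \<exists>cs. mset cs = C \<and> map f cs = ns"
proof (induction ns arbitrary: C)
  case (Cons n ns)
  then obtain a D where "C = add_mset a D" "f a = n" "image_mset f D = mset ns"
    using msed_map_invR[of f C n "mset ns"] by auto
  moreover from this obtain cs where "mset cs = D" "map f cs = ns" using Cons.IH by blast
  ultimately show ?case by (intro exI[of _ "a # cs"]) auto
qed auto

lemma group_cyclic_sum: "group (cyclic_sum ns)"
  by (simp add: cyclic_sum_def)

lemma isomorphic_to_subgroup_if_embeds_in:
  fixes G :: "('a, 'b) monoid_scheme"
  assumes "group G" "embeds_in G (mset ns)" "\<forall>n\<in>set ns. n > 0"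
  shows "isomorphic_to_subgroup G (cyclic_sum ns)"
proof -
  interpret group G by fact
  obtain C where C': "image_mset snd C = mset ns" "\<forall>\<xi> n. (\<xi>, n) \<in># C \<longrightarrow> character G \<xi>"
    "\<forall>\<xi> n x. (\<xi>, n) \<in># C \<longrightarrow> x \<in> carrier G \<longrightarrow> \<xi> x ^ n = 1"
    "\<forall>x. x \<in> carrier G \<longrightarrow> (\<forall>\<xi> n. (\<xi>, n) \<in># C \<longrightarrow> \<xi> x = 1) \<longrightarrow> x = \<one>\<^bsub>G\<^esub>"
    using assms(2) unfolding embeds_in_def by blast
  note C = C'[rule_format]
  obtain cs where cs: "mset cs = C" "map snd cs = ns" using list_of_image_mset[OF C(1)] by blast
  define \<xi> where "\<xi> i = fst (cs ! i)" for i
  have len: "length cs = length ns" using cs(2) by auto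
  have csi: "(\<xi> i, ns ! i) \<in># C" if "i < length ns" for i
  proof -
    have "snd (cs ! i) = ns ! i" using that len nth_map[of i cs snd] unfolding cs(2) by simp
    then have "(\<xi> i, ns ! i) = cs ! i" by (metis \<xi>_def prod.collapse)
    moreover have "cs ! i \<in> set cs" using that len by simp
    ultimately show ?thesis using cs(1) by (metis set_mset_mset)
  qed
  have pos: "ns ! i > 0" if "i < length ns" for i using assms(3) that by auto
  have ex: "\<exists>k. 0 \<le> k \<and> k < int (ns ! i) \<and> \<xi> i x = unity_root (ns ! i) k"
    if "i < length ns" "x \<in> carrier G" for i x
    using unity_root_surj[OF pos[OF that(1)] C(3)[OF csi[OF that(1)] that(2)]] by metis
  define h where "h x = (\<lambda>i\<in>{..<length ns}.
     SOME k. 0 \<le> k \<and> k < int (ns ! i) \<and> \<xi> i x = unity_root (ns ! i) k)" for x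
  have h: "0 \<le> h x i \<and> h x i < int (ns ! i) \<and> \<xi> i x = unity_root (ns ! i) (h x i)"
    if "i < length ns" "x \<in> carrier G" for i x
    using someI_ex[OF ex[OF that]] that by (simp add: h_def)
  have uniq: "k = l" if "i < length ns" "0 \<le> k" "k < int (ns ! i)" "0 \<le> l" "l < int (ns ! i)"
    "unity_root (ns ! i) k = unity_root (ns ! i) l" for i k l
  proof -
    have "unity_root (ns ! i) (k - l) * unity_root (ns ! i) l = unity_root (ns ! i) l"
      using that(6) unity_root_add[of "ns ! i" "k - l" l] by simp
    then have "unity_root (ns ! i) ((k - l) mod int (ns ! i)) = 1"
      using pos[OF that(1)] by (simp add: unity_root_mod) (simp add: unity_root_def)
    then have "(k - l) mod int (ns ! i) = 0"
      by (intro unity_root_eq_1) (use pos[OF that(1)] in auto)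
    then have "k mod int (ns ! i) = l mod int (ns ! i)" by (simp add: mod_eq_dvd_iff mod_0_imp_dvd)
    then show ?thesis using that by simp
  qed
  have carr: "h x \<in> carrier (cyclic_sum ns)" if "x \<in> carrier G" for x
    using h that by (auto simp: cyclic_sum_def carrier_integer_mod_group h_def PiE_iff dest: pos)
  have hom: "h \<in> hom G (cyclic_sum ns)"
  proof (rule homI)
    fix x y assume xy: "x \<in> carrier G" "y \<in> carrier G"
    show "h (x \<otimes>\<^bsub>G\<^esub> y) = h x \<otimes>\<^bsub>cyclic_sum ns\<^esub> h y"
    proof
      fix i show "h (x \<otimes>\<^bsub>G\<^esub> y) i = (h x \<otimes>\<^bsub>cyclic_sum ns\<^esub> h y) i"
      proof (cases "i < length ns")
        case True
        have "h (x \<otimes>\<^bsub>G\<^esub> y) i = (h x i + h y i) mod int (ns ! i)"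
        proof (rule uniq[OF True])
          have "unity_root (ns ! i) (h (x \<otimes>\<^bsub>G\<^esub> y) i) = \<xi> i (x \<otimes>\<^bsub>G\<^esub> y)" using h[OF True] xy by simp
          also have "\<dots> = \<xi> i x * \<xi> i y" using C(2)[OF csi[OF True]] xy by (auto simp: character_def)
          also have "\<dots> = unity_root (ns ! i) (h x i + h y i)"
            using h[OF True] xy by (simp add: unity_root_add)
          finally show "unity_root (ns ! i) (h (x \<otimes>\<^bsub>G\<^esub> y) i)
             = unity_root (ns ! i) ((h x i + h y i) mod int (ns ! i))"
            using pos[OF True] by (simp add: unity_root_mod)
        qed (use h[OF True] xy pos[OF True] in auto)
        then show ?thesis using True by (simp add: cyclic_sum_def)
      qed (simp add: cyclic_sum_def h_def)
    qed
  qed (use carr in auto)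
  have inj: "inj_on h (carrier G)"
  proof -
    interpret group_hom G "cyclic_sum ns" h
      using group_cyclic_sum hom by (simp add: group_hom_def group_hom_axioms_def is_group)
    show ?thesis unfolding inj_on_one_iff
    proof (intro allI impI)
      fix x assume x: "x \<in> carrier G" and "h x = \<one>\<^bsub>cyclic_sum ns\<^esub>"
      then have "h x i = 0" if "i < length ns" for i using that by (simp add: cyclic_sum_def)
      then have 1: "\<xi> i x = 1" if "i < length ns" for i using that h[OF that x] by (simp add: unity_root_def)
      have 2: "\<exists>i<length ns. \<psi> = \<xi> i" if "(\<psi>, n) \<in># C" for \<psi> n
        using that len by (auto simp: cs(1)[symmetric] in_set_conv_nth \<xi>_def)
      show "x = \<one>\<^bsub>G\<^esub>"
      proof (rule C(4)[OF x])
        fix \<psi> n assume "(\<psi>, n) \<in># C"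
        then show "\<psi> x = 1" using 1 2 by metis
      qed
    qed
  qed
  have sub: "subgroup (h ` carrier G) (cyclic_sum ns)"
    using group_hom.img_is_subgroup[of G "cyclic_sum ns" h] hom group_cyclic_sum
    by (simp add: group_hom_def group_hom_axioms_def is_group)
  have "h \<in> iso G (cyclic_sum ns\<lparr>carrier := h ` carrier G\<rparr>)"
    using hom inj by (auto simp: iso_def hom_def bij_betw_def)
  then show ?thesis unfolding isomorphic_to_subgroup_def using sub by (auto intro: is_isoI)
qed

lemma embeds_in_if_isomorphic_to_subgroup:
  fixes G :: "('a, 'b) monoid_scheme"
  assumes "group G" "isomorphic_to_subgroup G (cyclic_sum ns)" "\<forall>n\<in>set ns. n > 0"
  shows "\<exists>\<xi>. (\<forall>i<length ns. character G (\<xi> i) \<and> (\<forall>x\<in>carrier G. \<xi> i x ^ (ns ! i) = 1)) \<and>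
     (\<forall>x\<in>carrier G. (\<forall>i<length ns. \<xi> i x = 1) \<longrightarrow> x = \<one>\<^bsub>G\<^esub>)"
proof -
  interpret group G by fact
  obtain H f where H: "subgroup H (cyclic_sum ns)" and f: "f \<in> iso G (cyclic_sum ns\<lparr>carrier := H\<rparr>)"
    using assms(2) unfolding isomorphic_to_subgroup_def is_iso_def by auto
  have pos: "ns ! i > 0" if "i < length ns" for i using assms(3) that by auto
  have fH: "f x \<in> H" if "x \<in> carrier G" for x using f that by (auto simp: iso_def hom_def)
  then have fc: "f x \<in> carrier (cyclic_sum ns)" if "x \<in> carrier G" for x
    using that subgroup.subset[OF H] by auto
  have fi: "0 \<le> f x i \<and> f x i < int (ns ! i)" if "x \<in> carrier G" "i < length ns" for x i
  proof -
    have "f x i \<in> carrier (integer_mod_group (ns ! i))"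
      using fc[OF that(1)] that(2) by (simp add: cyclic_sum_def PiE_iff)
    then show ?thesis using pos[OF that(2)] by (simp add: carrier_integer_mod_group)
  qed
  have mult: "f (x \<otimes>\<^bsub>G\<^esub> y) i = (f x i + f y i) mod int (ns ! i)"
    if "x \<in> carrier G" "y \<in> carrier G" "i < length ns" for x y i
    using f that by (auto simp: iso_def hom_def cyclic_sum_def)
  interpret gh: group_hom G "cyclic_sum ns\<lparr>carrier := H\<rparr>" f
    using f subgroup.subgroup_is_group[OF H group_cyclic_sum]
    by (simp add: group_hom_def group_hom_axioms_def iso_def is_group)
  have ker: "x = \<one>\<^bsub>G\<^esub>" if "x \<in> carrier G" "\<forall>i<length ns. f x i = 0" for x
  proof -
    have "f x = \<one>\<^bsub>cyclic_sum ns\<^esub>"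
      using fc[OF that(1)] that(2) by (auto simp: cyclic_sum_def PiE_iff extensional_def)
    then have "f x = f \<one>\<^bsub>G\<^esub>" using gh.hom_one by simp
    moreover have "inj_on f (carrier G)" using f by (simp add: iso_def bij_betw_def)
    ultimately show ?thesis using that(1) by (metis inj_onD one_closed)
  qed
  show ?thesis
  proof (intro exI conjI allI impI ballI)
    fix i assume i: "i < length ns"
    show "character G ((\<lambda>i x. unity_root (ns ! i) (f x i)) i)"
      unfolding character_def
    proof (intro conjI ballI)
      fix x y assume "x \<in> carrier G" "y \<in> carrier G"
      then show "unity_root (ns ! i) (f (x \<otimes>\<^bsub>G\<^esub> y) i)
         = unity_root (ns ! i) (f x i) * unity_root (ns ! i) (f y i)"
        by (simp add: mult i unity_root_mod pos unity_root_add del: gh.hom_mult)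
    qed (simp add: unity_root_def)
    fix x assume "x \<in> carrier G"
    show "unity_root (ns ! i) (f x i) ^ (ns ! i) = 1"
      using pos[OF i] by (simp add: unity_root_power unity_root_mult_self)
  next
    fix x assume x: "x \<in> carrier G" and "\<forall>i<length ns. unity_root (ns ! i) (f x i) = 1"
    then have "f x i = 0" if "i < length ns" for i
      using unity_root_eq_1[OF pos[OF that]] fi[OF x that] that by simp
    then show "x = \<one>\<^bsub>G\<^esub>" using ker[OF x] by simp
  qed
qed

lemma power_eq_1_gcd:
  fixes z :: "'a :: field"
  assumes "z ^ a = 1" "z ^ b = 1" shows "z ^ gcd a b = 1"
proof (cases "a = 0")
  case False
  then obtain x y where "a * x = b * y + gcd a b" using bezout_nat by blast
  then have "z ^ (a * x) = z ^ (b * y) * z ^ gcd a b" by (simp add: power_add)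
  then show ?thesis using assms by (simp add: power_mult)
qed (use assms in auto)

lemma mem_joint_kernel:
  assumes "x \<in> carrier G" "\<And>\<xi> n. (\<xi>, n) \<in># C \<Longrightarrow> \<xi> x = 1"
  shows "x \<in> {x \<in> carrier G. \<forall>\<xi> n. (\<xi>, n) \<in># C \<longrightarrow> \<xi> x = 1}"
  unfolding mem_Collect_eq by (intro conjI allI impI assms) assumption

text \<open>The given characters have orders dividing \<open>q\<close>, so the power map with exponent \<open>q\<close> sends \<open>G\<close> into their joint
  kernel \<open>K\<close>. Pulling the characters of \<open>K\<close> back along this map extends their \<open>q\<close>-th powers to \<open>G\<close>, and on \<open>K\<close>
  nothing is lost because \<open>q\<close> is coprime to their orders.\<close>

lemma embeds_in_split:
  fixes G (structure)
  assumes "comm_group G"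
    and C: "\<And>\<xi> n. (\<xi>, n) \<in># C \<Longrightarrow> character G \<xi>"
      "\<And>\<xi> n x. (\<xi>, n) \<in># C \<Longrightarrow> x \<in> carrier G \<Longrightarrow> \<xi> x ^ n = 1"
    and K: "K = {x \<in> carrier G. \<forall>\<xi> n. (\<xi>, n) \<in># C \<longrightarrow> \<xi> x = 1}"
    and M: "embeds_in (G\<lparr>carrier := K\<rparr>) M"
    and q: "\<And>n. n \<in># image_mset snd C \<Longrightarrow> n dvd q" "\<And>m. m \<in># M \<Longrightarrow> coprime q m"
  shows "embeds_in G (image_mset snd C + M)"
proof -
  interpret comm_group G by fact
  obtain D where D': "image_mset snd D = M" "\<forall>\<xi> n. (\<xi>, n) \<in># D \<longrightarrow> character (G\<lparr>carrier := K\<rparr>) \<xi>"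
    "\<forall>\<xi> n x. (\<xi>, n) \<in># D \<longrightarrow> x \<in> carrier (G\<lparr>carrier := K\<rparr>) \<longrightarrow> \<xi> x ^ n = 1"
    "\<forall>x. x \<in> carrier (G\<lparr>carrier := K\<rparr>) \<longrightarrow> (\<forall>\<xi> n. (\<xi>, n) \<in># D \<longrightarrow> \<xi> x = 1) \<longrightarrow> x = \<one>\<^bsub>G\<lparr>carrier := K\<rparr>\<^esub>"
    using M unfolding embeds_in_def by blast
  note D = D'[rule_format]
  have Kmul: "x \<otimes> y \<in> K" if "x \<in> K" "y \<in> K" for x y
  proof -
    have "\<xi> (x \<otimes> y) = 1" if "(\<xi>, n) \<in># C" for \<xi> n
    proof -
      have "\<xi> x = 1" "\<xi> y = 1" "x \<in> carrier G" "y \<in> carrier G"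
        using that \<open>x \<in> K\<close> \<open>y \<in> K\<close> unfolding K by blast+
      then show ?thesis using C(1)[OF that] by (simp add: character_def)
    qed
    then show ?thesis unfolding K by (intro mem_joint_kernel m_closed) (use that K in auto)
  qed
  have K1: "\<one> \<in> K"
    unfolding K by (rule mem_joint_kernel) (auto intro: character_one[OF is_group] C(1))
  have powK: "x [^] q \<in> K" if "x \<in> carrier G" for x
  proof -
    have "\<xi> (x [^] q) = 1" if "(\<xi>, n) \<in># C" for \<xi> n
    proof -
      have "n \<in># image_mset snd C" using that by force
      then obtain r where "q = n * r" using q(1) by (blast elim: dvdE)
      then show ?thesis
        using character_pow[OF is_group C(1)[OF that] \<open>x \<in> carrier G\<close>] C(2)[OF that \<open>x \<in> carrier G\<close>]
        by (simp add: power_mult)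
    qed
    then show ?thesis unfolding K by (intro mem_joint_kernel nat_pow_closed that)
  qed
  have Dpow: "\<psi> (x [^] q) = \<psi> x ^ q" if "(\<psi>, m) \<in># D" "x \<in> K" for \<psi> m x
  proof -
    have ch: "character (G\<lparr>carrier := K\<rparr>) \<psi>" using D(2) that by blast
    have mul: "\<forall>x\<in>K. \<forall>y\<in>K. \<psi> (x \<otimes> y) = \<psi> x * \<psi> y" "\<forall>x\<in>K. \<psi> x \<noteq> 0"
      using ch by (simp_all add: character_def)
    have one: "\<psi> \<one> = 1"
      using bspec[OF bspec[OF mul(1) K1] K1] bspec[OF mul(2) K1] by simp
    have "x [^] k \<in> K \<and> \<psi> (x [^] k) = \<psi> x ^ k" for k :: nat
      by (induction k) (use mul K1 one Kmul that in simp_all)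
    then show ?thesis by blast
  qed
  define D2 where "D2 = image_mset (\<lambda>(\<psi>, m). (\<lambda>x. \<psi> (x [^] q), m)) D"
  have "embeds_in G (image_mset snd (C + D2))"
  proof (rule embeds_inI)
    fix \<xi> n assume "(\<xi>, n) \<in># C + D2"
    then consider "(\<xi>, n) \<in># C" | \<psi> where "(\<psi>, n) \<in># D" "\<xi> = (\<lambda>x. \<psi> (x [^] q))"
      by (auto simp: D2_def)
    then show "character G \<xi>"
    proof cases
      case 2
      have "character (G\<lparr>carrier := K\<rparr>) \<psi>" using D(2) 2 by blast
      then show ?thesis using powK 2(2) by (auto simp: character_def pow_mult_distrib m_comm)
    qed (rule C)
  next
    fix \<xi> n x assume "(\<xi>, n) \<in># C + D2" and x: "x \<in> carrier G"
    then consider "(\<xi>, n) \<in># C" | \<psi> where "(\<psi>, n) \<in># D" "\<xi> = (\<lambda>x. \<psi> (x [^] q))"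
      by (auto simp: D2_def)
    then show "\<xi> x ^ n = 1"
      by cases (use C(2) x powK[OF x] D(3) in auto)
  next
    fix x assume x: "x \<in> carrier G" and *: "\<And>\<xi> n. (\<xi>, n) \<in># C + D2 \<Longrightarrow> \<xi> x = 1"
    have "\<xi> x = 1" if "(\<xi>, n) \<in># C" for \<xi> n using *[of \<xi> n] that by simp
    then have xK: "x \<in> K" unfolding K by (intro mem_joint_kernel x)
    have "\<psi> x = 1" if "(\<psi>, m) \<in># D" for \<psi> m
    proof -
      have "(\<lambda>x. \<psi> (x [^] q), m) \<in># C + D2" using that by (force simp: D2_def)
      from *[OF this] have "\<psi> x ^ q = 1" using Dpow[OF that xK] by simp
      moreover have "\<psi> x ^ m = 1" using D(3)[OF that] xK by simp
      moreover have "coprime q m"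
      proof (rule q(2))
        show "m \<in># M" using that D(1) by force
      qed
      ultimately show ?thesis using power_eq_1_gcd[of "\<psi> x" q m] by simp
    qed
    then show "x = \<one>" using D(4)[of x] xK by simp
  qed
  moreover have "image_mset snd D2 = M"
    using D(1) by (auto simp: D2_def multiset.map_comp o_def case_prod_beta)
  ultimately show ?thesis by simp
qed

subsection \<open>Common eigenvectors\<close>

text \<open>An operator \<open>f\<close> of order \<open>n\<close> splits every vector into eigenvectors by discrete Fourier transform over its powers,
  and the components are still eigenvectors of everything that commutes with \<open>f\<close>. The statement is about an
  arbitrary vector space because it is applied both to functions on a group and to the
  coordinate space.\<close>

lemma common_eigenvectors_span:
  fixes scale :: "complex \<Rightarrow> 'v::ab_group_add \<Rightarrow> 'v"
  assumes "vector_space scale" and "finite F"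
    and add: "\<And>f x y. f \<in> F \<Longrightarrow> f (x + y) = f x + f y"
    and hom: "\<And>f c x. f \<in> F \<Longrightarrow> f (scale c x) = scale c (f x)"
    and fin: "\<And>f. f \<in> F \<Longrightarrow> \<exists>n>0. f ^^ n = id"
    and comm: "\<And>f g x. f \<in> F \<Longrightarrow> g \<in> F \<Longrightarrow> f (g x) = g (f x)"
  shows "v \<in> module.span scale {w. \<forall>f\<in>F. \<exists>c. f w = scale c w}"
proof -
  interpret vector_space scale by fact
  show ?thesis using assms(2-)
  proof (induction F arbitrary: v rule: finite_induct)
    case empty
    then show ?case by (simp add: span_base)
  next
    case (insert f F)
    let ?E = "\<lambda>F. {w. \<forall>f\<in>F. \<exists>c. f w = scale c w}"
    have "?E F \<subseteq> span (?E (insert f F))"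
    proof
      fix w assume w: "w \<in> ?E F"
      obtain n where n: "n > 0" "f ^^ n = id" using insert.prems(3) by blast
      define \<eta> where "\<eta> = unity_root n 1"
      have \<eta>: "\<eta> ^ n = 1" "\<eta> \<noteq> 0"
        using unity_root_mult_self[OF n(1), of 1] by (simp_all add: \<eta>_def unity_root_power) (simp add: unity_root_def)
      have \<eta>1: "\<eta> ^ j \<noteq> 1" if "0 < j" "j < n" for j
        using unity_root_eq_1[OF n(1), of "int j"] that by (auto simp: \<eta>_def unity_root_power)
      have fadd: "f (x + y) = f x + f y" and fhom: "f (scale c x) = scale c (f x)" for x y c
        using insert.prems by auto
      have f0: "f 0 = 0" using fhom[of 0 0] by simp
      have fsum: "f (sum h A) = (\<Sum>j\<in>A. f (h j))" for h and A :: "nat set"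
        by (induction A rule: infinite_finite_induct) (auto simp: f0 fadd)
      \<comment> \<open>The Fourier components of \<open>w\<close>; they add up to \<open>n\<close> times \<open>w\<close>.\<close>
      define u where "u k = (\<Sum>j<n. scale (\<eta> ^ (j * k)) ((f ^^ j) w))" for k
      have fu: "f (u k) = scale (inverse (\<eta> ^ k)) (u k)" for k
      proof -
        define h where "h j = scale (\<eta> ^ (j * k)) ((f ^^ j) w)" for j
        have "(\<Sum>j<n. h (Suc j)) + h 0 = (\<Sum>j<n. h j) + h n"
          using sum.lessThan_Suc[of h n] sum.lessThan_Suc_shift[of h n] by simp
        moreover have "h n = h 0" using n(2) \<eta>(1) by (simp add: h_def power_mult)
        ultimately have "u k = (\<Sum>j<n. h (Suc j))" by (simp add: u_def h_def)
        also have "\<dots> = scale (\<eta> ^ k) (f (u k))"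
          by (simp add: h_def u_def fsum fhom scale_sum_right power_add)
        finally have "scale (inverse (\<eta> ^ k)) (u k) = scale (inverse (\<eta> ^ k)) (scale (\<eta> ^ k) (f (u k)))"
          by (rule arg_cong)
        then show ?thesis using \<eta>(2) by simp
      qed
      have uE: "u k \<in> ?E (insert f F)" for k
      proof -
        have "\<exists>c. g (u k) = scale c (u k)" if g: "g \<in> F" for g
        proof -
          obtain c where c: "g w = scale c w" using w g by blast
          have gadd: "g (x + y) = g x + g y" and ghom: "g (scale c x) = scale c (g x)" for x y c
            using insert.prems g by auto
          have g0: "g 0 = 0" using ghom[of 0 0] by simp
          have gsum: "g (sum h A) = (\<Sum>j\<in>A. g (h j))" for h and A :: "nat set"
            by (induction A rule: infinite_finite_induct) (auto simp: g0 gadd)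
          have gf: "g ((f ^^ j) w) = scale c ((f ^^ j) w)" for j
          proof (induction j)
            case (Suc j)
            have "g (f ((f ^^ j) w)) = f (g ((f ^^ j) w))" using insert.prems(4) g by blast
            then show ?case using Suc fhom by simp
          qed (simp add: c)
          have "g (u k) = scale c (u k)"
            by (simp add: u_def gsum ghom gf scale_sum_right mult.commute)
          then show ?thesis by blast
        qed
        then show ?thesis using fu by blast
      qed
      have "(\<Sum>k<n. u k) = (\<Sum>j<n. \<Sum>k<n. scale (\<eta> ^ (j * k)) ((f ^^ j) w))"
        unfolding u_def by (rule sum.swap)
      also have "\<dots> = (\<Sum>j<n. if j = 0 then scale (of_nat n) w else 0)"
      proof (rule sum.cong[OF refl])
        fix j assume j: "j \<in> {..<n}"
        have "(\<Sum>k<n. scale (\<eta> ^ (j * k)) ((f ^^ j) w)) = scale (\<Sum>k<n. (\<eta> ^ j) ^ k) ((f ^^ j) w)"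
          by (simp add: scale_sum_left power_mult)
        also have "(\<Sum>k<n. (\<eta> ^ j) ^ k) = (if j = 0 then of_nat n else 0)"
        proof (cases "j = 0")
          case False
          have "(\<eta> ^ j) ^ n = 1" using \<eta>(1) by (metis mult.commute power_mult power_one)
          then show ?thesis using \<eta>1[of j] False j by (simp add: sum_gp_strict)
        qed simp
        finally show "(\<Sum>k<n. scale (\<eta> ^ (j * k)) ((f ^^ j) w)) = (if j = 0 then scale (of_nat n) w else 0)"
          by simp
      qed
      also have "\<dots> = scale (of_nat n) w" using n(1) by simp
      finally have w_eq: "w = scale (inverse (of_nat n)) (\<Sum>k<n. u k)" using n(1) by simp
      have u_span: "(\<Sum>k<n. u k) \<in> span (?E (insert f F))"
        using uE by (intro span_sum span_base)
      show "w \<in> span (?E (insert f F))" by (subst w_eq) (rule span_scale[OF u_span])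
    qed
    then have "span (?E F) \<subseteq> span (?E (insert f F))" by (rule span_minimal) (rule subspace_span)
    moreover have "v \<in> span (?E F)" using insert.prems by (intro insert.IH) simp_all
    ultimately show ?case by (rule subsetD)
  qed
qed

text \<open>In the regular representation on functions the delta function at the unit is moved by \<open>x\<close>. It is a combination of
  common eigenvectors, so \<open>x\<close> moves one of these, and the eigenvalues of that one form a character.\<close>

lemma characters_separate_points:
  fixes G :: "('a, 'b) monoid_scheme" (structure)
  assumes "comm_group G" "finite (carrier G)" "x \<in> carrier G" "x \<noteq> \<one>\<^bsub>G\<^esub>"
  shows "\<exists>\<xi>. character G \<xi> \<and> \<xi> x \<noteq> 1"
proof -
  interpret comm_group G by fact
  define scale :: "complex \<Rightarrow> ('a \<Rightarrow> complex) \<Rightarrow> 'a \<Rightarrow> complex" where "scale c f = (\<lambda>y. c * f y)" for c f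
  interpret V: vector_space scale
    by unfold_locales (auto simp: scale_def fun_eq_iff algebra_simps)
  define R :: "'a \<Rightarrow> ('a \<Rightarrow> complex) \<Rightarrow> 'a \<Rightarrow> complex" where
    "R g f = (\<lambda>y. if y \<in> carrier G then f (y \<otimes> g) else f y)" for g f
  have R_mult: "R g (R h f) = R (g \<otimes> h) f" if "g \<in> carrier G" "h \<in> carrier G" for g h f
    using that by (auto simp: R_def fun_eq_iff m_assoc)
  have R_one: "R \<one> = id" by (auto simp: R_def fun_eq_iff)
  have R_pow: "R g ^^ n = R (g [^] n)" if "g \<in> carrier G" for g and n :: nat
    by (induction n) (use that in \<open>simp_all add: R_one comp_def R_mult m_comm\<close>)
  let ?E = "{w. \<forall>f\<in>R ` carrier G. \<exists>c. f w = scale c w}"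
  define \<delta> :: "'a \<Rightarrow> complex" where "\<delta> y = (if y = \<one> then 1 else 0)" for y
  have "\<delta> \<in> V.span ?E"
  proof (rule common_eigenvectors_span[OF V.vector_space_axioms])
    fix f assume "f \<in> R ` carrier G"
    then obtain g where g: "g \<in> carrier G" "f = R g" by blast
    have "f ^^ Coset.order G = id" using g R_pow pow_order_eq_1 R_one by simp
    moreover have "Coset.order G > 0" using assms(2) by (simp add: order_gt_0_iff_finite)
    ultimately show "\<exists>n>0. f ^^ n = id" by blast
  next
    fix f h w assume "f \<in> R ` carrier G" "h \<in> R ` carrier G"
    then show "f (h w) = h (f w)" by (auto simp: R_mult m_comm)
  qed (use assms(2) in \<open>auto simp: R_def scale_def fun_eq_iff\<close>)
  moreover have "R x \<delta> \<noteq> \<delta>"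
  proof
    assume "R x \<delta> = \<delta>"
    then have "R x \<delta> \<one> = \<delta> \<one>" by simp
    then show False using assms(3,4) by (simp add: R_def \<delta>_def)
  qed
  ultimately obtain w where w: "w \<in> ?E" "R x w \<noteq> w"
  proof -
    have "V.subspace {v. R x v = v}"
      by (auto simp: V.subspace_def R_def scale_def fun_eq_iff)
    then have "V.span ?E \<subseteq> {v. R x v = v}" if "?E \<subseteq> {v. R x v = v}" using V.span_minimal that by blast
    then show thesis using that \<open>\<delta> \<in> V.span ?E\<close> \<open>R x \<delta> \<noteq> \<delta>\<close> by blast
  qed
  then have "\<forall>g\<in>carrier G. \<exists>c. R g w = scale c w" by auto
  then obtain c where c: "R g w = scale (c g) w" if "g \<in> carrier G" for g by metis
  obtain y where y: "w y \<noteq> 0"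
    using w(2) by (auto simp: R_def fun_eq_iff split: if_splits) metis
  have mult: "c (g \<otimes> h) = c g * c h" if "g \<in> carrier G" "h \<in> carrier G" for g h
  proof -
    have "R (g \<otimes> h) w = R g (R h w)" using that by (simp add: R_mult)
    also have "\<dots> = scale (c h) (R g w)" using c[OF that(2)] by (simp add: R_def scale_def fun_eq_iff)
    finally have "R (g \<otimes> h) w y = scale (c h) (R g w) y" by (rule fun_cong)
    then have "c (g \<otimes> h) * w y = c h * (c g * w y)"
      unfolding c[OF that(1)] c[OF m_closed[OF that]] by (simp only: scale_def)
    then show ?thesis using y by simp
  qed
  have "R \<one> w y = c \<one> * w y" unfolding c[OF one_closed] by (simp only: scale_def)
  then have one: "c \<one> = 1" using y by (simp add: R_one)
  have "c g \<noteq> 0" if "g \<in> carrier G" for g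
    using mult[of g "inv g"] one that by auto
  moreover have "c x \<noteq> 1" using w(2) c[OF assms(3)] by (auto simp: scale_def)
  ultimately show ?thesis using mult by (intro exI[of _ c]) (auto simp: character_def)
qed

subsection \<open>Decomposition of abelian p-groups\<close>

lemma power_eq_1_imp_dvd_prime_power:
  fixes z :: "'a :: field"
  assumes "prime (p::nat)" "z ^ (p ^ e) = 1" "z ^ (p ^ (e - 1)) \<noteq> 1" "z ^ j = 1"
  shows "p ^ e dvd j"
proof -
  have g: "z ^ gcd j (p ^ e) = 1" using power_eq_1_gcd assms(2,4) by blast
  obtain f where f: "f \<le> e" "gcd j (p ^ e) = p ^ f"
    using divides_primepow_nat[OF assms(1), of "gcd j (p ^ e)" e] by auto
  have "f = e"
  proof (rule ccontr)
    assume "f \<noteq> e"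
    then have "e - 1 = f + (e - 1 - f)" using f by simp
    then have "p ^ (e - 1) = p ^ f * p ^ (e - 1 - f)" by (metis power_add)
    then show False using g f(2) assms(3) by (simp add: power_mult)
  qed
  then show ?thesis using f(2) by (metis gcd_dvd1)
qed

lemma comm_group_subgroup:
  assumes "comm_group G" "subgroup H G" shows "comm_group (G\<lparr>carrier := H\<rparr>)"
proof -
  interpret comm_group G by fact
  interpret H: group "G\<lparr>carrier := H\<rparr>" using assms(2) by (rule subgroup_imp_group)
  show ?thesis
    by (rule H.group_comm_groupI) (use subgroup.subset[OF assms(2)] in \<open>auto intro: m_comm\<close>)
qed

lemma subgroup_character_kernel:
  assumes "group G" "character G \<xi>" shows "subgroup {x \<in> carrier G. \<xi> x = 1} G"
proof -
  interpret group G by fact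
  show ?thesis
    by (rule subgroupI)
      (use assms in \<open>auto simp: character_inv character_def intro!: exI[of _ "\<one>\<^bsub>G\<^esub>"] character_one\<close>)
qed

text \<open>Let \<open>g\<close> have maximal order \<open>p ^ e\<close>. A character \<open>\<xi>\<close> which is nontrivial on the power of \<open>g\<close> with exponent \<open>p ^ (e - 1)\<close> maps
  \<open>g\<close> to a primitive root of unity of order \<open>p ^ e\<close>. Hence \<open>G\<close> is the direct product of the subgroup generated by \<open>g\<close> and the kernel of \<open>\<xi>\<close>, to which the
  induction applies. The last inequality holds since every cyclic factor contributes \<open>p\<close> elements killed by
  \<open>p\<close>; it turns bounds for the \<open>p\<close>-torsion into bounds for the number of factors.\<close>

theorem abelian_p_group_embeds_in:
  fixes G :: "('a, 'b) monoid_scheme" (structure) and p :: nat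
  assumes "prime p" "comm_group G" "finite (carrier G)" "\<And>x. x \<in> carrier G \<Longrightarrow> x [^] (p ^ k) = \<one>"
  shows "\<exists>M. embeds_in G M \<and> prod_mset M = card (carrier G) \<and> (\<forall>m\<in>#M. \<exists>e\<in>{1..k}. m = p ^ e) \<and>
    p ^ size M \<le> card {x \<in> carrier G. x [^] p = \<one>}"
  using assms(2-4)
proof (induction "card (carrier G)" arbitrary: G rule: less_induct)
  case less
  interpret comm_group G by fact
  show ?case
  proof (cases "carrier G = {\<one>\<^bsub>G\<^esub>}")
    case True
    have "embeds_in G (image_mset snd ({#} :: (('a \<Rightarrow> complex) \<times> nat) multiset))" by (rule embeds_inI) (use True in auto)
    moreover have "{x \<in> carrier G. x [^]\<^bsub>G\<^esub> p = \<one>\<^bsub>G\<^esub>} = {\<one>\<^bsub>G\<^esub>}" using True by auto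
    ultimately show ?thesis using True by (intro exI[of _ "{#}"]) simp
  next
    case False
    define e where "e = (LEAST e. \<forall>x\<in>carrier G. x [^]\<^bsub>G\<^esub> (p ^ e) = \<one>\<^bsub>G\<^esub>)"
    have e: "x [^]\<^bsub>G\<^esub> (p ^ e) = \<one>\<^bsub>G\<^esub>" if "x \<in> carrier G" for x
      using LeastI[of "\<lambda>e. \<forall>x\<in>carrier G. x [^]\<^bsub>G\<^esub> (p ^ e) = \<one>\<^bsub>G\<^esub>" k] less.prems(3) that
      unfolding e_def by blast
    have "e \<le> k" unfolding e_def by (rule Least_le) (use less.prems(3) in blast)
    have "e \<noteq> 0"
    proof
      assume "e = 0"
      then show False using e False by auto
    qed
    then have "\<not> (\<forall>x\<in>carrier G. x [^]\<^bsub>G\<^esub> (p ^ (e - 1)) = \<one>\<^bsub>G\<^esub>)"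
      using not_less_Least[of "e - 1" "\<lambda>e. \<forall>x\<in>carrier G. x [^]\<^bsub>G\<^esub> (p ^ e) = \<one>\<^bsub>G\<^esub>"]
      unfolding e_def[symmetric] by simp
    then obtain g where g: "g \<in> carrier G" "g [^]\<^bsub>G\<^esub> (p ^ (e - 1)) \<noteq> \<one>\<^bsub>G\<^esub>" by blast
    obtain \<xi> where \<xi>: "character G \<xi>" "\<xi> (g [^]\<^bsub>G\<^esub> (p ^ (e - 1))) \<noteq> 1"
      using characters_separate_points[OF less.prems(1,2) _ g(2)] g(1) by auto
    define n where "n = p ^ e"
    have p1: "p > 1" using assms(1) prime_gt_1_nat by blast
    have n0: "n > 0" using p1 by (simp add: n_def)
    have \<xi>_pow: "\<xi> (x [^]\<^bsub>G\<^esub> (j::nat)) = \<xi> x ^ j" if "x \<in> carrier G" for x j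
      using character_pow[OF is_group \<xi>(1) that] .
    have \<xi>_mult: "\<xi> (x \<otimes>\<^bsub>G\<^esub> y) = \<xi> x * \<xi> y" if "x \<in> carrier G" "y \<in> carrier G" for x y
      using \<xi>(1) that by (simp add: character_def)
    have \<xi>_n: "\<xi> x ^ n = 1" if "x \<in> carrier G" for x
      using \<xi>_pow[OF that, of n] e[OF that] character_one[OF is_group \<xi>(1)] by (simp add: n_def)
    define \<zeta> where "\<zeta> = \<xi> g"
    have \<zeta>_dvd: "n dvd j" if "\<zeta> ^ j = 1" for j
      using power_eq_1_imp_dvd_prime_power[OF assms(1), of \<zeta> e j] \<xi>_n[OF g(1)] \<xi>(2) that
      by (simp add: \<zeta>_def n_def \<xi>_pow g)
    have pow_le: "g [^]\<^bsub>G\<^esub> a = g [^]\<^bsub>G\<^esub> b \<and> n dvd (b - a)" if "\<zeta> ^ a = \<zeta> ^ b" "a \<le> b" for a b :: nat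
    proof -
      have "\<zeta> ^ b = \<zeta> ^ a * \<zeta> ^ (b - a)" using that(2) by (simp flip: power_add)
      moreover have "\<zeta> \<noteq> 0" using \<xi>(1) g(1) by (simp add: \<zeta>_def character_def)
      ultimately have "\<zeta> ^ (b - a) = 1" using that(1) by simp
      then have d: "n dvd (b - a)" by (rule \<zeta>_dvd)
      then obtain r where "b - a = n * r" by blast
      then have "g [^]\<^bsub>G\<^esub> (b - a) = \<one>\<^bsub>G\<^esub>"
        using e[OF g(1)] g(1) by (simp add: n_def nat_pow_pow[symmetric])
      moreover have "g [^]\<^bsub>G\<^esub> b = g [^]\<^bsub>G\<^esub> a \<otimes>\<^bsub>G\<^esub> g [^]\<^bsub>G\<^esub> (b - a)"
        using that(2) g(1) by (simp add: nat_pow_mult)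
      ultimately show ?thesis using d g(1) by simp
    qed
    have pow_eq: "g [^]\<^bsub>G\<^esub> a = g [^]\<^bsub>G\<^esub> b" if "\<zeta> ^ a = \<zeta> ^ b" for a b :: nat
      using pow_le[of a b] pow_le[of b a] that by (metis nat_le_linear)
    have inj\<zeta>: "inj_on (\<lambda>j. \<zeta> ^ j) {..<n}"
    proof (rule linorder_inj_onI')
      fix a b assume ab: "a \<in> {..<n}" "b \<in> {..<n}" "a < b"
      show "\<zeta> ^ a \<noteq> \<zeta> ^ b"
      proof
        assume "\<zeta> ^ a = \<zeta> ^ b"
        then have "n dvd b - a" using pow_le ab by auto
        then show False using ab by (auto dest!: dvd_imp_le)
      qed
    qed
    have "(\<lambda>j. \<zeta> ^ j) ` {..<n} = {z. z ^ n = 1}"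
    proof (rule card_subset_eq)
      show "finite {z::complex. z ^ n = 1}" using n0 by (simp add: finite_roots_unity)
      show "(\<lambda>j. \<zeta> ^ j) ` {..<n} \<subseteq> {z. z ^ n = 1}"
      proof clarify
        fix j
        have "(\<zeta> ^ j) ^ n = (\<zeta> ^ n) ^ j" by (metis mult.commute power_mult)
        then show "(\<zeta> ^ j) ^ n = 1" using \<xi>_n[OF g(1)] by (simp add: \<zeta>_def)
      qed
      show "card ((\<lambda>j. \<zeta> ^ j) ` {..<n}) = card {z::complex. z ^ n = 1}"
        using card_image[OF inj\<zeta>] card_roots_unity_eq[OF n0] by simp
    qed
    then have "\<exists>j<n. \<xi> x = \<zeta> ^ j" if "x \<in> carrier G" for x
      using \<xi>_n[OF that] by blast
    then obtain m where m: "m x < n" "\<xi> x = \<zeta> ^ m x" if "x \<in> carrier G" for x by metis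
    define H where "H = {x \<in> carrier G. \<xi> x = 1}"
    have H: "subgroup H G" unfolding H_def by (rule subgroup_character_kernel[OF is_group \<xi>(1)])
    have Hc: "H \<subseteq> carrier G" by (auto simp: H_def)
    interpret GH: comm_group "G\<lparr>carrier := H\<rparr>" using comm_group_subgroup[OF less.prems(1) H] .
    \<comment> \<open>The projection onto the kernel of \<open>\<xi>\<close> along the powers of \<open>g\<close>.\<close>
    define \<pi> where "\<pi> x = x \<otimes>\<^bsub>G\<^esub> inv\<^bsub>G\<^esub> (g [^]\<^bsub>G\<^esub> m x)" for x
    have \<xi>g: "\<xi> (g [^]\<^bsub>G\<^esub> (j::nat)) = \<zeta> ^ j" for j using \<xi>_pow[OF g(1)] by (simp add: \<zeta>_def)
    have \<pi>H: "\<pi> x \<in> H" if "x \<in> carrier G" for x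
    proof -
      have "\<xi> x \<noteq> 0" using \<xi>(1) that by (simp add: character_def)
      then have "\<xi> (\<pi> x) = 1"
        using that g(1) m(2)[OF that] by (simp add: \<pi>_def \<xi>_mult character_inv[OF is_group \<xi>(1)] \<xi>g)
      then show ?thesis using that g(1) by (simp add: H_def \<pi>_def)
    qed
    have \<pi>_mult: "\<pi> (x \<otimes>\<^bsub>G\<^esub> y) = \<pi> x \<otimes>\<^bsub>G\<^esub> \<pi> y" if "x \<in> carrier G" "y \<in> carrier G" for x y
    proof -
      have "\<zeta> ^ m (x \<otimes>\<^bsub>G\<^esub> y) = \<zeta> ^ (m x + m y)"
        using m(2)[of "x \<otimes>\<^bsub>G\<^esub> y"] m(2)[OF that(1)] m(2)[OF that(2)] \<xi>_mult[OF that] that by (simp add: power_add)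
      then have "g [^]\<^bsub>G\<^esub> m (x \<otimes>\<^bsub>G\<^esub> y) = g [^]\<^bsub>G\<^esub> (m x + m y)" by (rule pow_eq)
      also have "\<dots> = g [^]\<^bsub>G\<^esub> m x \<otimes>\<^bsub>G\<^esub> g [^]\<^bsub>G\<^esub> m y" using g(1) by (simp add: nat_pow_mult)
      finally show ?thesis using that g(1) by (simp add: \<pi>_def inv_mult m_ac)
    qed
    have decomp: "x = g [^]\<^bsub>G\<^esub> m x \<otimes>\<^bsub>G\<^esub> \<pi> x" if "x \<in> carrier G" for x
      using that g(1) by (simp add: \<pi>_def m_lcomm[of _ x])
    have injG: "inj_on (\<lambda>(j, h). g [^]\<^bsub>G\<^esub> j \<otimes>\<^bsub>G\<^esub> h) ({..<n} \<times> H)"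
    proof (rule inj_onI, clarify)
      fix i h j l assume *: "i < n" "h \<in> H" "j < n" "l \<in> H"
        and eq: "g [^]\<^bsub>G\<^esub> i \<otimes>\<^bsub>G\<^esub> h = g [^]\<^bsub>G\<^esub> j \<otimes>\<^bsub>G\<^esub> l"
      have "\<zeta> ^ i = \<zeta> ^ j"
        using arg_cong[OF eq, of \<xi>] * g(1) Hc by (auto simp: \<xi>_mult \<xi>g H_def)
      then have "i = j" using inj\<zeta> * by (auto dest: inj_onD)
      moreover have "h \<in> carrier G" "l \<in> carrier G" using * Hc by auto
      ultimately show "i = j \<and> h = l" using eq g(1) by simp
    qed
    have imG: "(\<lambda>(j, h). g [^]\<^bsub>G\<^esub> j \<otimes>\<^bsub>G\<^esub> h) ` ({..<n} \<times> H) = carrier G"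
    proof
      show "carrier G \<subseteq> (\<lambda>(j, h). g [^]\<^bsub>G\<^esub> j \<otimes>\<^bsub>G\<^esub> h) ` ({..<n} \<times> H)"
      proof
        fix x assume "x \<in> carrier G"
        then show "x \<in> (\<lambda>(j, h). g [^]\<^bsub>G\<^esub> j \<otimes>\<^bsub>G\<^esub> h) ` ({..<n} \<times> H)"
          using decomp m(1) \<pi>H by (intro image_eqI[of _ _ "(m x, \<pi> x)"]) auto
      qed
    qed (use g(1) Hc in auto)
    have finH: "finite H" using Hc less.prems(2) finite_subset by blast
    have cardG: "card (carrier G) = n * card H"
      using card_image[OF injG] imG by (simp add: card_cartesian_product)
    have powH: "x [^]\<^bsub>G\<lparr>carrier := H\<rparr>\<^esub> (j::nat) = x [^]\<^bsub>G\<^esub> j" for x j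
      by (rule nat_pow_consistent[symmetric])
    have "H \<noteq> carrier G" using \<xi>(2) g(1) by (auto simp: H_def)
    then have "card H < card (carrier G)"
      using Hc less.prems(2) by (intro psubset_card_mono) auto
    from less.hyps[of "G\<lparr>carrier := H\<rparr>"] this obtain M where M: "embeds_in (G\<lparr>carrier := H\<rparr>) M"
      "prod_mset M = card H" "\<forall>m\<in>#M. \<exists>e\<in>{1..k}. m = p ^ e"
      "p ^ size M \<le> card {x \<in> H. x [^]\<^bsub>G\<^esub> p = \<one>\<^bsub>G\<^esub>}"
      using GH.comm_group_axioms finH less.prems(3) Hc by (auto simp: powH)
    obtain D where D': "image_mset snd D = M" "\<forall>\<xi> n. (\<xi>, n) \<in># D \<longrightarrow> character (G\<lparr>carrier := H\<rparr>) \<xi>"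
      "\<forall>\<xi> n x. (\<xi>, n) \<in># D \<longrightarrow> x \<in> carrier (G\<lparr>carrier := H\<rparr>) \<longrightarrow> \<xi> x ^ n = 1"
      "\<forall>x. x \<in> carrier (G\<lparr>carrier := H\<rparr>) \<longrightarrow> (\<forall>\<xi> n. (\<xi>, n) \<in># D \<longrightarrow> \<xi> x = 1) \<longrightarrow> x = \<one>\<^bsub>G\<lparr>carrier := H\<rparr>\<^esub>"
      using M(1) unfolding embeds_in_def by blast
    note D = D'[rule_format]
    define D2 where "D2 = image_mset (\<lambda>(\<psi>, l). (\<lambda>x. \<psi> (\<pi> x), l)) D"
    have D2: "\<exists>\<psi>. (\<psi>, l) \<in># D \<and> \<eta> = (\<lambda>x. \<psi> (\<pi> x))" if "(\<eta>, l) \<in># D2" for \<eta> l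
      using that by (auto simp: D2_def)
    have "embeds_in G (image_mset snd (add_mset (\<xi>, n) D2))"
    proof (rule embeds_inI)
      fix \<eta> l assume "(\<eta>, l) \<in># add_mset (\<xi>, n) D2"
      then consider "\<eta> = \<xi>" | \<psi> where "(\<psi>, l) \<in># D" "\<eta> = (\<lambda>x. \<psi> (\<pi> x))" using D2 by auto
      then show "character G \<eta>"
      proof cases
        case 2
        have "character (G\<lparr>carrier := H\<rparr>) \<psi>" using D(2)[OF 2(1)] .
        then show ?thesis using \<pi>H \<pi>_mult 2(2) by (simp add: character_def)
      qed (use \<xi>(1) in simp)
    next
      fix \<eta> l x assume "(\<eta>, l) \<in># add_mset (\<xi>, n) D2" and x: "x \<in> carrier G"
      then consider "\<eta> = \<xi>" "l = n" | \<psi> where "(\<psi>, l) \<in># D" "\<eta> = (\<lambda>x. \<psi> (\<pi> x))" using D2 by auto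
      then show "\<eta> x ^ l = 1"
      proof cases
        case 2
        then show ?thesis using D(3)[OF 2(1), of "\<pi> x"] \<pi>H[OF x] by simp
      qed (use \<xi>_n[OF x] in simp)
    next
      fix x assume x: "x \<in> carrier G" and *: "\<And>\<eta> l. (\<eta>, l) \<in># add_mset (\<xi>, n) D2 \<Longrightarrow> \<eta> x = 1"
      have "\<xi> x = 1" using *[of \<xi> n] by simp
      then have "\<zeta> ^ m x = \<zeta> ^ 0" using m(2)[OF x] by simp
      then have "g [^]\<^bsub>G\<^esub> m x = g [^]\<^bsub>G\<^esub> (0::nat)" by (rule pow_eq)
      then have "\<pi> x = x" using x by (simp add: \<pi>_def)
      moreover have "\<pi> x = \<one>\<^bsub>G\<lparr>carrier := H\<rparr>\<^esub>"
      proof (rule D(4))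
        fix \<psi> l assume "(\<psi>, l) \<in># D"
        then have "(\<lambda>x. \<psi> (\<pi> x), l) \<in># add_mset (\<xi>, n) D2" by (force simp: D2_def)
        from *[OF this] show "\<psi> (\<pi> x) = 1" .
      qed (use \<pi>H[OF x] in simp)
      ultimately show "x = \<one>\<^bsub>G\<^esub>" by simp
    qed
    moreover have "image_mset snd D2 = M"
      using D(1) by (auto simp: D2_def multiset.map_comp o_def case_prod_beta)
    ultimately have "embeds_in G (add_mset n M)" by simp
    moreover have "p ^ size (add_mset n M) \<le> card {x \<in> carrier G. x [^]\<^bsub>G\<^esub> p = \<one>\<^bsub>G\<^esub>}"
    proof -
      let ?Hp = "{x \<in> H. x [^]\<^bsub>G\<^esub> p = \<one>\<^bsub>G\<^esub>}" and ?f = "\<lambda>(i, h). g [^]\<^bsub>G\<^esub> (i * p ^ (e - 1)) \<otimes>\<^bsub>G\<^esub> h"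
      have pe: "n = p * p ^ (e - 1)" using \<open>e \<noteq> 0\<close> by (cases e) (auto simp: n_def)
      have lt: "i * p ^ (e - 1) < n" if "i < p" for i using that p1 by (simp add: pe)
      have "inj_on ?f ({..<p} \<times> ?Hp)"
      proof (rule inj_onI, clarify)
        fix i h j l assume *: "i < p" "h \<in> H" "j < p" "l \<in> H"
          and eq: "g [^]\<^bsub>G\<^esub> (i * p ^ (e - 1)) \<otimes>\<^bsub>G\<^esub> h = g [^]\<^bsub>G\<^esub> (j * p ^ (e - 1)) \<otimes>\<^bsub>G\<^esub> l"
        have "(i * p ^ (e - 1), h) = (j * p ^ (e - 1), l)"
          using * lt eq by (intro inj_onD[OF injG]) auto
        then show "i = j \<and> h = l" using p1 by simp
      qed
      moreover have "?f ` ({..<p} \<times> ?Hp) \<subseteq> {x \<in> carrier G. x [^]\<^bsub>G\<^esub> p = \<one>\<^bsub>G\<^esub>}"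
      proof clarify
        fix i h assume ih: "h \<in> H" "h [^]\<^bsub>G\<^esub> p = \<one>\<^bsub>G\<^esub>"
        have h: "h \<in> carrier G" using ih Hc by auto
        have "(g [^]\<^bsub>G\<^esub> (i * p ^ (e - 1))) [^]\<^bsub>G\<^esub> p = (g [^]\<^bsub>G\<^esub> (p ^ e)) [^]\<^bsub>G\<^esub> i"
          using pe g(1) by (simp add: nat_pow_pow n_def ac_simps)
        then show "g [^]\<^bsub>G\<^esub> (i * p ^ (e - 1)) \<otimes>\<^bsub>G\<^esub> h \<in> carrier G \<and>
            (g [^]\<^bsub>G\<^esub> (i * p ^ (e - 1)) \<otimes>\<^bsub>G\<^esub> h) [^]\<^bsub>G\<^esub> p = \<one>\<^bsub>G\<^esub>"
          using g(1) h ih e[OF g(1)] by (simp add: pow_mult_distrib m_comm)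
      qed
      ultimately have "card ({..<p} \<times> ?Hp) \<le> card {x \<in> carrier G. x [^]\<^bsub>G\<^esub> p = \<one>\<^bsub>G\<^esub>}"
        using less.prems(2) by (intro card_inj_on_le) auto
      then show ?thesis using M(4) p1 by (simp add: card_cartesian_product) (meson le_trans mult_le_mono2)
    qed
    moreover have "e \<in> {1..k}" using \<open>e \<noteq> 0\<close> \<open>e \<le> k\<close> by simp
    then have "\<forall>m\<in>#add_mset n M. \<exists>e\<in>{1..k}. m = p ^ e" using M(3) unfolding n_def by auto
    ultimately show ?thesis using M(2) cardG by (intro exI[of _ "add_mset n M"]) simp
  qed
qed

section \<open>Diagonal abelian groups preserving a smooth cubic form in six variables\<close>

lemma odd_root_unique:
  fixes y z :: complex
  assumes "y\<^sup>2 = z\<^sup>2" "y ^ N = 1" "z ^ N = 1" "odd N" shows "y = z"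
proof -
  obtain m where m: "N = 2 * m + 1" using assms(4) by (rule oddE)
  have "x = (x\<^sup>2) ^ (m + 1)" if "x ^ N = 1" for x :: complex
  proof -
    have "2 * (m + 1) = N + 1" using m by simp
    then have "(x\<^sup>2) ^ (m + 1) = x ^ (N + 1)" by (metis power_mult)
    then show ?thesis using that by simp
  qed
  then show ?thesis using assms(1-3) by metis
qed

text \<open>The situation of commuting lifts, reduced to combinatorics. \<open>R i j k\<close> says that the monomial \<open>x\<^sub>i x\<^sub>j x\<^sub>k\<close> occurs in the
  cubic form in eigencoordinates, and \<open>t g i\<close> is the eigenvalue of the lift of \<open>g\<close> at the
  \<open>i\<close>-th basis vector. Lifts are chosen one by one, so they are multiplicative only up to a cube root of unity.
  The last assumption is the consequence of smoothness proved in \<open>monomial_exists\<close>.\<close>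

locale diagonal_action = comm_group G for G (structure) +
  fixes t :: "'a \<Rightarrow> 'i::finite \<Rightarrow> complex" and R :: "'i \<Rightarrow> 'i \<Rightarrow> 'i \<Rightarrow> bool"
  assumes fin: "finite (carrier G)"
    and card6: "CARD('i) = 6"
    and R_t: "g \<in> carrier G \<Longrightarrow> R i j k \<Longrightarrow> t g i * t g j * t g k = 1"
    and t_mult: "g \<in> carrier G \<Longrightarrow> h \<in> carrier G \<Longrightarrow> \<exists>c. c ^ 3 = 1 \<and> (\<forall>i. t (g \<otimes> h) i = c * t g i * t h i)"
    and faithful: "g \<in> carrier G \<Longrightarrow> (\<And>i j. t g i = t g j) \<Longrightarrow> g = \<one>"
    and nondeg: "card U \<le> 2 \<Longrightarrow> card U < card S \<Longrightarrow> \<exists>i\<in>S. \<exists>k\<in>S. \<exists>l. l \<notin> U \<and> R i k l"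
begin

subsection \<open>The graph of square monomials\<close>

text \<open>The case of singletons in the smoothness condition: some \<open>x\<^sub>i\<^sup>2 x\<^sub>j\<close> occurs in the form.\<close>

definition \<sigma> :: "'i \<Rightarrow> 'i" where "\<sigma> i = (SOME j. R i i j)"

lemma R_\<sigma>: "R i i (\<sigma> i)"
proof -
  have "\<exists>j. R i i j" using nondeg[of "{}" "{i}"] by auto
  then show ?thesis unfolding \<sigma>_def by (rule someI_ex)
qed

text \<open>Diagonal matrices fixing all monomials. Working with these rather than with group elements leaves room for
  powers of eigenvalue vectors and for vectors rescaled by a cube root of unity.\<close>

definition invariant :: "('i \<Rightarrow> complex) \<Rightarrow> bool" where
  "invariant w \<longleftrightarrow> (\<forall>i j k. R i j k \<longrightarrow> w i * w j * w k = 1)"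

lemma invariantD: "invariant w \<Longrightarrow> R i j k \<Longrightarrow> w i * w j * w k = 1"
  by (simp add: invariant_def)

lemma invariant_t: "g \<in> carrier G \<Longrightarrow> invariant (t g)"
  using R_t by (simp add: invariant_def)

lemma invariant_power: "invariant w \<Longrightarrow> invariant (\<lambda>i. w i ^ k)"
  by (simp add: invariant_def flip: power_mult_distrib)

lemma invariant_\<sigma>: assumes "invariant w" shows "(w i)\<^sup>2 * w (\<sigma> i) = 1"
  using invariantD[OF assms R_\<sigma>, of i] by (simp add: power2_eq_square)

lemma invariant_nonzero: assumes "invariant w" shows "w i \<noteq> 0"
  using invariant_\<sigma>[OF assms, of i] by auto

lemma t_nonzero: "g \<in> carrier G \<Longrightarrow> t g i \<noteq> 0"
  using invariant_nonzero invariant_t by blast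

lemma invariant_\<sigma>2: assumes "invariant w" shows "w (\<sigma> (\<sigma> i)) = w i ^ 4"
proof -
  have "(w i ^ 2 * w (\<sigma> i)) ^ 2 * w (\<sigma> (\<sigma> i)) = w i ^ 4 * ((w (\<sigma> i))\<^sup>2 * w (\<sigma> (\<sigma> i)))"
    by (simp add: power_mult_distrib mult.assoc flip: power_mult)
  then show ?thesis using invariant_\<sigma>[OF assms] by simp
qed

lemma invariant_\<sigma>6: assumes "invariant w" shows "w ((\<sigma> ^^ 6) i) = w i ^ 64"
proof -
  have "(\<sigma> ^^ 6) i = \<sigma> (\<sigma> (\<sigma> (\<sigma> (\<sigma> (\<sigma> i)))))" by (simp add: eval_nat_numeral)
  then show ?thesis by (simp add: invariant_\<sigma>2[OF assms] flip: power_mult)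
qed

text \<open>Going once around a cycle of length \<open>p\<close> raises \<open>w i\<close> to the power \<open>(-2) ^ p\<close>, so the exponent is the absolute
  value of \<open>(-2) ^ p - 1\<close>.\<close>

lemma invariant_period:
  assumes "invariant w" "(\<sigma> ^^ p) i = i"
  shows "p = 1 \<Longrightarrow> w i ^ 3 = 1" "p = 2 \<Longrightarrow> w i ^ 3 = 1" "p = 3 \<Longrightarrow> w i ^ 9 = 1"
    "p = 4 \<Longrightarrow> w i ^ 15 = 1" "p = 5 \<Longrightarrow> w i ^ 33 = 1" "p = 6 \<Longrightarrow> w i ^ 63 = 1"
proof -
  note s = invariant_\<sigma>[OF assms(1)] and s2 = invariant_\<sigma>2[OF assms(1)] and nz = invariant_nonzero[OF assms(1), of i]
  have odd: "w i ^ (2 * m + 1) = 1" if "w (\<sigma> j) = w i" "w j = w i ^ m" for j m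
  proof -
    have "(w i ^ m)\<^sup>2 * w i = 1" using s[of j] that by simp
    then show ?thesis by (simp add: power_mult mult.commute flip: power_mult)
  qed
  have even: "w j = w i \<Longrightarrow> w j = w i ^ Suc m \<Longrightarrow> w i ^ m = 1" for j m
    using nz by simp
  show "p = 1 \<Longrightarrow> w i ^ 3 = 1" using odd[of i 1] assms(2) by simp
  show "p = 2 \<Longrightarrow> w i ^ 3 = 1" using even[of "\<sigma> (\<sigma> i)" 3] s2[of i] assms(2) by (simp add: numeral_2_eq_2)
  show "p = 3 \<Longrightarrow> w i ^ 9 = 1" using odd[of "\<sigma> (\<sigma> i)" 4] s2[of i] assms(2) by (simp add: numeral_3_eq_3)
  have s4: "w (\<sigma> (\<sigma> (\<sigma> (\<sigma> i)))) = w i ^ 16" using s2[of i] s2[of "\<sigma> (\<sigma> i)"] by (simp flip: power_mult)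
  have s6: "w (\<sigma> (\<sigma> (\<sigma> (\<sigma> (\<sigma> (\<sigma> i)))))) = w i ^ 64" using s2[of "\<sigma> (\<sigma> (\<sigma> (\<sigma> i)))"] s4 by (simp flip: power_mult)
  show "p = 4 \<Longrightarrow> w i ^ 15 = 1" using even[of "\<sigma> (\<sigma> (\<sigma> (\<sigma> i)))" 15] s4 assms(2) by (simp add: eval_nat_numeral)
  show "p = 5 \<Longrightarrow> w i ^ 33 = 1" using odd[of "\<sigma> (\<sigma> (\<sigma> (\<sigma> i)))" 16] s4 assms(2) by (simp add: eval_nat_numeral)
  show "p = 6 \<Longrightarrow> w i ^ 63 = 1" using even[of "\<sigma> (\<sigma> (\<sigma> (\<sigma> (\<sigma> (\<sigma> i)))))" 63] s6 assms(2) by (simp add: eval_nat_numeral)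
qed

subsection \<open>Periodic points\<close>

text \<open>The indices on cycles of \<open>\<sigma>\<close>. Six steps lead from every index into \<open>C\<close>.\<close>

definition C :: "'i set" where "C = {i. \<exists>n>0. (\<sigma> ^^ n) i = i}"

definition per :: "'i \<Rightarrow> nat" where "per x = (LEAST n. n > 0 \<and> (\<sigma> ^^ n) x = x)"

definition orb :: "'i \<Rightarrow> 'i set" where "orb x = (\<lambda>n. (\<sigma> ^^ n) x) ` {..<per x}"

lemma per: assumes "x \<in> C" shows "per x > 0" "(\<sigma> ^^ per x) x = x"
proof -
  have "\<exists>n. n > 0 \<and> (\<sigma> ^^ n) x = x" using assms by (auto simp: C_def)
  then have "per x > 0 \<and> (\<sigma> ^^ per x) x = x" unfolding per_def by (rule LeastI_ex)
  then show "per x > 0" "(\<sigma> ^^ per x) x = x" by auto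
qed

lemma per_least: "n > 0 \<Longrightarrow> n < per x \<Longrightarrow> (\<sigma> ^^ n) x \<noteq> x"
  using not_less_Least[of n "\<lambda>n. n > 0 \<and> (\<sigma> ^^ n) x = x"] by (auto simp: per_def)

lemma \<sigma>_mod: assumes "x \<in> C" shows "(\<sigma> ^^ n) x = (\<sigma> ^^ (n mod per x)) x"
proof -
  have *: "(\<sigma> ^^ (per x * k)) x = x" for k
    by (induction k) (use per[OF assms] in \<open>auto simp: funpow_add\<close>)
  have "(\<sigma> ^^ n) x = (\<sigma> ^^ (n mod per x + per x * (n div per x))) x" by simp
  also have "\<dots> = (\<sigma> ^^ (n mod per x)) x" unfolding funpow_add by (simp add: *)
  finally show ?thesis .
qed

lemma orb_eq: "x \<in> C \<Longrightarrow> orb x = range (\<lambda>n. (\<sigma> ^^ n) x)"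
proof (intro equalityI subsetI)
  fix y assume x: "x \<in> C" and "y \<in> range (\<lambda>n. (\<sigma> ^^ n) x)"
  then obtain n where "y = (\<sigma> ^^ n) x" by blast
  then show "y \<in> orb x" unfolding orb_def
    using \<sigma>_mod[OF x, of n] per(1)[OF x] by (intro image_eqI[of _ _ "n mod per x"]) auto
qed (auto simp: orb_def)

lemma card_orb: assumes "x \<in> C" shows "card (orb x) = per x"
proof -
  have "inj_on (\<lambda>n. (\<sigma> ^^ n) x) {..<per x}"
  proof (rule linorder_inj_onI')
    fix a b assume ab: "a \<in> {..<per x}" "b \<in> {..<per x}" "a < b"
    show "(\<sigma> ^^ a) x \<noteq> (\<sigma> ^^ b) x"
    proof
      assume "(\<sigma> ^^ a) x = (\<sigma> ^^ b) x"
      then have "(\<sigma> ^^ (per x - b)) ((\<sigma> ^^ a) x) = (\<sigma> ^^ (per x - b)) ((\<sigma> ^^ b) x)" by simp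
      then have "(\<sigma> ^^ (per x - b + a)) x = (\<sigma> ^^ (per x - b + b)) x"
        by (simp only: funpow_add o_apply)
      then have "(\<sigma> ^^ (per x - b + a)) x = x" using ab per[OF assms] by simp
      moreover have "0 < per x - b + a" "per x - b + a < per x" using ab by auto
      ultimately show False using per_least[of "per x - b + a" x] by simp
    qed
  qed
  then show ?thesis unfolding orb_def by (simp add: card_image)
qed

lemma \<sigma>_C: "x \<in> C \<Longrightarrow> \<sigma> x \<in> C"
proof -
  assume "x \<in> C"
  then have "(\<sigma> ^^ per x) (\<sigma> x) = \<sigma> x" using per(2)[of x] by (metis funpow_swap1)
  then show ?thesis using per(1)[OF \<open>x \<in> C\<close>] unfolding C_def by blast
qed

lemma \<sigma>n_C: "x \<in> C \<Longrightarrow> (\<sigma> ^^ n) x \<in> C"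
  by (induction n) (auto intro: \<sigma>_C)

lemma orb_C: "x \<in> C \<Longrightarrow> orb x \<subseteq> C"
  unfolding orb_def using \<sigma>n_C by auto

lemma x_orb: "x \<in> C \<Longrightarrow> x \<in> orb x"
  using per(1) unfolding orb_def by (intro image_eqI[of _ _ 0]) auto

lemma pred_C: assumes "x \<in> C" shows "\<exists>p\<in>C. \<sigma> p = x"
proof
  show "(\<sigma> ^^ (per x - 1)) x \<in> C" by (rule \<sigma>n_C[OF assms])
  have "\<sigma> ((\<sigma> ^^ (per x - 1)) x) = (\<sigma> ^^ Suc (per x - 1)) x" by simp
  then show "\<sigma> ((\<sigma> ^^ (per x - 1)) x) = x" using per[OF assms] by simp
qed

lemma orb_disjoint: assumes "x \<in> C" "y \<in> C - orb x" shows "orb y \<subseteq> C - orb x"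
proof -
  have y: "y \<in> C" using assms by simp
  have "(\<sigma> ^^ n) y \<notin> orb x" for n
  proof
    assume "(\<sigma> ^^ n) y \<in> orb x"
    then obtain m where m: "(\<sigma> ^^ n) y = (\<sigma> ^^ m) x" by (auto simp: orb_def)
    have p: "n \<le> per y * n" using per(1)[OF y] by (cases "per y") auto
    have "y = (\<sigma> ^^ (per y * n)) y" using \<sigma>_mod[OF y, of "per y * n"] by simp
    also have "\<dots> = (\<sigma> ^^ (per y * n - n)) ((\<sigma> ^^ n) y)" using p by (metis funpow_add le_add_diff_inverse2 o_apply)
    also have "\<dots> = (\<sigma> ^^ (per y * n - n + m)) x" by (simp add: m funpow_add)
    finally have "y \<in> orb x" using orb_eq[OF assms(1)] by blast
    then show False using assms by simp
  qed
  then show ?thesis using orb_C[OF y] unfolding orb_def by auto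
qed

lemma \<sigma>6_C: "(\<sigma> ^^ 6) i \<in> C"
proof -
  have "\<not> inj_on (\<lambda>n. (\<sigma> ^^ n) i) {..6}"
  proof
    assume "inj_on (\<lambda>n. (\<sigma> ^^ n) i) {..6}"
    then have "card ((\<lambda>n. (\<sigma> ^^ n) i) ` {..6}) = 7" by (simp add: card_image)
    moreover have "card ((\<lambda>n. (\<sigma> ^^ n) i) ` {..6}) \<le> CARD('i)" by (rule card_mono) auto
    ultimately show False using card6 by simp
  qed
  then obtain a b where ab: "a < b" "b \<le> 6" "(\<sigma> ^^ a) i = (\<sigma> ^^ b) i"
    by (auto simp: inj_on_def) (metis linorder_neqE_nat)
  have "(\<sigma> ^^ (b - a)) ((\<sigma> ^^ a) i) = (\<sigma> ^^ (b - a + a)) i" by (simp only: funpow_add o_apply)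
  then have "(\<sigma> ^^ (b - a)) ((\<sigma> ^^ a) i) = (\<sigma> ^^ a) i" using ab by simp
  then have "(\<sigma> ^^ a) i \<in> C" using ab(1) unfolding C_def by (auto intro!: exI[of _ "b - a"])
  then have "(\<sigma> ^^ (6 - a)) ((\<sigma> ^^ a) i) \<in> C" by (rule \<sigma>n_C)
  moreover have "(\<sigma> ^^ (6 - a)) ((\<sigma> ^^ a) i) = (\<sigma> ^^ (6 - a + a)) i" by (simp only: funpow_add o_apply)
  ultimately show ?thesis using ab by simp
qed

lemma C_nonempty: "C \<noteq> {}" using \<sigma>6_C by auto

lemma card_C_le: "card C \<le> 6" using card_mono[of UNIV C] card6 by simp

text \<open>Indices can be added one by one to a set containing the cycles in such a way that each new index is
  mapped into the old set.\<close>

lemma closed_step: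
  assumes "C \<subseteq> S" "\<sigma> ` S' \<subseteq> S'" "S \<subset> S'" shows "\<exists>i\<in>S' - S. \<sigma> i \<in> S"
proof (rule ccontr)
  assume *: "\<not> ?thesis"
  obtain i where i: "i \<in> S' - S" using assms(3) by blast
  have "(\<sigma> ^^ n) i \<in> S' - S" for n
    by (induction n) (use i * assms(2) in auto)
  then show False using \<sigma>6_C[of i] assms(1) by blast
qed

subsection \<open>The subgroup of 2-elements\<close>

definition x0 :: 'i where "x0 = (SOME x. x \<in> C)"

lemma x0: "x0 \<in> C" unfolding x0_def using C_nonempty by (simp add: some_in_eq)

text \<open>Dividing by the eigenvalue at a fixed cycle index removes the ambiguity of the lift and makes all
  entries characters.\<close>

definition \<tau> :: "'a \<Rightarrow> 'i \<Rightarrow> complex" where "\<tau> g i = t g i / t g x0"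

lemma \<tau>_mult: assumes "g \<in> carrier G" "h \<in> carrier G" shows "\<tau> (g \<otimes> h) i = \<tau> g i * \<tau> h i"
proof -
  from t_mult[OF assms] obtain c where c: "c ^ 3 = 1" "\<And>i. t (g \<otimes> h) i = c * t g i * t h i" by blast
  have "c \<noteq> 0" using c(1) by auto
  then show ?thesis by (simp add: \<tau>_def c(2))
qed

lemma character_ratio: "character G (\<lambda>g. t g a / t g b)"
proof -
  have "t (g \<otimes> h) a / t (g \<otimes> h) b = t g a / t g b * (t h a / t h b)" if gh: "g \<in> carrier G" "h \<in> carrier G" for g h
  proof -
    from t_mult[OF gh] obtain c where c: "c ^ 3 = 1" "\<And>i. t (g \<otimes> h) i = c * t g i * t h i" by blast
    have "c \<noteq> 0" using c(1) by auto
    then show ?thesis by (simp add: c(2))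
  qed
  then show ?thesis using t_nonzero by (simp add: character_def)
qed

lemma character_cube: "character G (\<lambda>g. t g a ^ (3 * k))"
proof -
  have "t (g \<otimes> h) a ^ (3 * k) = t g a ^ (3 * k) * t h a ^ (3 * k)" if gh: "g \<in> carrier G" "h \<in> carrier G" for g h
  proof -
    from t_mult[OF gh] obtain c where c: "c ^ 3 = 1" "\<And>i. t (g \<otimes> h) i = c * t g i * t h i" by blast
    have "c ^ (3 * k) = 1" using c(1) by (simp add: power_mult)
    then show ?thesis by (simp add: c(2) power_mult_distrib)
  qed
  then show ?thesis using t_nonzero by (simp add: character_def)
qed

lemma character_\<tau>: "character G (\<lambda>g. \<tau> g i)"
  unfolding \<tau>_def by (rule character_ratio)

lemma \<tau>_nonzero: "g \<in> carrier G \<Longrightarrow> \<tau> g i \<noteq> 0"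
  using character_\<tau> by (simp add: character_def)

lemma \<tau>_one: "\<tau> \<one> i = 1" using character_one[OF is_group character_\<tau>] .

lemma \<tau>_inv: "g \<in> carrier G \<Longrightarrow> \<tau> (inv g) i = inverse (\<tau> g i)"
  using character_inv[OF is_group character_\<tau>] .

lemma \<tau>_pow: "g \<in> carrier G \<Longrightarrow> \<tau> (g [^] (k::nat)) i = \<tau> g i ^ k"
  using character_pow[OF is_group character_\<tau>] .

lemma \<tau>_faithful: assumes "g \<in> carrier G" "\<And>i. \<tau> g i = 1" shows "g = \<one>"
proof (rule faithful[OF assms(1)])
  fix i j show "t g i = t g j"
    using assms(2)[of i] assms(2)[of j] t_nonzero[OF assms(1)] by (simp add: \<tau>_def)
qed

lemma \<tau>_inj: assumes "g \<in> carrier G" "h \<in> carrier G" "\<And>i. \<tau> g i = \<tau> h i" shows "g = h"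
proof -
  have "g \<otimes> inv h = \<one>"
    by (rule \<tau>_faithful) (use assms \<tau>_nonzero in \<open>auto simp: \<tau>_mult \<tau>_inv\<close>)
  then show ?thesis using assms(1,2) by (metis inv_solve_right' l_one one_closed)
qed

text \<open>The elements acting by a scalar on the coordinates of the cycles. By following \<open>\<sigma>\<close> into a cycle, \<open>\<tau>\<close> becomes trivial
  after six squarings, so this is a 2-group.\<close>

definition K :: "'a set" where "K = {g \<in> carrier G. \<forall>x\<in>C. \<tau> g x = 1}"

lemma K_carrier: "g \<in> K \<Longrightarrow> g \<in> carrier G" by (simp add: K_def)

lemma K_subset: "K \<subseteq> carrier G" by (auto simp: K_def)

lemma finite_K: "finite K" using K_subset fin finite_subset by blast

lemma K_iff: "g \<in> K \<longleftrightarrow> g \<in> carrier G \<and> (\<forall>x\<in>C. t g x = t g x0)"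
  unfolding K_def \<tau>_def using t_nonzero by auto

lemma subgroup_K: "subgroup K G"
proof (rule subgroupI)
  show "K \<noteq> {}" using \<tau>_one by (auto simp: K_def)
qed (auto simp: K_def \<tau>_mult \<tau>_inv)

lemma K_cube: assumes "g \<in> K" "x \<in> C" shows "t g x ^ 3 = 1"
proof -
  have "t g (\<sigma> x) = t g x" using assms \<sigma>_C unfolding K_iff by metis
  then show ?thesis using invariant_\<sigma>[OF invariant_t, of g x] assms(1) K_carrier
    by (simp add: power2_eq_square power3_eq_cube)
qed

lemma invariant_\<tau>: assumes "g \<in> K" shows "invariant (\<tau> g)"
proof -
  have "t g x0 ^ 3 = 1" using K_cube[OF assms x0] .
  moreover have "\<tau> g i * \<tau> g j * \<tau> g k = t g i * t g j * t g k / t g x0 ^ 3" for i j k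
    by (simp add: \<tau>_def power3_eq_cube)
  ultimately show ?thesis using R_t[OF K_carrier[OF assms]] by (simp add: invariant_def)
qed

lemma \<tau>_C: "g \<in> K \<Longrightarrow> x \<in> C \<Longrightarrow> \<tau> g x = 1" by (simp add: K_def)

lemma K_64: assumes "g \<in> K" shows "g [^] (64::nat) = \<one>"
proof (rule \<tau>_faithful)
  fix i show "\<tau> (g [^] (64::nat)) i = 1"
    using invariant_\<sigma>6[OF invariant_\<tau>[OF assms], of i] \<tau>_C[OF assms \<sigma>6_C, of i] K_carrier[OF assms]
    by (simp add: \<tau>_pow)
qed (use K_carrier[OF assms] in simp)

text \<open>A filtration of \<open>K\<close> by the sets of indices on which an element is trivial.\<close>

definition H :: "'i set \<Rightarrow> 'a set" where "H S = {g \<in> K. \<forall>i\<in>S. \<tau> g i = 1}"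

lemma finite_H: "finite (H S)" using finite_K by (simp add: H_def)

lemma H_C: "H C = K" by (auto simp: H_def \<tau>_C)

lemma H_UNIV: "H UNIV = {\<one>}"
proof (intro equalityI subsetI)
  fix g assume "g \<in> H UNIV"
  then have "g \<in> carrier G" "\<And>i. \<tau> g i = 1" by (auto simp: H_def K_def)
  then show "g \<in> {\<one>}" using \<tau>_faithful[of g] by simp
qed (simp add: H_def \<tau>_one subgroup.one_closed[OF subgroup_K])

lemma \<tau>_sq: assumes "g \<in> K" "\<tau> g (\<sigma> i) = 1" shows "(\<tau> g i)\<^sup>2 = 1"
  using invariant_\<sigma>[OF invariant_\<tau>[OF assms(1)], of i] assms(2) by simp

text \<open>For elements trivial at \<open>\<sigma> i\<close> the entry at \<open>i\<close> is a square root of 1, hence a sign.\<close>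

lemma card_H_step: assumes "\<sigma> i \<in> S" shows "card (H S) \<le> 2 * card (H (insert i S))"
proof (cases "H S = H (insert i S)")
  case False
  have sub: "H (insert i S) \<subseteq> H S" by (auto simp: H_def)
  then obtain g where g: "g \<in> H S" "g \<notin> H (insert i S)" using False by blast
  have pm: "\<tau> h i = -1" if "h \<in> H S - H (insert i S)" for h
    using that \<tau>_sq[of h i] assms unfolding H_def by (auto simp: power2_eq_1_iff)
  have "(\<lambda>h. g \<otimes> h) ` (H S - H (insert i S)) \<subseteq> H (insert i S)"
  proof clarify
    fix h assume h: "h \<in> H S" "h \<notin> H (insert i S)"
    have "g \<in> K" "h \<in> K" using g h by (auto simp: H_def)
    then have "g \<otimes> h \<in> K" using subgroup.m_closed[OF subgroup_K] by blast
    moreover have "\<tau> (g \<otimes> h) j = \<tau> g j * \<tau> h j" for j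
      using \<tau>_mult K_carrier \<open>g \<in> K\<close> \<open>h \<in> K\<close> by blast
    ultimately show "g \<otimes> h \<in> H (insert i S)"
      using g h pm[of g] pm[of h] by (auto simp: H_def)
  qed
  moreover have "inj_on (\<lambda>h. g \<otimes> h) (H S - H (insert i S))"
    using g K_carrier by (auto intro!: inj_onI simp: H_def)
  ultimately have "card (H S - H (insert i S)) \<le> card (H (insert i S))"
    using finite_H by (metis card_inj_on_le)
  moreover have "card (H S) = card (H S - H (insert i S)) + card (H (insert i S))"
    using sub finite_H card_Diff_subset[OF finite_H sub] card_mono[OF finite_H sub] by simp
  ultimately show ?thesis by simp
qed simp

lemma card_H_chain:
  assumes "C \<subseteq> S" "\<sigma> ` S \<subseteq> S" "\<sigma> ` S' \<subseteq> S'" "S \<subseteq> S'"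
  shows "card (H S) \<le> 2 ^ card (S' - S) * card (H S')"
  using assms(1,2,4)
proof (induction "card (S' - S)" arbitrary: S)
  case 0
  then have "S = S'" by auto
  then show ?case by simp
next
  case (Suc n)
  then have "S \<subset> S'" by auto
  then obtain i where i: "i \<in> S' - S" "\<sigma> i \<in> S" using closed_step[OF Suc.prems(1) assms(3)] by blast
  have n: "n = card (S' - insert i S)"
    using Suc.hyps(2) i by (metis Diff_insert card_Diff_singleton diff_Suc_1)
  have "card (H (insert i S)) \<le> 2 ^ card (S' - insert i S) * card (H S')"
    by (rule Suc.hyps(1)[OF n]) (use Suc.prems i in auto)
  then have "2 * card (H (insert i S)) \<le> 2 ^ Suc n * card (H S')" using n by simp
  then show ?case using card_H_step[OF i(2)] Suc.hyps(2) by simp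
qed

lemma card_K_le: "card K \<le> 2 ^ (6 - card C)"
proof -
  have "card (UNIV - C) = 6 - card C" using card_Diff_subset[of C UNIV] card6 by simp
  then show ?thesis using card_H_chain[of C UNIV] \<sigma>_C H_C H_UNIV by auto
qed

text \<open>The 2-torsion of \<open>K\<close>; its order bounds the number of cyclic factors.\<close>

definition E :: "'a set" where "E = {g \<in> K. \<forall>i. (\<tau> g i)\<^sup>2 = 1}"

lemma K_decomposition:
  "\<exists>M. embeds_in (G\<lparr>carrier := K\<rparr>) M \<and> prod_mset M = card K \<and> (\<forall>m\<in>#M. \<exists>e\<ge>1. m = 2 ^ e) \<and> 2 ^ size M \<le> card E"
proof -
  have pow: "x [^]\<^bsub>G\<lparr>carrier := K\<rparr>\<^esub> (n::nat) = x [^] n" for x n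
    by (rule nat_pow_consistent[symmetric])
  have "{x \<in> K. x [^] (2::nat) = \<one>} = E"
  proof (intro equalityI subsetI)
    fix x assume x: "x \<in> {x \<in> K. x [^] (2::nat) = \<one>}"
    then have "(\<tau> x i)\<^sup>2 = 1" for i
      using \<tau>_pow[of x 2 i] \<tau>_one K_carrier by simp
    then show "x \<in> E" using x by (simp add: E_def)
  next
    fix x assume x: "x \<in> E"
    then have c: "x \<in> carrier G" using K_carrier by (simp add: E_def)
    have "x [^] (2::nat) = \<one>"
      by (rule \<tau>_faithful) (use x c in \<open>auto simp: E_def \<tau>_pow\<close>)
    then show "x \<in> {x \<in> K. x [^] (2::nat) = \<one>}" using x by (simp add: E_def)
  qed
  then obtain M where "embeds_in (G\<lparr>carrier := K\<rparr>) M" "prod_mset M = card K"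
    "\<forall>m\<in>#M. \<exists>e\<in>{1..6}. m = 2 ^ e" "2 ^ size M \<le> card E"
    using abelian_p_group_embeds_in[of 2 "G\<lparr>carrier := K\<rparr>" 6]
      comm_group_subgroup[OF comm_group_axioms subgroup_K] finite_K K_64 by (auto simp: pow)
  then show ?thesis by (intro exI[of _ M]) fastforce
qed

end

lemma eq_sign_if_mult_eq_1:
  fixes z w :: complex
  assumes "z * w = 1" "w = 1 \<or> w = -1" shows "z = w"
proof -
  have "w * w = 1" using assms(2) by auto
  then have "z = z * (w * w)" by simp
  also have "\<dots> = w" using assms(1) by (simp flip: mult.assoc)
  finally show ?thesis .
qed

context diagonal_action
begin

subsection \<open>The 2-torsion as a binary code\<close>

definition neg :: "'a \<Rightarrow> 'i set" where "neg g = {i. \<tau> g i = -1}"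

text \<open>An element of \<open>E\<close> is determined by the set of indices with sign \<open>-1\<close>. These sets form a binary linear
  code under symmetric difference.\<close>

definition code :: "'i set set" where "code = neg ` E"

lemma E_K: "g \<in> E \<Longrightarrow> g \<in> K" by (simp add: E_def)

lemma E_\<tau>: "g \<in> E \<Longrightarrow> \<tau> g i = (if i \<in> neg g then -1 else 1)"
  by (auto simp: E_def neg_def power2_eq_1_iff)

lemma card_code: "card code = card E"
proof -
  have "inj_on neg E"
  proof (rule inj_onI)
    fix g h assume gh: "g \<in> E" "h \<in> E" "neg g = neg h"
    show "g = h" by (rule \<tau>_inj) (use gh E_\<tau> E_K K_carrier in auto)
  qed
  then show ?thesis unfolding code_def by (rule card_image)
qed

lemma one_E: "\<one> \<in> E" using subgroup.one_closed[OF subgroup_K] by (simp add: E_def \<tau>_one)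

lemma empty_code: "{} \<in> code"
proof -
  have "neg \<one> = {}" by (auto simp: neg_def \<tau>_one)
  then show ?thesis using one_E unfolding code_def by (metis image_eqI)
qed

lemma code_sym_diff: assumes "S \<in> code" "T \<in> code" shows "sym_diff S T \<in> code"
proof -
  obtain g h where gh: "g \<in> E" "h \<in> E" "S = neg g" "T = neg h" using assms by (auto simp: code_def)
  have m: "\<tau> (g \<otimes> h) i = \<tau> g i * \<tau> h i" for i
    using \<tau>_mult gh E_K K_carrier by blast
  have "g \<otimes> h \<in> K" using subgroup.m_closed[OF subgroup_K] gh E_K by blast
  then have "g \<otimes> h \<in> E" using gh by (simp add: E_def m power_mult_distrib)
  moreover have "neg (g \<otimes> h) = sym_diff (neg g) (neg h)"
  proof -
    have "\<tau> (g \<otimes> h) i = -1 \<longleftrightarrow> i \<in> sym_diff (neg g) (neg h)" for i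
      using m[of i] E_\<tau>[OF gh(1), of i] E_\<tau>[OF gh(2), of i] by (simp split: if_splits)
    then show ?thesis unfolding neg_def[of "g \<otimes> h"] by blast
  qed
  ultimately show ?thesis unfolding code_def gh(3,4) by (metis image_eqI)
qed

text \<open>Sign vectors of elements of \<open>E\<close> multiply to 1 along every monomial.\<close>

lemma code_R: assumes "S \<in> code" "R i j k" shows "((i \<in> S) \<noteq> (j \<in> S)) = (k \<in> S)"
proof -
  obtain g where g: "g \<in> E" "S = neg g" using assms by (auto simp: code_def)
  have "\<tau> g i * \<tau> g j * \<tau> g k = 1"
    using invariantD[OF invariant_\<tau>[OF E_K[OF g(1)]] assms(2)] .
  then show ?thesis using E_\<tau>[OF g(1)] g(2) by (auto split: if_splits)
qed

text \<open>If \<open>S\<close> had more elements than its complement, smoothness would give a monomial inside \<open>S\<close>, with sign \<open>-1\<close>.\<close>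

lemma card_code_word: assumes "S \<in> code" shows "card S \<le> 3"
proof (rule ccontr)
  assume "\<not> ?thesis"
  moreover have "card (UNIV - S) = 6 - card S" using card_Diff_subset[of S UNIV] card6 by simp
  ultimately have "card (UNIV - S) \<le> 2" "card (UNIV - S) < card S" by linarith+
  from nondeg[OF this] obtain i k l where "i \<in> S" "k \<in> S" "l \<notin> UNIV - S" "R i k l" by blast
  then show False using code_R[OF assms] by blast
qed

text \<open>The indices without preimage. Code words avoid the range of \<open>\<sigma>\<close>, because the square of a sign is 1.\<close>

definition N :: "'i set" where "N = UNIV - range \<sigma>"

lemma code_N: assumes "S \<in> code" shows "S \<subseteq> N"
  using code_R[OF assms R_\<sigma>] unfolding N_def by auto

lemma code_Pow: "code \<subseteq> Pow N" using code_N by auto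

lemma R_outside: assumes "{a} \<in> code" "R i i l" shows "l \<noteq> a"
  using code_R[OF assms] by auto

lemma order_four_exists: assumes "E \<noteq> K" obtains h where "h \<in> K" "h \<notin> E" "h [^] (2::nat) \<in> E"
proof -
  obtain g where g: "g \<in> K" "g \<notin> E" using assms E_K by blast
  define n where "n = (LEAST n. g [^] ((2::nat) ^ n) \<in> E)"
  have "g [^] ((2::nat) ^ 6) \<in> E" using K_64[OF g(1)] one_E by simp
  then have n: "g [^] ((2::nat) ^ n) \<in> E" unfolding n_def by (rule LeastI)
  have "n \<noteq> 0"
  proof
    assume "n = 0"
    then show False using n g K_carrier by simp
  qed
  then have "g [^] ((2::nat) ^ (n - 1)) \<notin> E"
    using not_less_Least[of "n - 1" "\<lambda>n. g [^] ((2::nat) ^ n) \<in> E"] unfolding n_def[symmetric] by simp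
  moreover have "(g [^] ((2::nat) ^ (n - 1))) [^] (2::nat) = g [^] ((2::nat) ^ n)"
    using \<open>n \<noteq> 0\<close> K_carrier[OF g(1)] by (cases n) (auto simp: nat_pow_pow mult.commute)
  moreover have "g [^] (k::nat) \<in> K" for k
    by (induction k) (use g subgroup.m_closed[OF subgroup_K] subgroup.one_closed[OF subgroup_K] in auto)
  ultimately show ?thesis using that n by metis
qed

lemma K_eq_E_if: assumes "g \<in> K" "\<And>j. j \<in> range \<sigma> \<Longrightarrow> \<tau> g j = 1" shows "g \<in> E"
  using assms \<tau>_sq[of g] unfolding E_def by blast

text \<open>Let \<open>h\<close> have order four with square in \<open>E\<close> and let \<open>T\<close> be its entries. The code separates the indices of \<open>L\<close>, so a
  monomial contains each of them an even number of times. On \<open>L\<close> the squares of the entries are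
  \<open>\<plusminus>1\<close> and outside they are signs themselves; this divides the indices into \<open>Lp\<close>, \<open>Lm\<close>, \<open>Jp\<close>, \<open>Jm\<close>. A monomial
  \<open>x\<^sub>i x\<^sub>k x\<^sub>l\<close> with \<open>i, k \<in> Lp \<union> Jm\<close> has \<open>l \<in> Jp\<close>, and one with \<open>i, k \<in> Lm\<close> has \<open>l \<in> Jm\<close>. The
  inequalities which smoothness implies for the cardinalities contradict each other.\<close>

lemma no_full_code:
  assumes "E \<noteq> K" "card L = 3" "code = Pow L" shows False
proof -
  obtain h where h: "h \<in> K" "h \<notin> E" "h [^] (2::nat) \<in> E" using order_four_exists[OF assms(1)] .
  define T where "T = \<tau> h"
  have invT: "T i * T j * T k = 1" if "R i j k" for i j k
    using invariantD[OF invariant_\<tau>[OF h(1)] that] by (simp add: T_def)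
  have single: "{a} \<in> code" if "a \<in> L" for a using assms(3) that by auto
  have J: "l \<notin> L" if "R i i l" for i l using R_outside[OF single that] by blast
  have T_J: "T j = 1 \<or> T j = -1" if "j \<notin> L" for j
  proof -
    have "neg (h [^] (2::nat)) \<subseteq> L" using h(3) assms(3) unfolding code_def by blast
    then have "\<tau> (h [^] (2::nat)) j = 1" using E_\<tau>[OF h(3), of j] that by auto
    then have "(T j)\<^sup>2 = 1" using \<tau>_pow[of h 2 j] K_carrier[OF h(1)] by (simp add: T_def)
    then show ?thesis by (simp add: power2_eq_1_iff)
  qed
  have T_L: "(T a)\<^sup>2 = 1 \<or> (T a)\<^sup>2 = -1" for a
    using eq_sign_if_mult_eq_1[OF invT[OF R_\<sigma>[of a]] T_J[OF J[OF R_\<sigma>[of a]]]]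
      T_J[OF J[OF R_\<sigma>[of a]]] by (auto simp: power2_eq_square)
  define Jm where "Jm = {j. j \<notin> L \<and> T j = -1}"
  define Jp where "Jp = {j. j \<notin> L \<and> T j = 1}"
  define Lp where "Lp = {a \<in> L. (T a)\<^sup>2 = 1}"
  define Lm where "Lm = {a \<in> L. (T a)\<^sup>2 \<noteq> 1}"
  have "UNIV - L = Jm \<union> Jp" "Jm \<inter> Jp = {}" using T_J by (auto simp: Jm_def Jp_def)
  then have cJ: "card Jm + card Jp = 3"
    using card_Diff_subset[of L UNIV] card6 assms(2) card_Un_disjoint[of Jm Jp] by simp
  have "L = Lp \<union> Lm" "Lp \<inter> Lm = {}" by (auto simp: Lp_def Lm_def)
  then have cL: "card Lp + card Lm = 3" using assms(2) card_Un_disjoint[of Lp Lm] by simp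
  have "Lp \<inter> Jm = {}" by (auto simp: Lp_def Jm_def)
  then have cS: "card (Lp \<union> Jm) = card Lp + card Jm" by (simp add: card_Un_disjoint)
  have "Jm \<noteq> {}"
  proof
    assume "Jm = {}"
    have "T j = 1" if "j \<notin> L" for j using T_J[OF that] \<open>Jm = {}\<close> that unfolding Jm_def by blast
    then have "\<tau> h j = 1" if "j \<in> range \<sigma>" for j using J[OF R_\<sigma>] that unfolding T_def by blast
    then have "h \<in> E" by (rule K_eq_E_if[OF h(1)])
    then show False using h(2) by simp
  qed
  then have Jm0: "card Jm > 0" by (simp add: card_gt_0_iff)
  have c1: "card Lp + card Jm \<le> card Jp"
  proof (rule ccontr)
    assume "\<not> ?thesis"
    then have "card Jp \<le> 2" "card Jp < card (Lp \<union> Jm)" using cS cJ Jm0 by linarith+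
    from nondeg[OF this] obtain i k l
      where ikl: "i \<in> Lp \<union> Jm" "k \<in> Lp \<union> Jm" "l \<notin> Jp" "R i k l" by blast
    have P: "((i = a) \<noteq> (k = a)) = (l = a)" if "a \<in> L" for a
      using code_R[OF single[OF that] ikl(4)] by simp
    have sq: "l \<in> Jp" if "l \<notin> L" "T i * T k = 1"
      using invT[OF ikl(4)] that by (simp add: Jp_def)
    show False
    proof (cases "i \<in> L \<and> k \<in> L")
      case True
      show ?thesis
      proof (cases "i = k")
        case True
        then have "l \<notin> L" using P by blast
        moreover have "T i * T k = 1" using True \<open>i \<in> L \<and> k \<in> L\<close> ikl(1) by (auto simp: Lp_def Jm_def power2_eq_square)
        ultimately show ?thesis using sq ikl(3) by blast
      next
        case False
        then show ?thesis using P[of i] P[of k] \<open>i \<in> L \<and> k \<in> L\<close> by auto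
      qed
    next
      case False
      then consider "i \<in> Lp" "k \<in> Jm" | "i \<in> Jm" "k \<in> Lp" | "i \<in> Jm" "k \<in> Jm"
        using ikl(1,2) by (auto simp: Lp_def Jm_def)
      then show ?thesis
      proof cases
        case 1
        then have "l = i" using P[of i] by (auto simp: Lp_def Jm_def)
        then have "(T i)\<^sup>2 * T k = 1" using invT[OF ikl(4)] by (simp add: power2_eq_square mult_ac)
        then show ?thesis using 1 by (simp add: Lp_def Jm_def)
      next
        case 2
        then have "l = k" using P[of k] by (auto simp: Lp_def Jm_def)
        then have "(T k)\<^sup>2 * T i = 1" using invT[OF ikl(4)] by (simp add: power2_eq_square mult_ac)
        then show ?thesis using 2 by (simp add: Lp_def Jm_def)
      next
        case 3
        then have "l \<notin> L" using P[of l] by (auto simp: Jm_def)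
        then show ?thesis using sq ikl(3) 3 by (simp add: Jm_def)
      qed
    qed
  qed
  have c2: "card Lm \<le> card Jm"
  proof (rule ccontr)
    assume "\<not> ?thesis"
    then have "card Jm \<le> 2" "card Jm < card Lm" using cJ c1 by linarith+
    from nondeg[OF this] obtain i k l where ikl: "i \<in> Lm" "k \<in> Lm" "l \<notin> Jm" "R i k l" by blast
    have P: "((i = a) \<noteq> (k = a)) = (l = a)" if "a \<in> L" for a
      using code_R[OF single[OF that] ikl(4)] by simp
    have "i = k" using P[of i] P[of k] ikl(1,2) by (auto simp: Lm_def)
    moreover have "(T i)\<^sup>2 = -1" using T_L[of i] ikl(1) by (auto simp: Lm_def)
    ultimately have "T l * (-1) = 1" using invT[OF ikl(4)] by (simp flip: power2_eq_square)
    then have "T l = -1" by (rule eq_sign_if_mult_eq_1) simp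
    moreover have "l \<notin> L" using J ikl(4) \<open>i = k\<close> by blast
    ultimately show False using ikl(3) by (simp add: Jm_def)
  qed
  show False using c1 c2 cL cJ Jm0 by linarith
qed

text \<open>The other code of dimension three on four indices, generated by \<open>{d}\<close> and the pairs in \<open>{a, b, c}\<close>. As before an
  element \<open>h\<close> of order four is considered. Only two indices \<open>jm\<close>, \<open>jp\<close> lie outside \<open>N\<close>, with
  entries \<open>-1\<close> and \<open>1\<close>; all entries on \<open>N\<close> turn out to be primitive fourth roots of unity, and then the only monomials in
  \<open>x\<^sub>d\<close>, \<open>x\<^sub>a\<close> and a third coordinate are completed by \<open>jm\<close>, against smoothness.\<close>

lemma no_even_code:
  assumes "E \<noteq> K" "N = {a, b, c, d}" "card N = 4"
    and code: "{d} \<in> code" "{a, b} \<in> code" "{a, c} \<in> code" "{b, c} \<in> code"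
  shows False
proof -
  obtain h where h: "h \<in> K" "h \<notin> E" "h [^] (2::nat) \<in> E" using order_four_exists[OF assms(1)] .
  define T where "T = \<tau> h"
  have invT: "T i * T j * T k = 1" if "R i j k" for i j k
    using invariantD[OF invariant_\<tau>[OF h(1)] that] by (simp add: T_def)
  have dist: "a \<noteq> b" "a \<noteq> c" "a \<noteq> d" "b \<noteq> c" "b \<noteq> d" "c \<noteq> d"
    using assms(2,3) by (auto simp: card_insert_if split: if_splits)
  have P: "((i = d) \<noteq> (k = d)) = (l = d)"
    "((i = a \<or> i = b) \<noteq> (k = a \<or> k = b)) = (l = a \<or> l = b)"
    "((i = a \<or> i = c) \<noteq> (k = a \<or> k = c)) = (l = a \<or> l = c)"
    "((i = b \<or> i = c) \<noteq> (k = b \<or> k = c)) = (l = b \<or> l = c)" if "R i k l" for i k l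
    using code[THEN code_R, OF that] by simp_all
  have sq: "l \<notin> N" if "R i i l" for i l using P[OF that] assms(2) by auto
  have T_J: "T j = 1 \<or> T j = -1" if "j \<notin> N" for j
  proof -
    have "neg (h [^] (2::nat)) \<subseteq> N" using h(3) code_Pow unfolding code_def by blast
    then have "\<tau> (h [^] (2::nat)) j = 1" using E_\<tau>[OF h(3), of j] that by auto
    then have "(T j)\<^sup>2 = 1" using \<tau>_pow[of h 2 j] K_carrier[OF h(1)] by (simp add: T_def)
    then show ?thesis by (simp add: power2_eq_1_iff)
  qed
  have "\<exists>j. j \<notin> N \<and> T j = -1"
  proof (rule ccontr)
    assume "\<not> ?thesis"
    then have "T j = 1" if "j \<notin> N" for j using T_J[OF that] that by blast
    then have "\<tau> h j = 1" if "j \<in> range \<sigma>" for j using that unfolding T_def N_def by blast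
    then have "h \<in> E" by (rule K_eq_E_if[OF h(1)])
    then show False using h(2) by simp
  qed
  then obtain jm where jm: "jm \<notin> N" "T jm = -1" by blast
  define jp where "jp = \<sigma> jm"
  have jp: "jp \<notin> N" "T jp = 1"
    using sq[OF R_\<sigma>] invT[OF R_\<sigma>, of jm] jm unfolding jp_def by auto
  have "card (UNIV - N) = 2" using card_Diff_subset[of N UNIV] card6 assms(3) by simp
  moreover have "{jm, jp} \<subseteq> UNIV - N" "jm \<noteq> jp" using jm jp by auto
  ultimately have J: "UNIV - N = {jm, jp}" by (intro card_subset_eq[symmetric]) auto
  have Jl: "l = jm \<or> l = jp" if "l \<notin> N" for l using J that by blast
  have Tn: "(T n)\<^sup>2 = -1" if n: "n \<in> N" for n
  proof -
    have "(T n)\<^sup>2 \<noteq> 1"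
    proof
      assume n1: "(T n)\<^sup>2 = 1"
      have "n \<noteq> jm" using n jm by auto
      then have "card {jp} \<le> 2" "card {jp} < card {jm, n}" by simp_all
      from nondeg[OF this] obtain i k l
        where ikl: "i \<in> {jm, n}" "k \<in> {jm, n}" "l \<notin> {jp}" "R i k l" by blast
      show False
      proof (cases "i = k")
        case True
        then have "l = jm" using sq Jl ikl by auto
        then show False using invT[OF ikl(4)] True ikl(1) jm n1 by (auto simp: power2_eq_square)
      next
        case False
        then have ik: "i = jm \<and> k = n \<or> i = n \<and> k = jm" using ikl by auto
        then have "l = n" using P[OF ikl(4)] n jm(1) dist unfolding assms(2) by auto
        then have "(T n)\<^sup>2 * T jm = 1" using invT[OF ikl(4)] ik by (auto simp: power2_eq_square mult_ac)
        then show False using n1 jm by simp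
      qed
    qed
    moreover have "(T n)\<^sup>2 * T (\<sigma> n) = 1" using invT[OF R_\<sigma>] by (simp add: power2_eq_square)
    ultimately show ?thesis
      using eq_sign_if_mult_eq_1[of "(T n)\<^sup>2"] T_J[OF sq[OF R_\<sigma>[of n]]] by metis
  qed
  have "card {jm} \<le> 2" "card {jm} < card {d, a}" using dist by simp_all
  from nondeg[OF this] obtain i k l where ikl: "i \<in> {d, a}" "k \<in> {d, a}" "l \<notin> {jm}" "R i k l" by blast
  show False
  proof (cases "i = k")
    case True
    then have "l = jp" using sq Jl ikl by auto
    moreover have "(T i)\<^sup>2 = -1" using Tn[of i] ikl(1) assms(2) by auto
    ultimately show False using invT[OF ikl(4)] jp True by (simp add: power2_eq_square)
  next
    case False
    then show False using P[OF ikl(4)] ikl(1,2) dist by auto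
  qed
qed

text \<open>When the whole of \<open>N\<close> is not a code word, the code and the set of complements are disjoint, so a code of half the
  possible size contains exactly one of each pair of complementary sets.\<close>

lemma code_complement:
  assumes "N \<notin> code" "2 * card code \<ge> 2 ^ card N" "S \<subseteq> N"
  shows "S \<in> code \<or> N - S \<in> code" "2 * card code = 2 ^ card N"
proof -
  let ?f = "\<lambda>S. N - S"
  have disj: "code \<inter> ?f ` code = {}"
  proof -
    have False if "S \<in> code" "T \<in> code" "S = N - T" for S T
    proof -
      have "sym_diff S T = N" using that code_N[OF that(2)] by auto
      then show False using code_sym_diff[OF that(1,2)] assms(1) by simp
    qed
    then show ?thesis by blast
  qed
  have "inj_on ?f code" by (rule inj_onI) (use code_N in blast)
  then have c: "card (code \<union> ?f ` code) = 2 * card code"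
    using disj by (simp add: card_Un_disjoint card_image)
  have sub: "code \<union> ?f ` code \<subseteq> Pow N" using code_Pow by auto
  have "card (code \<union> ?f ` code) \<le> 2 ^ card N" using card_mono[OF _ sub] by (simp add: card_Pow)
  then show "2 * card code = 2 ^ card N" using c assms(2) by simp
  then have "code \<union> ?f ` code = Pow N"
    using c sub by (intro card_subset_eq) (auto simp: card_Pow)
  then have "S \<in> code \<union> ?f ` code" using assms(3) by simp
  then show "S \<in> code \<or> N - S \<in> code"
  proof
    assume "S \<in> ?f ` code"
    then obtain T where "T \<in> code" "S = N - T" by blast
    then have "N - S = T" using code_N by blast
    then show ?thesis using \<open>T \<in> code\<close> by simp
  qed simp
qed

text \<open>The code has at least eight words of weight at most three, on at most five indices. The
  possibilities are all subsets of a set of three indices or, on four indices, the code of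
  \<open>no_even_code\<close>; in both cases \<open>K\<close> contains elements of order four. On five indices \<open>K = E\<close> and \<open>N\<close> itself would be a word, contradicting the weight bound.\<close>

theorem two_rank_bound: assumes "card K \<ge> 16" shows "card E < 8"
proof (rule ccontr)
  assume "\<not> ?thesis"
  then have E8: "card code \<ge> 8" by (simp add: card_code)
  have "card code \<le> 2 ^ card N" using card_mono[OF _ code_Pow] by (simp add: card_Pow)
  then have "(2::nat) ^ 3 \<le> 2 ^ card N" using E8 by simp
  then have N3: "card N \<ge> 3" by (rule power_le_imp_le_exp[rotated]) simp
  have cN: "card N = 6 - card (range \<sigma>)" unfolding N_def using card_Diff_subset[of "range \<sigma>" UNIV] card6 by simp
  have "card (range \<sigma>) > 0" by (simp add: card_gt_0_iff)
  then consider "card N = 3" | "card N = 4" | "card N = 5" using cN N3 by linarith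
  then show False
  proof cases
    case 1
    then have "code = Pow N"
      using E8 card_mono[OF _ code_Pow] by (intro card_subset_eq code_Pow) (auto simp: card_Pow)
    moreover from this have "E \<noteq> K" using card_code 1 assms by (auto simp: card_Pow)
    ultimately show False using no_full_code 1 by blast
  next
    case 2
    have Nc: "N \<notin> code" using card_code_word[of N] 2 by auto
    note compl = code_complement[OF Nc]
    have c8: "card code = 8" using compl(2)[of "{}"] 2 E8 by simp
    then have EK: "E \<noteq> K" using card_code assms by auto
    have "\<exists>a b c d. N = {a, b, c, d} \<and> distinct [a, b, c, d]"
    proof -
      obtain xs where "set xs = N" "distinct xs" using finite_distinct_list[of N] by auto
      then have "length xs = 4" using 2 distinct_card by metis
      then obtain a b c d where "xs = [a, b, c, d]" by (auto simp: numeral_eq_Suc length_Suc_conv)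
      then have "N = {a, b, c, d} \<and> distinct [a, b, c, d]" using \<open>set xs = N\<close> \<open>distinct xs\<close> by auto
      then show ?thesis by blast
    qed
    then obtain n1 n2 n3 n4 where n: "N = {n1, n2, n3, n4}" "distinct [n1, n2, n3, n4]" by blast
    have pair: "{x, y} \<in> code" if "x \<in> N" "y \<in> N" "x \<noteq> y" "({x} \<in> code) = ({y} \<in> code)" for x y
    proof (cases "{x} \<in> code")
      case True
      then have "sym_diff {x} {y} \<in> code" using that code_sym_diff by blast
      moreover have "sym_diff {x} {y} = {x, y}" using that by auto
      ultimately show ?thesis by simp
    next
      case False
      then have "N - {x} \<in> code" "N - {y} \<in> code" using compl(1)[of "{x}"] compl(1)[of "{y}"] that 2 E8 by auto
      then have "sym_diff (N - {x}) (N - {y}) \<in> code" by (rule code_sym_diff)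
      moreover have "sym_diff (N - {x}) (N - {y}) = {x, y}" using that by auto
      ultimately show ?thesis by simp
    qed
    have two: False if "{x, y} \<in> code" "{z, w} \<in> code" "N = {x, y, z, w}" "distinct [x, y, z, w]" for x y z w
    proof -
      have "sym_diff {x, y} {z, w} = N" unfolding that(3) using that(4) by auto
      then show False using code_sym_diff[OF that(1,2)] Nc by simp
    qed
    \<comment> \<open>The code contains one of \<open>{x}\<close>, \<open>N - {x}\<close> for each \<open>x\<close>. If the number of singletons in the code is
      even, \<open>N\<close> is the sum of two words that are pairs; otherwise one index \<open>d\<close> differs from the rest.\<close>
    have main: False if nn: "N = {a, b, c, d}" "distinct [a, b, c, d]"
      and s: "({a} \<in> code) = ({d} \<notin> code)" "({b} \<in> code) = ({d} \<notin> code)" "({c} \<in> code) = ({d} \<notin> code)" for a b c d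
    proof (cases "{d} \<in> code")
      case True
      have "{a, b} \<in> code" "{a, c} \<in> code" "{b, c} \<in> code"
        by (rule pair; use nn s in auto)+
      then show False using no_even_code[OF EK nn(1) 2 True] by blast
    next
      case False
      then have abc: "{a} \<in> code" "{b} \<in> code" "{c} \<in> code" using s by auto
      have *: "S \<in> code" if "S \<subseteq> {a, b, c}" for S
      proof -
        have "finite S" using that finite_subset by blast
        then show ?thesis using that
        proof (induction S rule: finite_induct)
          case (insert x S)
          then have "{x} \<in> code" "S \<in> code" using abc by auto
          then have "sym_diff {x} S \<in> code" by (rule code_sym_diff)
          moreover have "sym_diff {x} S = insert x S" using insert by auto
          ultimately show ?case by simp
        qed (rule empty_code)
      qed
      have "Pow {a, b, c} = code"
        by (rule card_subset_eq) (use * nn c8 in \<open>auto simp: card_Pow\<close>)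
      then show False using no_full_code[OF EK, of "{a, b, c}"] nn by simp
    qed
    have p12: "({n1} \<in> code) = ({n2} \<in> code) \<Longrightarrow> ({n3} \<in> code) = ({n4} \<in> code) \<Longrightarrow> False"
      using two[OF pair pair, of n1 n2 n3 n4] n by auto
    have p13: "({n1} \<in> code) = ({n3} \<in> code) \<Longrightarrow> ({n2} \<in> code) = ({n4} \<in> code) \<Longrightarrow> False"
      using two[OF pair pair, of n1 n3 n2 n4] n by auto
    have p14: "({n1} \<in> code) = ({n4} \<in> code) \<Longrightarrow> ({n2} \<in> code) = ({n3} \<in> code) \<Longrightarrow> False"
      using two[OF pair pair, of n1 n4 n2 n3] n by auto
    have m1: "({n2} \<in> code) = ({n1} \<notin> code) \<Longrightarrow> ({n3} \<in> code) = ({n1} \<notin> code) \<Longrightarrow> ({n4} \<in> code) = ({n1} \<notin> code) \<Longrightarrow> False"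
      by (rule main[of n2 n3 n4 n1]) (use n in auto)
    have m2: "({n1} \<in> code) = ({n2} \<notin> code) \<Longrightarrow> ({n3} \<in> code) = ({n2} \<notin> code) \<Longrightarrow> ({n4} \<in> code) = ({n2} \<notin> code) \<Longrightarrow> False"
      by (rule main[of n1 n3 n4 n2]) (use n in auto)
    have m3: "({n1} \<in> code) = ({n3} \<notin> code) \<Longrightarrow> ({n2} \<in> code) = ({n3} \<notin> code) \<Longrightarrow> ({n4} \<in> code) = ({n3} \<notin> code) \<Longrightarrow> False"
      by (rule main[of n1 n2 n4 n3]) (use n in auto)
    have m4: "({n1} \<in> code) = ({n4} \<notin> code) \<Longrightarrow> ({n2} \<in> code) = ({n4} \<notin> code) \<Longrightarrow> ({n3} \<in> code) = ({n4} \<notin> code) \<Longrightarrow> False"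
      by (rule main[of n1 n2 n3 n4]) (use n in auto)
    show False using p12 p13 p14 m1 m2 m3 m4 by argo
  next
    case 3
    have "card (range \<sigma>) = 1" using cN 3 by simp
    then obtain r where r: "range \<sigma> = {r}" by (auto simp: card_1_singleton_iff)
    have "(\<sigma> ^^ Suc 0) r = r" using r by auto
    then have "r \<in> C" unfolding C_def by blast
    have "g \<in> E" if "g \<in> K" for g
      by (rule K_eq_E_if[OF that]) (use r \<tau>_C[OF that \<open>r \<in> C\<close>] in simp)
    then have "K = E" using E_K by blast
    then have c16: "card code \<ge> 16" using assms card_code by simp
    have Nc: "N \<notin> code" using card_code_word[of N] 3 by auto
    have single: "{x} \<in> code" if "x \<in> N" for x
    proof -
      have "card (N - {x}) = 4" using that 3 by simp
      then have "N - {x} \<notin> code" using card_code_word[of "N - {x}"] by auto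
      then show ?thesis using code_complement(1)[OF Nc, of "{x}"] 3 c16 that by auto
    qed
    have "S \<in> code" if "S \<subseteq> N" for S
    proof -
      have "finite S" by simp
      then show ?thesis using that
      proof (induction S rule: finite_induct)
        case (insert x S)
        then have "{x} \<in> code" "S \<in> code" using single by auto
        then have "sym_diff {x} S \<in> code" by (rule code_sym_diff)
        moreover have "sym_diff {x} S = insert x S" using insert by auto
        ultimately show ?case by simp
      qed (rule empty_code)
    qed
    then show False using Nc by blast
  qed
qed

subsection \<open>A 2-group of order 32\<close>

definition subtree :: "'i \<Rightarrow> 'i set" where "subtree i = {x. \<exists>n. (\<sigma> ^^ n) x = i}"

lemma subtree_self: "i \<in> subtree i"
  unfolding subtree_def by (intro CollectI exI[of _ 0]) simp

lemma subtree_trans: assumes "x \<in> subtree y" "y \<in> subtree z" shows "x \<in> subtree z"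
proof -
  obtain n m where "(\<sigma> ^^ n) x = y" "(\<sigma> ^^ m) y = z" using assms unfolding subtree_def by blast
  then have "(\<sigma> ^^ (m + n)) x = z" by (simp add: funpow_add)
  then show ?thesis unfolding subtree_def by blast
qed

lemma subtree_\<sigma>: assumes "\<sigma> x \<in> subtree y" shows "x \<in> subtree y"
proof -
  obtain n where "(\<sigma> ^^ n) (\<sigma> x) = y" using assms unfolding subtree_def by blast
  then have "(\<sigma> ^^ Suc n) x = y" by (simp only: funpow_Suc_right o_apply)
  then show ?thesis unfolding subtree_def by blast
qed

lemma subtree_step: assumes "x \<in> subtree y" "x \<noteq> y" shows "\<sigma> x \<in> subtree y"
proof -
  obtain n where n: "(\<sigma> ^^ n) x = y" using assms unfolding subtree_def by blast
  then obtain m where "n = Suc m" using assms(2) by (cases n) auto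
  then have "(\<sigma> ^^ m) (\<sigma> x) = y" using n by (simp only: funpow_Suc_right o_apply)
  then show ?thesis unfolding subtree_def by blast
qed

lemma cycle_C: assumes "\<sigma> x \<in> subtree x" shows "x \<in> C"
proof -
  obtain n where "(\<sigma> ^^ n) (\<sigma> x) = x" using assms unfolding subtree_def by blast
  then have "(\<sigma> ^^ Suc n) x = x" by (simp only: funpow_Suc_right o_apply)
  then show ?thesis unfolding C_def by blast
qed

text \<open>If the bound for \<open>K\<close> is attained, every step of every filtration doubles the order. Adding first the indices outside
  the subtree of \<open>i\<close> and then \<open>i\<close> itself produces the required element.\<close>

lemma branch_sign:
  assumes card: "card K = 2 ^ (6 - card C)" and i: "i \<notin> C"
  shows "\<exists>g\<in>K. \<tau> g i = -1 \<and> (\<forall>x. x \<notin> subtree i \<longrightarrow> \<tau> g x = 1)"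
proof -
  define S where "S = - subtree i"
  have CS: "C \<subseteq> S"
  proof
    fix x assume x: "x \<in> C"
    show "x \<in> S"
    proof (rule ccontr)
      assume "x \<notin> S"
      then obtain n where "(\<sigma> ^^ n) x = i" by (auto simp: S_def subtree_def)
      then show False using \<sigma>n_C[OF x] i by auto
    qed
  qed
  have closed: "\<sigma> ` S \<subseteq> S" unfolding S_def using subtree_\<sigma> by blast
  have \<sigma>iS: "\<sigma> i \<in> S" unfolding S_def using cycle_C i by blast
  have iS: "i \<notin> S" unfolding S_def using subtree_self by blast
  have "card K \<le> 2 ^ card (S - C) * card (H S)"
    using card_H_chain[of C S] CS closed \<sigma>_C H_C by auto
  moreover have "card (H (insert i S)) \<le> 2 ^ card (UNIV - insert i S) * card (H UNIV)"
    using CS closed \<sigma>iS by (intro card_H_chain) auto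
  moreover have "card (S - C) + (card (UNIV - insert i S) + 1) = 6 - card C"
  proof -
    have "card (UNIV - C) = 6 - card C" using card_Diff_subset[of C UNIV] card6 by simp
    moreover have "UNIV - C = (S - C) \<union> insert i (UNIV - insert i S)" using CS iS by auto
    moreover have "card \<dots> = card (S - C) + card (insert i (UNIV - insert i S))"
      using iS by (intro card_Un_disjoint) auto
    ultimately show ?thesis by simp
  qed
  ultimately have "H S \<noteq> H (insert i S)"
  proof -
    assume a: "card K \<le> 2 ^ card (S - C) * card (H S)"
      "card (H (insert i S)) \<le> 2 ^ card (UNIV - insert i S) * card (H UNIV)"
      "card (S - C) + (card (UNIV - insert i S) + 1) = 6 - card C"
    show ?thesis
    proof
      assume "H S = H (insert i S)"
      then have "card K \<le> 2 ^ card (S - C) * 2 ^ card (UNIV - insert i S)"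
        using a(1,2) by (simp add: H_UNIV) (meson le_trans mult_le_mono2)
      moreover have "card K = 2 ^ card (S - C) * (2 ^ card (UNIV - insert i S) * 2)"
        unfolding card a(3)[symmetric] by (simp add: power_add)
      ultimately show False by simp
    qed
  qed
  moreover have "H (insert i S) \<subseteq> H S" by (auto simp: H_def)
  ultimately obtain g where g: "g \<in> H S" "g \<notin> H (insert i S)" by blast
  then have "g \<in> K" "\<tau> g i \<noteq> 1" "\<forall>x\<in>S. \<tau> g x = 1" unfolding H_def by auto
  moreover from this have "(\<tau> g i)\<^sup>2 = 1" using \<tau>_sq \<sigma>iS by blast
  ultimately show ?thesis unfolding S_def by (intro bexI[of _ g]) (auto simp: power2_eq_1_iff)
qed

text \<open>Here \<open>\<sigma>\<close> has a single periodic index \<open>r\<close>. The signs on branches separate all indices. If two indices \<open>i\<close>, \<open>k\<close> had the same image \<open>j\<close>,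
  smoothness would give a monomial in \<open>x\<^sub>i, x\<^sub>k\<close> and some \<open>x\<^sub>l\<close> other than \<open>x\<^sub>j\<close>; a square forces \<open>l = j\<close> by separation, and a
  mixed monomial forces \<open>l\<close> into both subtrees. So \<open>\<sigma>\<close> is injective away from \<open>r\<close>, which leaves at
  most one index outside its range.\<close>

theorem two_rank_order_32: assumes "card K = 32" shows "card E \<le> 2"
proof -
  have "(2::nat) ^ 5 \<le> 2 ^ (6 - card C)" using assms card_K_le by simp
  then have "5 \<le> 6 - card C" by (rule power_le_imp_le_exp[rotated]) simp
  moreover have "card C > 0" using C_nonempty by (simp add: card_gt_0_iff)
  ultimately have c1: "card C = 1" by linarith
  then obtain r where r: "C = {r}" by (auto simp: card_1_singleton_iff)
  have cK: "card K = 2 ^ (6 - card C)" using assms c1 by simp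
  have \<sigma>r: "\<sigma> r = r" using \<sigma>_C[of r] r by simp
  have branch: "\<exists>g\<in>K. \<tau> g i = -1 \<and> (\<forall>x. x \<notin> subtree i \<longrightarrow> \<tau> g x = 1)" if "i \<noteq> r" for i
    using branch_sign[OF cK] that r by simp
  have cyc: "x = r" if "x \<in> subtree y" "y \<in> subtree x" "x \<noteq> y" for x y
  proof -
    have "\<sigma> x \<in> subtree y" using subtree_step that(1,3) by blast
    then have "\<sigma> x \<in> subtree x" using that(2) subtree_trans by blast
    then show ?thesis using cycle_C r by blast
  qed
  have distinct: "\<exists>g\<in>K. \<tau> g l \<noteq> \<tau> g j" if "l \<noteq> j" for l j
  proof (cases "l = r \<or> j \<in> subtree l")
    case False
    then obtain g where "g \<in> K" "\<tau> g l = -1" "\<tau> g j = 1" using branch[of l] by blast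
    then show ?thesis by (intro bexI[of _ g]) auto
  next
    case True
    have jl: "j \<in> subtree l"
    proof (cases "l = r")
      case True
      have "(\<sigma> ^^ 6) j = r" using \<sigma>6_C[of j] r by blast
      then show ?thesis using True unfolding subtree_def by blast
    qed (use \<open>l = r \<or> j \<in> subtree l\<close> in blast)
    have "j \<noteq> r"
    proof
      assume "j = r"
      obtain n where "(\<sigma> ^^ n) j = l" using jl unfolding subtree_def by blast
      moreover have "(\<sigma> ^^ n) r = r" by (induction n) (auto simp: \<sigma>r)
      ultimately show False using \<open>j = r\<close> that by simp
    qed
    then have "l \<notin> subtree j" using cyc[OF jl] that by blast
    then obtain g where "g \<in> K" "\<tau> g j = -1" "\<tau> g l = 1" using branch[of j] \<open>j \<noteq> r\<close> by blast
    then show ?thesis by (intro bexI[of _ g]) auto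
  qed
  have no_conflict: False if ik: "\<sigma> i = j" "\<sigma> k = j" "i \<noteq> k" "i \<noteq> j" "k \<noteq> j" for i k j
  proof -
    have ir: "i \<noteq> r" "k \<noteq> r" using ik \<sigma>r by auto
    have "card {j} \<le> 2" "card {j} < card {i, k}" using ik by simp_all
    from nondeg[OF this] obtain a b l where abl: "a \<in> {i, k}" "b \<in> {i, k}" "l \<notin> {j}" "R a b l" by blast
    have k_i: "k \<notin> subtree i"
    proof
      assume "k \<in> subtree i"
      then have "\<sigma> k \<in> subtree i" using subtree_step ik(3) by blast
      then have "i \<in> C" using cycle_C ik by metis
      then show False using r ir by simp
    qed
    have i_k: "i \<notin> subtree k"
    proof
      assume "i \<in> subtree k"
      then have "\<sigma> i \<in> subtree k" using subtree_step ik(3) by blast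
      then have "k \<in> C" using cycle_C ik by metis
      then show False using r ir by simp
    qed
    show False
    proof (cases "a = b")
      case True
      have "\<tau> g l = \<tau> g j" if "g \<in> K" for g
      proof -
        have "\<tau> g a * \<tau> g a * \<tau> g l = \<tau> g a * \<tau> g a * \<tau> g (\<sigma> a)"
          using invariantD[OF invariant_\<tau>[OF that] abl(4)] invariantD[OF invariant_\<tau>[OF that] R_\<sigma>[of a]] True by simp
        moreover have "\<sigma> a = j" using abl(1) ik by auto
        ultimately show ?thesis using \<tau>_nonzero[OF K_carrier[OF that]] by simp
      qed
      then show False using distinct[of l j] abl(3) by blast
    next
      case False
      then have ab: "\<tau> g i * \<tau> g k * \<tau> g l = 1" if "g \<in> K" for g
        using invariantD[OF invariant_\<tau>[OF that] abl(4)] abl(1,2) by (auto simp: mult.commute)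
      obtain g where g: "g \<in> K" "\<tau> g i = -1" "\<forall>x. x \<notin> subtree i \<longrightarrow> \<tau> g x = 1" using branch[OF ir(1)] by blast
      obtain h where h: "h \<in> K" "\<tau> h k = -1" "\<forall>x. x \<notin> subtree k \<longrightarrow> \<tau> h x = 1" using branch[OF ir(2)] by blast
      have li: "l \<in> subtree i"
      proof (rule ccontr)
        assume "l \<notin> subtree i"
        then show False using ab[OF g(1)] g(2,3) k_i by simp
      qed
      have lk: "l \<in> subtree k"
      proof (rule ccontr)
        assume "l \<notin> subtree k"
        then show False using ab[OF h(1)] h(2,3) i_k by simp
      qed
      obtain n m where nm: "(\<sigma> ^^ n) l = i" "(\<sigma> ^^ m) l = k" using li lk unfolding subtree_def by blast
      show False
      proof (cases "n \<le> m")
        case True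
        have "(\<sigma> ^^ (m - n)) ((\<sigma> ^^ n) l) = (\<sigma> ^^ (m - n + n)) l" by (simp only: funpow_add o_apply)
        then have "i \<in> subtree k" using nm True unfolding subtree_def by auto
        then show False using i_k by simp
      next
        case False
        have "(\<sigma> ^^ (n - m)) ((\<sigma> ^^ m) l) = (\<sigma> ^^ (n - m + m)) l" by (simp only: funpow_add o_apply)
        then have "k \<in> subtree i" using nm False unfolding subtree_def by auto
        then show False using k_i by simp
      qed
    qed
  qed
  have "inj_on \<sigma> (UNIV - {r})"
  proof (rule inj_onI)
    fix i k assume ik: "i \<in> UNIV - {r}" "k \<in> UNIV - {r}" "\<sigma> i = \<sigma> k"
    have nf: "x \<noteq> \<sigma> x" if "x \<noteq> r" for x
    proof
      assume "x = \<sigma> x"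
      then have "x \<in> C" using cycle_C subtree_self by metis
      then show False using r that by simp
    qed
    show "i = k"
    proof (rule ccontr)
      assume "i \<noteq> k"
      have a: "i \<noteq> \<sigma> i" using nf[of i] ik(1) by blast
      have b: "k \<noteq> \<sigma> i" using nf[of k] ik(2) unfolding ik(3) by blast
      show False by (rule no_conflict[OF refl ik(3)[symmetric] \<open>i \<noteq> k\<close> a b])
    qed
  qed
  then have "card (\<sigma> ` (UNIV - {r})) = 5" using card6 by (simp add: card_image card_Diff_singleton)
  moreover have "card (\<sigma> ` (UNIV - {r})) \<le> card (range \<sigma>)" by (rule card_mono) auto
  moreover have "card N = 6 - card (range \<sigma>)" unfolding N_def using card_Diff_subset[of "range \<sigma>" UNIV] card6 by simp
  ultimately have "card N \<le> 1" by simp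
  have "card code \<le> 2 ^ card N" using card_mono[OF _ code_Pow] by (simp add: card_Pow)
  also have "\<dots> \<le> 2 ^ 1" using \<open>card N \<le> 1\<close> by (intro power_increasing) auto
  finally show ?thesis by (simp add: card_code)
qed

subsection \<open>Conflicts at a cycle\<close>

text \<open>As \<open>k\<close> and the cycle index \<open>p\<close> have the same image, \<open>w\<close> agrees at both. A monomial in \<open>x\<^sub>p\<close>, \<open>x\<^sub>k\<close> completed by another \<open>x\<^sub>l\<close> than
  \<open>x\<^bsub>\<sigma> k\<^esub>\<close> has \<open>w l = w (\<sigma> k)\<close>, which is incompatible with \<open>l \<in> C\<close> if \<open>w\<close> is injective there. So there is a
  second index off the cycles, and a monomial tying it to \<open>k\<close> and \<open>p\<close>.\<close>

lemma conflict_at_cycle: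
  assumes w: "invariant w" "inj_on w C" and N: "odd n" "\<And>i. w i ^ n = 1"
    and k: "k \<notin> C" "\<sigma> k \<in> C" and p: "p \<in> C" "\<sigma> p = \<sigma> k" "\<sigma> k \<noteq> p"
  shows "\<exists>x\<in>{p, k}. \<exists>y\<in>{p, k}. \<exists>l. l \<notin> C \<and> l \<noteq> k \<and> R x y l"
proof -
  have "(w k)\<^sup>2 * w (\<sigma> k) = (w p)\<^sup>2 * w (\<sigma> k)"
    using invariant_\<sigma>[OF w(1), of k] invariant_\<sigma>[OF w(1), of p] p(2) by simp
  then have "(w k)\<^sup>2 = (w p)\<^sup>2" using invariant_nonzero[OF w(1)] by simp
  then have wk: "w k = w p" by (rule odd_root_unique) (use N in auto)
  have "card {\<sigma> k} \<le> 2" "card {\<sigma> k} < card {p, k}" using p k by (auto simp: card_insert_if)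
  from nondeg[OF this] obtain x y l where xyl: "x \<in> {p, k}" "y \<in> {p, k}" "l \<notin> {\<sigma> k}" "R x y l" by blast
  have wxy: "w x = w p" "w y = w p" using xyl wk by auto
  have "w p * w p * w l = w p * w p * w (\<sigma> k)"
    using invariantD[OF w(1) xyl(4)] invariantD[OF w(1) R_\<sigma>[of p]] p(2) wxy by simp
  then have wl: "w l = w (\<sigma> k)" using invariant_nonzero[OF w(1)] by simp
  have "l \<notin> C" using inj_onD[OF w(2) wl] k(2) xyl(3) by blast
  moreover have "l \<noteq> k"
  proof
    assume "l = k"
    then have "w p = w (\<sigma> k)" using wl wk by simp
    then show False using inj_onD[OF w(2)] p k by blast
  qed
  ultimately show ?thesis using xyl by blast
qed

end

section \<open>The list of groups\<close>

definition fourfold_types :: "nat list set" where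
  "fourfold_types = {[3, 3, 3, 3, 3], [3, 3, 3, 3, 2], [3, 3, 3, 4], [3, 3, 3, 2, 2],
             [3, 3, 8], [3, 3, 2, 4], [3, 3, 2, 2, 2], [3, 16],
             [3, 2, 8], [3, 4, 4], [32],
             [3, 3, 9], [2, 3, 9], [4, 9],
             [3, 3, 5], [2, 3, 5], [3, 7], [3, 11]}"

text \<open>Passing to a sub-multiset of orders means passing to a subgroup.\<close>

definition fits :: "nat multiset \<Rightarrow> bool" where
  "fits M \<longleftrightarrow> (\<exists>ns\<in>fourfold_types. M \<subseteq># mset ns)"

lemma fitsI: "ns \<in> fourfold_types \<Longrightarrow> M \<subseteq># mset ns \<Longrightarrow> fits M"
  by (auto simp: fits_def)

definition two_powers :: "nat multiset \<Rightarrow> bool" where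
  "two_powers M \<longleftrightarrow> (\<forall>m\<in>#M. \<exists>e\<ge>1. m = 2 ^ e)"

lemma two_powers_add: "two_powers (add_mset m M) \<longleftrightarrow> (\<exists>e\<ge>1. m = 2 ^ e) \<and> two_powers M"
  by (auto simp: two_powers_def)

lemma two_power_cases:
  assumes "\<exists>e\<ge>1. m = 2 ^ e" shows "m = 2 \<or> m = 4 \<or> m = 8 \<or> m = 16 \<or> m = 32 \<or> (m::nat) \<ge> 64"
proof -
  obtain e where e: "e \<ge> 1" "m = 2 ^ e" using assms by blast
  show ?thesis
  proof (cases "e \<ge> 6")
    case True
    then have "(2::nat) ^ 6 \<le> 2 ^ e" by (intro power_increasing) auto
    then show ?thesis using e by simp
  next
    case False
    then have "e = 1 \<or> e = 2 \<or> e = 3 \<or> e = 4 \<or> e = 5" using e(1) by linarith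
    then show ?thesis using e(2) by auto
  qed
qed

lemma two_powers_pos: "two_powers M \<Longrightarrow> prod_mset M > 0"
  by (induction M) (auto simp: two_powers_add)

lemma two_powers_cons:
  assumes "two_powers M" "M = add_mset m N"
  shows "two_powers N" "m = 2 \<or> m = 4 \<or> m = 8 \<or> m = 16 \<or> m = 32 \<or> m \<ge> 64"
    "m \<le> prod_mset M" "prod_mset M = m * prod_mset N"
proof -
  show N: "two_powers N" using assms by (simp add: two_powers_add)
  show "m = 2 \<or> m = 4 \<or> m = 8 \<or> m = 16 \<or> m = 32 \<or> m \<ge> 64"
    using assms by (intro two_power_cases) (simp add: two_powers_add)
  show "prod_mset M = m * prod_mset N" using assms(2) by simp
  then show "m \<le> prod_mset M" using two_powers_pos[OF N] by simp
qed

lemma two_powers_1: assumes "two_powers M" "prod_mset M < 2" shows "M = {#}"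
proof (cases M)
  case (add m N)
  show ?thesis using two_powers_cons(2,3)[OF assms(1) add] assms(2) by linarith
qed

lemma two_powers_2: assumes "two_powers M" "prod_mset M < 4" shows "M = {#} \<or> M = {#2#}"
proof (cases M)
  case (add m N)
  note * = two_powers_cons[OF assms(1) add]
  have m: "m = 2" using *(2,3) assms(2) by linarith
  then have "prod_mset N < 2" using *(4) assms(2) by simp
  from two_powers_1[OF *(1) this] show ?thesis using add m by simp
qed simp

lemma two_powers_4:
  assumes "two_powers M" "prod_mset M < 8" shows "M = {#} \<or> M = {#2#} \<or> M = {#4#} \<or> M = {#2, 2#}"
proof (cases M)
  case (add m N)
  note * = two_powers_cons[OF assms(1) add]
  have "m = 2 \<or> m = 4" using *(2,3) assms(2) by linarith
  then show ?thesis
  proof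
    assume m: "m = 2"
    then have "prod_mset N < 4" using *(4) assms(2) by simp
    from two_powers_2[OF *(1) this] show ?thesis using add m by auto
  next
    assume m: "m = 4"
    then have "prod_mset N < 2" using *(4) assms(2) by simp
    from two_powers_1[OF *(1) this] show ?thesis using add m by auto
  qed
qed simp

lemma two_powers_8:
  assumes "two_powers M" "prod_mset M < 16"
  shows "M = {#} \<or> M = {#2#} \<or> M = {#4#} \<or> M = {#2, 2#} \<or> M = {#8#} \<or> M = {#2, 4#} \<or> M = {#2, 2, 2#}"
proof (cases M)
  case (add m N)
  note * = two_powers_cons[OF assms(1) add]
  have "m = 2 \<or> m = 4 \<or> m = 8" using *(2,3) assms(2) by linarith
  then show ?thesis
  proof (elim disjE)
    assume m: "m = 2"
    then have "prod_mset N < 8" using *(4) assms(2) by simp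
    from two_powers_4[OF *(1) this] show ?thesis using add m by auto
  next
    assume m: "m = 4"
    then have "prod_mset N < 4" using *(4) assms(2) by simp
    from two_powers_2[OF *(1) this] show ?thesis using add m by (auto simp: add_mset_commute)
  next
    assume m: "m = 8"
    then have "prod_mset N < 2" using *(4) assms(2) by simp
    from two_powers_1[OF *(1) this] show ?thesis using add m by auto
  qed
qed simp

lemma two_powers_32:
  assumes "two_powers M" "16 \<le> prod_mset M" "prod_mset M \<le> 32" "size M \<le> 2" "prod_mset M = 32 \<longrightarrow> size M \<le> 1"
  shows "M = {#16#} \<or> M = {#2, 8#} \<or> M = {#4, 4#} \<or> M = {#32#} \<and> prod_mset M = 32"
proof (cases M)
  case (add m N)
  note * = two_powers_cons[OF assms(1) add]
  show ?thesis
  proof (cases "prod_mset M = 32")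
    case True
    then have "N = {#}" using assms(5) add by simp
    then show ?thesis using add True by simp
  next
    case False
    have sN: "size N \<le> 1" using assms(4) add by simp
    have "m = 2 \<or> m = 4 \<or> m = 8 \<or> m = 16" using *(2,3) assms(3) False by linarith
    then show ?thesis
    proof (elim disjE)
      assume m: "m = 2"
      then have "prod_mset N < 16" "8 \<le> prod_mset N" using *(4) assms(2,3) False by simp_all
      from two_powers_8[OF *(1) this(1)] this(2) sN show ?thesis using add m by auto
    next
      assume m: "m = 4"
      then have "prod_mset N < 8" "4 \<le> prod_mset N" using *(4) assms(2,3) False by simp_all
      from two_powers_4[OF *(1) this(1)] this(2) sN show ?thesis using add m by auto
    next
      assume m: "m = 8"
      then have "prod_mset N < 4" "2 \<le> prod_mset N" using *(4) assms(2,3) False by simp_all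
      from two_powers_2[OF *(1) this(1)] this(2) show ?thesis using add m by (auto simp: add_mset_commute)
    next
      assume m: "m = 16"
      then have "prod_mset N < 2" using *(4) assms(2,3) False by simp
      from two_powers_1[OF *(1) this] show ?thesis using add m by auto
    qed
  qed
qed (use assms in simp)

lemma inj_on_powers:
  fixes \<zeta> :: complex
  assumes "\<zeta> \<noteq> 0" "\<And>j. 0 < j \<Longrightarrow> j < n \<Longrightarrow> \<zeta> ^ j \<noteq> 1" shows "inj_on (\<lambda>k. \<zeta> ^ k) {..<n}"
proof (rule linorder_inj_onI')
  fix a b assume ab: "a \<in> {..<n}" "b \<in> {..<n}" "a < b"
  show "\<zeta> ^ a \<noteq> \<zeta> ^ b"
  proof
    assume eq: "\<zeta> ^ a = \<zeta> ^ b"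
    have "\<zeta> ^ b = \<zeta> ^ a * \<zeta> ^ (b - a)" using ab(3) by (simp flip: power_add)
    then have "\<zeta> ^ (b - a) = 1" using eq assms(1) by simp
    moreover have "b - a < n" using ab by simp
    ultimately show False using assms(2)[of "b - a"] ab(3) by simp
  qed
qed

lemma replicate_mset_small:
  "replicate_mset 2 x = {#x, x#}" "replicate_mset 3 x = {#x, x, x#}"
  "replicate_mset 4 x = {#x, x, x, x#}" "replicate_mset 5 x = {#x, x, x, x, x#}"
  by (simp_all add: eval_nat_numeral)

context diagonal_action
begin

text \<open>A set of characters of odd order with joint kernel \<open>K\<close> can be completed by the cyclic factors of
  \<open>K\<close>. The remaining proofs supply such characters for each cycle shape.\<close>

lemma embeds_with_K:
  assumes char: "\<And>\<xi> n. (\<xi>, n) \<in># Cm \<Longrightarrow> character G \<xi>"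
    and pow: "\<And>\<xi> n g. (\<xi>, n) \<in># Cm \<Longrightarrow> g \<in> carrier G \<Longrightarrow> \<xi> g ^ n = 1"
    and triv: "\<And>\<xi> n g. (\<xi>, n) \<in># Cm \<Longrightarrow> g \<in> K \<Longrightarrow> \<xi> g = 1"
    and ker: "\<And>g. g \<in> carrier G \<Longrightarrow> (\<And>\<xi> n. (\<xi>, n) \<in># Cm \<Longrightarrow> \<xi> g = 1) \<Longrightarrow> g \<in> K"
    and odd: "\<And>n. n \<in># image_mset snd Cm \<Longrightarrow> odd n"
  obtains M where "embeds_in G (image_mset snd Cm + M)" "prod_mset M = card K" "two_powers M" "2 ^ size M \<le> card E"
proof -
  obtain M where M: "embeds_in (G\<lparr>carrier := K\<rparr>) M" "prod_mset M = card K" "two_powers M" "2 ^ size M \<le> card E"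
    using K_decomposition unfolding two_powers_def by blast
  define q where "q = prod_mset (image_mset snd Cm)"
  have "odd (prod_mset A)" if "\<And>n. n \<in># A \<Longrightarrow> odd n" for A :: "nat multiset"
    using that by (induction A) auto
  then have "odd q" using odd unfolding q_def by blast
  have "embeds_in G (image_mset snd Cm + M)"
  proof (rule embeds_in_split[where K = K and q = q])
    show "comm_group G" by (rule comm_group_axioms)
    show "embeds_in (G\<lparr>carrier := K\<rparr>) M" by (rule M(1))
    show "character G \<xi>" if "(\<xi>, n) \<in># Cm" for \<xi> n by (rule char[OF that])
    show "\<xi> g ^ n = 1" if "(\<xi>, n) \<in># Cm" "g \<in> carrier G" for \<xi> n g by (rule pow[OF that])
    show "K = {x \<in> carrier G. \<forall>\<xi> n. (\<xi>, n) \<in># Cm \<longrightarrow> \<xi> x = 1}"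
    proof (intro equalityI subsetI)
      fix g assume "g \<in> K"
      then show "g \<in> {x \<in> carrier G. \<forall>\<xi> n. (\<xi>, n) \<in># Cm \<longrightarrow> \<xi> x = 1}"
        by (intro mem_joint_kernel triv K_carrier)
    next
      fix g assume "g \<in> {x \<in> carrier G. \<forall>\<xi> n. (\<xi>, n) \<in># Cm \<longrightarrow> \<xi> x = 1}"
      then have g: "g \<in> carrier G" "\<forall>\<xi> n. (\<xi>, n) \<in># Cm \<longrightarrow> \<xi> g = 1" unfolding mem_Collect_eq by (rule conjunct1, rule conjunct2)
      show "g \<in> K"
      proof (rule ker[OF g(1)])
        show "\<xi> g = 1" if "(\<xi>, n) \<in># Cm" for \<xi> n using g(2) that by (elim allE impE)
      qed
    qed
    show "n dvd q" if "n \<in># image_mset snd Cm" for n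
      unfolding q_def by (rule dvd_prod_mset[OF that])
    show "coprime q m" if "m \<in># M" for m
    proof -
      obtain e where "m = 2 ^ e" using M(3) \<open>m \<in># M\<close> unfolding two_powers_def by blast
      then show ?thesis using \<open>odd q\<close> by (simp add: coprime_power_right_iff)
    qed
  qed
  then show ?thesis using that M by blast
qed

lemma cube_const:
  assumes g: "g \<in> carrier G" and "t g x ^ 3 = 1" "y \<in> orb x" shows "t g y = t g x"
proof -
  have "t g ((\<sigma> ^^ n) x) = t g x" for n
  proof (induction n)
    case (Suc n)
    have "(t g x)\<^sup>2 * t g (\<sigma> ((\<sigma> ^^ n) x)) = 1" using invariant_\<sigma>[OF invariant_t[OF g], of "(\<sigma> ^^ n) x"] Suc by simp
    moreover have "(t g x)\<^sup>2 * t g x = 1" using assms(2) by (simp add: power2_eq_square power3_eq_cube)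
    ultimately have "(t g x)\<^sup>2 * t g (\<sigma> ((\<sigma> ^^ n) x)) = (t g x)\<^sup>2 * t g x" by simp
    then show ?case using t_nonzero[OF g, of x] by simp
  qed simp
  then show ?thesis using assms(3) by (auto simp: orb_def)
qed

lemma orb_no_fix: assumes "x \<in> C" "per x > 1" "y \<in> orb x" shows "\<sigma> y \<noteq> y"
proof
  assume fix_y: "\<sigma> y = y"
  obtain m where m: "y = (\<sigma> ^^ m) x" using assms(3) by (auto simp: orb_def)
  have p: "m \<le> per x * m" using per(1)[OF assms(1)] by (cases "per x") auto
  have fy: "(\<sigma> ^^ n) y = y" for n by (induction n) (auto simp: fix_y)
  have "x = (\<sigma> ^^ (per x * m)) x" using \<sigma>_mod[OF assms(1), of "per x * m"] by simp
  also have "\<dots> = (\<sigma> ^^ (per x * m - m)) ((\<sigma> ^^ m) x)" using p by (metis funpow_add le_add_diff_inverse2 o_apply)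
  also have "\<dots> = y" using fy m by simp
  finally have "x = y" .
  then show False using per_least[of 1 x] assms(2) fix_y by simp
qed

lemma orb_period: "x \<in> C \<Longrightarrow> y \<in> orb x \<Longrightarrow> (\<sigma> ^^ per x) y = y"
proof -
  assume x: "x \<in> C" "y \<in> orb x"
  then obtain m where m: "y = (\<sigma> ^^ m) x" by (auto simp: orb_def)
  have "(\<sigma> ^^ per x) ((\<sigma> ^^ m) x) = (\<sigma> ^^ m) ((\<sigma> ^^ per x) x)"
    by (metis add.commute funpow_add o_apply)
  then show ?thesis using m per(2)[OF x(1)] by simp
qed

text \<open>The entries along the cycle are the powers of \<open>\<zeta>\<close> with exponents \<open>(-2) ^ m\<close>, listed in \<open>e\<close> modulo \<open>n\<close>.\<close>

lemma inj_on_orb: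
  assumes w: "invariant w" "x \<in> C" "w x = \<zeta>" and pw: "\<And>j. 0 < j \<Longrightarrow> j < n \<Longrightarrow> \<zeta> ^ j \<noteq> 1" "\<zeta> ^ n = 1"
    and pn: "(per x, n) \<in> {(3, 9), (4, 5), (5, 11)}"
  shows "inj_on w (orb x) \<and> (\<forall>y\<in>orb x. w y \<noteq> 1)"
proof -
  define e where "e = (if n = 9 then [1, 7, 4] else if n = 5 then [1, 3, 4, 2] else [1, 9, 4, 3, 5 :: nat])"
  have nz: "\<zeta> \<noteq> 0" using pw(2) pn by auto
  note s = invariant_\<sigma>[OF w(1)]
  have val: "w (\<sigma> y) = \<zeta> ^ b" if "w y = \<zeta> ^ a" "2 * a + b = n * q" for y a b q
  proof -
    have "(\<zeta> ^ a)\<^sup>2 * \<zeta> ^ b = 1"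
      using that(2) pw(2) by (simp flip: power_mult power_add add: mult.commute[of a]) (simp add: power_mult)
    moreover have "(\<zeta> ^ a)\<^sup>2 * w (\<sigma> y) = 1" using s[of y] that(1) by simp
    ultimately have "(\<zeta> ^ a)\<^sup>2 * w (\<sigma> y) = (\<zeta> ^ a)\<^sup>2 * \<zeta> ^ b" by simp
    then show ?thesis using nz by simp
  qed
  have v0: "w x = \<zeta> ^ 1" using w(3) by simp
  have e: "w ((\<sigma> ^^ m) x) = \<zeta> ^ (e ! m)" if "m < per x" for m
  proof -
    consider "per x = 3" "n = 9" | "per x = 4" "n = 5" | "per x = 5" "n = 11" using pn by auto
    then show ?thesis
    proof cases
      case 1
      have v1: "w (\<sigma> x) = \<zeta> ^ 7" by (rule val[OF v0, of _ 1]) (simp add: 1)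
      have v2: "w (\<sigma> (\<sigma> x)) = \<zeta> ^ 4" by (rule val[OF v1, of _ 2]) (simp add: 1)
      have "m = 0 \<or> m = 1 \<or> m = 2" using that 1 by auto
      then show ?thesis using v0 v1 v2 1 by (auto simp: e_def numeral_2_eq_2)
    next
      case 2
      have v1: "w (\<sigma> x) = \<zeta> ^ 3" by (rule val[OF v0, of _ 1]) (simp add: 2)
      have v2: "w (\<sigma> (\<sigma> x)) = \<zeta> ^ 4" by (rule val[OF v1, of _ 2]) (simp add: 2)
      have v3: "w (\<sigma> (\<sigma> (\<sigma> x))) = \<zeta> ^ 2" by (rule val[OF v2, of _ 2]) (simp add: 2)
      have "m = 0 \<or> m = 1 \<or> m = 2 \<or> m = 3" using that 2 by auto
      then show ?thesis using v0 v1 v2 v3 2 by (auto simp: e_def numeral_2_eq_2 numeral_3_eq_3)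
    next
      case 3
      have v1: "w (\<sigma> x) = \<zeta> ^ 9" by (rule val[OF v0, of _ 1]) (simp add: 3)
      have v2: "w (\<sigma> (\<sigma> x)) = \<zeta> ^ 4" by (rule val[OF v1, of _ 2]) (simp add: 3)
      have v3: "w (\<sigma> (\<sigma> (\<sigma> x))) = \<zeta> ^ 3" by (rule val[OF v2, of _ 1]) (simp add: 3)
      have v4: "w (\<sigma> (\<sigma> (\<sigma> (\<sigma> x)))) = \<zeta> ^ 5" by (rule val[OF v3, of _ 1]) (simp add: 3)
      have "m = 0 \<or> m = 1 \<or> m = 2 \<or> m = 3 \<or> m = 4" using that 3 by auto
      then show ?thesis using v0 v1 v2 v3 v4 3 by (auto simp: e_def eval_nat_numeral)
    qed
  qed
  have en: "length e = per x" "distinct e" "\<forall>k\<in>set e. 0 < k \<and> k < n" using pn by (auto simp: e_def)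
  have "inj_on (\<lambda>m. \<zeta> ^ (e ! m)) {..<per x}"
  proof (rule inj_onI)
    fix a b assume ab: "a \<in> {..<per x}" "b \<in> {..<per x}" "\<zeta> ^ (e ! a) = \<zeta> ^ (e ! b)"
    have "e ! a < n" "e ! b < n" using ab en by (auto simp: all_set_conv_all_nth)
    then have "e ! a = e ! b" using inj_onD[OF inj_on_powers[OF nz pw(1)] ab(3)] by simp
    then show "a = b" using ab en by (simp add: nth_eq_iff_index_eq)
  qed
  then have "inj_on (w \<circ> (\<lambda>m. (\<sigma> ^^ m) x)) {..<per x}" using e by (simp add: inj_on_def)
  then have "inj_on w (orb x)" unfolding orb_def by (rule inj_on_imageI)
  moreover have "w y \<noteq> 1" if "y \<in> orb x" for y
  proof -
    obtain m where m: "m < per x" "y = (\<sigma> ^^ m) x" using \<open>y \<in> orb x\<close> by (auto simp: orb_def)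
    then have "0 < e ! m \<and> e ! m < n" using en by (simp add: all_set_conv_all_nth)
    then show ?thesis using pw(1)[of "e ! m"] e[OF m(1)] m(2) by simp
  qed
  ultimately show ?thesis by blast
qed

lemma cycle_successor_outside:
  assumes "C \<noteq> UNIV" shows "\<exists>k. k \<notin> C \<and> \<sigma> k \<in> C"
  using closed_step[of C UNIV] assms by auto

lemma per_le_2_cube:
  assumes "y \<in> C" "per y \<le> 2" "g \<in> carrier G" shows "t g y ^ 3 = 1"
proof -
  have "per y = 1 \<or> per y = 2" using per(1)[OF assms(1)] assms(2) by linarith
  then show ?thesis using invariant_period(1,2)[OF invariant_t[OF assms(3)] per(2)[OF assms(1)]] by blast
qed

lemma card_K_1: assumes "C = UNIV" "prod_mset M = card K" "two_powers M" shows "M = {#}"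
  using card_K_le assms card6 two_powers_1[of M] by simp

subsection \<open>Cycles with eigenvalues of order three\<close>

text \<open>The ratios of the entries on \<open>C\<close> are characters of order three with joint kernel \<open>K\<close>; there is one of them less
  than \<open>C\<close> has elements.\<close>

lemma embeds_if_cubes:
  assumes cubes: "\<And>x g. x \<in> C \<Longrightarrow> g \<in> carrier G \<Longrightarrow> t g x ^ 3 = 1"
  shows "\<exists>M. fits M \<and> embeds_in G M"
proof -
  define Cm where "Cm = image_mset (\<lambda>x. ((\<lambda>g. t g x / t g x0), 3::nat)) (mset_set (C - {x0}))"
  have mem: "\<exists>x\<in>C. \<xi> = (\<lambda>g. t g x / t g x0) \<and> n = 3" if "(\<xi>, n) \<in># Cm" for \<xi> n
    using that by (auto simp: Cm_def)
  obtain M where M: "embeds_in G (image_mset snd Cm + M)" "prod_mset M = card K" "two_powers M" "2 ^ size M \<le> card E"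
  proof (rule embeds_with_K[of Cm])
    fix \<xi> n assume "(\<xi>, n) \<in># Cm"
    from mem[OF this] show "character G \<xi>" using character_ratio by blast
  next
    fix \<xi> n g assume "(\<xi>, n) \<in># Cm" "g \<in> carrier G"
    from mem[OF this(1)] obtain x where "x \<in> C" "\<xi> = (\<lambda>g. t g x / t g x0)" "n = 3" by blast
    then show "\<xi> g ^ n = 1" using cubes[of _ g] x0 \<open>g \<in> carrier G\<close> by (simp add: power_divide)
  next
    fix \<xi> n g assume "(\<xi>, n) \<in># Cm" "g \<in> K"
    from mem[OF this(1)] obtain x where "x \<in> C" "\<xi> = (\<lambda>g. t g x / t g x0)" "n = 3" by blast
    then show "\<xi> g = 1" using \<open>g \<in> K\<close> t_nonzero by (simp add: K_iff)
  next
    fix g assume g: "g \<in> carrier G" and *: "\<And>\<xi> n. (\<xi>, n) \<in># Cm \<Longrightarrow> \<xi> g = 1"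
    have "t g x = t g x0" if "x \<in> C" for x
    proof (cases "x = x0")
      case False
      then have "((\<lambda>g. t g x / t g x0), 3) \<in># Cm" using that by (simp add: Cm_def)
      from *[OF this] show ?thesis using t_nonzero[OF g] by simp
    qed simp
    then show "g \<in> K" using g by (simp add: K_iff)
  qed (auto simp: Cm_def)
  define n where "n = card C"
  have Cm: "image_mset snd Cm = replicate_mset (n - 1) 3"
    using x0 by (simp add: Cm_def multiset.map_comp o_def image_mset_const_eq n_def)
  have le: "prod_mset M \<le> 2 ^ (6 - n)" using card_K_le M(2) by (simp add: n_def)
  have size: "size M \<le> 2" if "prod_mset M \<ge> 16"
  proof -
    have "(2::nat) ^ size M < 2 ^ 3" using M(2,4) two_rank_bound that by simp
    then have "size M < 3" by (rule power_less_imp_less_exp[rotated]) simp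
    then show ?thesis by simp
  qed
  have size32: "size M \<le> 1" if "prod_mset M = 32"
  proof -
    have "(2::nat) ^ size M \<le> 2 ^ 1" using M(2,4) two_rank_order_32 that by simp
    then show ?thesis by (rule power_le_imp_le_exp[rotated]) simp
  qed
  have "n > 0" using C_nonempty by (simp add: n_def card_gt_0_iff)
  then consider "n = 1" | "n = 2" | "n = 3" | "n = 4" | "n = 5" | "n = 6"
    using card_C_le unfolding n_def by linarith
  then have "fits (image_mset snd Cm + M)"
  proof cases
    case 1
    show ?thesis
    proof (cases "prod_mset M < 16")
      case True
      from two_powers_8[OF M(3) this] show ?thesis unfolding Cm 1
        by (elim disjE) (auto intro: fitsI[of "[3, 3, 8]"] fitsI[of "[3, 3, 2, 4]"] fitsI[of "[3, 3, 2, 2, 2]"]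
          simp: fourfold_types_def insert_subset_eq_iff)
    next
      case False
      then have "M = {#16#} \<or> M = {#2, 8#} \<or> M = {#4, 4#} \<or> M = {#32#} \<and> prod_mset M = 32"
        using le size size32 1 by (intro two_powers_32 M(3)) auto
      then show ?thesis unfolding Cm 1
        by (elim disjE) (auto intro: fitsI[of "[3, 16]"] fitsI[of "[3, 2, 8]"] fitsI[of "[3, 4, 4]"] fitsI[of "[32]"]
          simp: fourfold_types_def insert_subset_eq_iff)
    qed
  next
    case 2
    show ?thesis
    proof (cases "prod_mset M < 16")
      case True
      from two_powers_8[OF M(3) this] show ?thesis unfolding Cm 2
        by (elim disjE) (auto intro: fitsI[of "[3, 3, 8]"] fitsI[of "[3, 3, 2, 4]"] fitsI[of "[3, 3, 2, 2, 2]"]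
          simp: fourfold_types_def insert_subset_eq_iff)
    next
      case False
      then have "M = {#16#} \<or> M = {#2, 8#} \<or> M = {#4, 4#} \<or> M = {#32#} \<and> prod_mset M = 32"
        using le size size32 2 by (intro two_powers_32 M(3)) auto
      moreover have "prod_mset M \<noteq> 32" using le 2 by simp
      ultimately show ?thesis unfolding Cm 2
        by (elim disjE) (auto intro: fitsI[of "[3, 16]"] fitsI[of "[3, 2, 8]"] fitsI[of "[3, 4, 4]"]
          simp: fourfold_types_def insert_subset_eq_iff)
    qed
  next
    case 3
    then have "prod_mset M < 16" using le by simp
    from two_powers_8[OF M(3) this] show ?thesis unfolding Cm 3
      by (elim disjE) (auto intro: fitsI[of "[3, 3, 8]"] fitsI[of "[3, 3, 2, 4]"] fitsI[of "[3, 3, 2, 2, 2]"]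
        simp: fourfold_types_def insert_subset_eq_iff replicate_mset_small)
  next
    case 4
    then have "prod_mset M < 8" using le by simp
    from two_powers_4[OF M(3) this] show ?thesis unfolding Cm 4
      by (elim disjE) (auto intro: fitsI[of "[3, 3, 3, 4]"] fitsI[of "[3, 3, 3, 2, 2]"]
        simp: fourfold_types_def insert_subset_eq_iff replicate_mset_small)
  next
    case 5
    then have "prod_mset M < 4" using le by simp
    from two_powers_2[OF M(3) this] show ?thesis unfolding Cm 5
      by (elim disjE) (auto intro: fitsI[of "[3, 3, 3, 3, 2]"]
        simp: fourfold_types_def insert_subset_eq_iff replicate_mset_small)
  next
    case 6
    then have "prod_mset M < 2" using le by simp
    from two_powers_1[OF M(3) this] show ?thesis unfolding Cm 6
      by (auto intro: fitsI[of "[3, 3, 3, 3, 3]"]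
        simp: fourfold_types_def insert_subset_eq_iff replicate_mset_small)
  qed
  then show ?thesis using M(1) by blast
qed

subsection \<open>Cycles with eigenvalues of higher order\<close>

lemma K_if_const: assumes "g \<in> carrier G" "\<And>y. y \<in> C \<Longrightarrow> t g y = a" shows "g \<in> K"
  unfolding K_iff using assms x0 by simp

lemma K_const: assumes "g \<in> K" "y \<in> C" "z \<in> C" shows "t g y = t g z"
  using assms unfolding K_iff by metis

lemma character_t3: "character G (\<lambda>g. t g a ^ 3)" using character_cube[of a 1] by simp

lemma character_t9: "character G (\<lambda>g. t g a ^ 9)" using character_cube[of a 3] by simp

lemma character_t21: "character G (\<lambda>g. t g a ^ 21)" using character_cube[of a 7] by simp

lemma root_order:
  fixes z :: complex
  assumes "z ^ a = 1" "z ^ b = 1" "gcd a b = 1" shows "z = 1"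
  using power_eq_1_gcd[OF assms(1,2)] assms(3) by simp

text \<open>All indices lie on one cycle, so \<open>K\<close> is trivial and the eigenvalue, of order dividing 63, splits into a
  part of order 7 and a part of order 3.\<close>

lemma per_6:
  assumes x: "x \<in> C" "per x = 6" shows "\<exists>M. fits M \<and> embeds_in G M"
proof -
  have orb: "orb x = UNIV" using card_orb[OF x(1)] x(2) card6 by (intro card_subset_eq) auto
  then have CU: "C = UNIV" using orb_C[OF x(1)] by auto
  have t63: "t g x ^ 63 = 1" if "g \<in> carrier G" for g
    using invariant_period(6)[OF invariant_t[OF that] per(2)[OF x(1)]] x(2) by simp
  define Cm where "Cm = {#((\<lambda>g. t g x ^ 9), 7::nat), ((\<lambda>g. t g x ^ 21), 3)#}"
  obtain M where M: "embeds_in G (image_mset snd Cm + M)" "prod_mset M = card K" "two_powers M"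
  proof (rule embeds_with_K[of Cm])
    fix \<xi> n assume "(\<xi>, n) \<in># Cm"
    then show "character G \<xi>" unfolding Cm_def using character_t9 character_t21 by auto
  next
    fix \<xi> n g assume "(\<xi>, n) \<in># Cm" "g \<in> carrier G"
    then show "\<xi> g ^ n = 1" unfolding Cm_def using t63[of g] by (auto simp flip: power_mult)
  next
    fix \<xi> n g assume *: "(\<xi>, n) \<in># Cm" "g \<in> K"
    have "(t g x ^ 3) ^ 3 = 1" "(t g x ^ 3) ^ 7 = 1" using K_cube[OF *(2) x(1)] by simp_all
    then show "\<xi> g = 1" using *(1) unfolding Cm_def by (auto simp flip: power_mult)
  next
    fix g assume g: "g \<in> carrier G" and *: "\<And>\<xi> n. (\<xi>, n) \<in># Cm \<Longrightarrow> \<xi> g = 1"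
    have "t g x ^ 9 = 1" using *[of "\<lambda>g. t g x ^ 9" 7] by (simp add: Cm_def)
    moreover have "t g x ^ 21 = 1" using *[of "\<lambda>g. t g x ^ 21" 3] by (simp add: Cm_def)
    ultimately have "t g x ^ gcd 9 21 = 1" by (rule power_eq_1_gcd)
    moreover have "gcd 9 (21::nat) = 3" by (simp add: gcd_non_0_nat)
    ultimately have t3: "t g x ^ 3 = 1" by simp
    show "g \<in> K" by (rule K_if_const[OF g cube_const[OF g t3]]) (simp add: orb)
  qed (auto simp: Cm_def)
  have "M = {#}" by (rule card_K_1[OF CU M(2,3)])
  then have "fits (image_mset snd Cm + M)"
    by (auto simp: Cm_def fourfold_types_def insert_subset_eq_iff intro: fitsI[of "[3, 7]"])
  then show ?thesis using M(1) by blast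
qed

lemma conflict_outside_orbit:
  assumes w: "invariant w" "inj_on w C" and N: "odd n" "\<And>i. w i ^ n = 1"
    and x: "x \<in> C" "per x > 1" and k: "k \<notin> C" "\<sigma> k \<in> orb x"
  shows "\<exists>p\<in>C. \<exists>a\<in>{p, k}. \<exists>b\<in>{p, k}. \<exists>l. l \<notin> C \<and> l \<noteq> k \<and> R a b l"
proof -
  have \<sigma>k: "\<sigma> k \<in> C" using k orb_C x by blast
  obtain p where p: "p \<in> C" "\<sigma> p = \<sigma> k" using pred_C[OF \<sigma>k] by blast
  have "\<sigma> k \<noteq> p" using orb_no_fix[OF x k(2)] p(2) by auto
  then show ?thesis using conflict_at_cycle[OF w N k(1) \<sigma>k p] p(1) by blast
qed

text \<open>After removal of its 3-part, an eigenvalue of order divisible by 11 takes distinct values along the cycle. If the sixth index were not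
  periodic, it would meet a conflict at the cycle without having a second index
  available. So it is fixed by \<open>\<sigma>\<close>.\<close>

lemma per_5:
  assumes x: "x \<in> C" "per x = 5" and u: "u \<in> carrier G" "t u x ^ 3 \<noteq> 1"
  shows "\<exists>M. fits M \<and> embeds_in G M"
proof -
  have card_rest: "card (C - orb x) = card C - 5"
    using card_Diff_subset[of "orb x" C] orb_C[OF x(1)] card_orb[OF x(1)] x(2) by simp
  have t33: "t g y ^ 33 = 1" if "g \<in> carrier G" "y \<in> orb x" for g y
    using invariant_period(5)[OF invariant_t[OF that(1)] orb_period[OF x(1) that(2)]] x(2) by simp
  have "C \<noteq> orb x"
  proof
    assume Co: "C = orb x"
    then have "card C = 5" using card_orb x by simp
    then have c1: "card (UNIV - C) = 1" using card_Diff_subset[of C UNIV] card6 by simp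
    then have "C \<noteq> UNIV" by auto
    then obtain k where k: "k \<notin> C" "\<sigma> k \<in> C" using cycle_successor_outside by blast
    \<comment> \<open>The 64-th power is the value six steps further along \<open>\<sigma>\<close>, on a cycle; the cube removes the 3-part.\<close>
    define w where "w i = t u i ^ 192" for i
    have w: "invariant w" unfolding w_def by (rule invariant_power[OF invariant_t[OF u(1)]])
    have w_eq: "w i = t u ((\<sigma> ^^ 6) i) ^ 3" for i
      unfolding w_def invariant_\<sigma>6[OF invariant_t[OF u(1)]] by (simp flip: power_mult)
    have w11: "w i ^ 11 = 1" for i
      using t33[OF u(1), of "(\<sigma> ^^ 6) i"] \<sigma>6_C[of i] Co by (simp add: w_eq flip: power_mult)
    have "w x \<noteq> 1"
    proof
      assume "w x = 1"
      then have "t u x ^ 192 = 1" by (simp add: w_def)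
      then have "t u x ^ gcd 192 33 = 1" using t33[OF u(1) x_orb[OF x(1)]] by (rule power_eq_1_gcd)
      moreover have "gcd 192 (33::nat) = 3" by (simp add: gcd_non_0_nat)
      ultimately show False using u(2) by simp
    qed
    then have wj: "w x ^ j \<noteq> 1" if "0 < j" "j < 11" for j
    proof -
      have "prime (11::nat)" by simp
      then have "coprime j 11" using that by (metis coprime_commute prime_imp_coprime nat_dvd_not_less)
      then show ?thesis using root_order[of "w x" j 11] w11 \<open>w x \<noteq> 1\<close> by auto
    qed
    have "inj_on w (orb x)" using inj_on_orb[OF w x(1) refl wj w11] x(2) by simp
    then have "inj_on w C" using Co by simp
    then obtain p a b l where l: "l \<notin> C" "l \<noteq> k"
      using conflict_outside_orbit[OF w _ _ w11 x(1) _ k(1)] k(2) Co x(2) by auto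
    then have "{k, l} \<subseteq> UNIV - C" "card {k, l} = 2" using k by auto
    then show False using c1 card_mono[of "UNIV - C" "{k, l}"] by simp
  qed
  then obtain s where s: "s \<in> C - orb x" using orb_C[OF x(1)] by blast
  have "card (C - orb x) \<le> 1" using card_rest card_C_le by simp
  then have Cs: "C - orb x = {s}" using s by (metis card_le_Suc0_iff_eq One_nat_def finite singletonD insertI1 is_singletonI' is_singleton_the_elem empty_iff)
  have "card C = 6" using card_rest Cs by simp
  then have CU: "C = UNIV" using card6 by (intro card_subset_eq) auto
  have "orb s \<subseteq> {s}" using orb_disjoint[OF x(1) s] Cs by simp
  then have "card (orb s) \<le> 1" using card_mono[of "{s}"] by simp
  then have ts: "t g s ^ 3 = 1" if "g \<in> carrier G" for g
    using per_le_2_cube[OF _ _ that, of s] s card_orb[of s] by simp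
  have r33: "(t g x / t g s) ^ 33 = 1" if "g \<in> carrier G" for g
  proof -
    have "t g s ^ (3 * 11) = 1" using ts[OF that] by (simp only: power_mult) simp
    then show ?thesis using t33[OF that x_orb[OF x(1)]] by (simp add: power_divide)
  qed
  define Cm where "Cm = {#((\<lambda>g. t g x ^ 3), 11::nat), ((\<lambda>g. (t g x / t g s) ^ 11), 3)#}"
  obtain M where M: "embeds_in G (image_mset snd Cm + M)" "prod_mset M = card K" "two_powers M"
  proof (rule embeds_with_K[of Cm])
    fix \<xi> n assume "(\<xi>, n) \<in># Cm"
    then show "character G \<xi>" unfolding Cm_def using character_t3 character_power[OF character_ratio] by auto
  next
    fix \<xi> n g assume "(\<xi>, n) \<in># Cm" "g \<in> carrier G"
    then show "\<xi> g ^ n = 1" unfolding Cm_def using t33[of g x] x_orb[OF x(1)] r33[of g] by (auto simp flip: power_mult)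
  next
    fix \<xi> n g assume *: "(\<xi>, n) \<in># Cm" "g \<in> K"
    have "t g x ^ 3 = 1" using K_cube[OF *(2) x(1)] .
    moreover have "t g x / t g s = 1" using K_const[OF *(2) x(1), of s] s t_nonzero[OF K_carrier[OF *(2)]] by simp
    ultimately show "\<xi> g = 1" using *(1) unfolding Cm_def by auto
  next
    fix g assume g: "g \<in> carrier G" and *: "\<And>\<xi> n. (\<xi>, n) \<in># Cm \<Longrightarrow> \<xi> g = 1"
    have t3: "t g x ^ 3 = 1" using *[of "\<lambda>g. t g x ^ 3" 11] by (simp add: Cm_def)
    have "(t g x / t g s) ^ 11 = 1" using *[of "\<lambda>g. (t g x / t g s) ^ 11" 3] by (simp add: Cm_def)
    moreover have "(t g x / t g s) ^ 3 = 1" using t3 ts[OF g] by (simp add: power_divide)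
    moreover have "gcd 11 (3::nat) = 1" by (simp add: gcd_non_0_nat)
    ultimately have "t g x / t g s = 1" by (rule root_order)
    then have "t g s = t g x" using t_nonzero[OF g] by simp
    show "g \<in> K"
    proof (rule K_if_const[OF g])
      fix y assume "y \<in> C"
      then have "y \<in> orb x \<or> y = s" using Cs by auto
      then show "t g y = t g x" using cube_const[OF g t3, of y] \<open>t g s = t g x\<close> by (elim disjE) simp_all
    qed
  qed (auto simp: Cm_def)
  have "M = {#}" by (rule card_K_1[OF CU M(2,3)])
  then have "fits (image_mset snd Cm + M)"
    by (auto simp: Cm_def fourfold_types_def insert_subset_eq_iff intro: fitsI[of "[3, 11]"])
  then show ?thesis using M(1) by blast
qed

text \<open>The case where the cycle is all of \<open>C\<close> needs a conflict: it ties the two further indices together, so that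
  \<open>K\<close> has order at most 2 instead of 4.\<close>

lemma per_4:
  assumes x: "x \<in> C" "per x = 4" and u: "u \<in> carrier G" "t u x ^ 3 \<noteq> 1"
  shows "\<exists>M. fits M \<and> embeds_in G M"
proof -
  have card_rest: "card C = card (C - orb x) + 4"
    using card_Diff_subset[of "orb x" C] card_mono[OF _ orb_C[OF x(1)]] orb_C[OF x(1)] card_orb[OF x(1)] x(2) by simp
  have t15: "t g y ^ 15 = 1" if "g \<in> carrier G" "y \<in> orb x" for g y
    using invariant_period(4)[OF invariant_t[OF that(1)] orb_period[OF x(1) that(2)]] x(2) by simp
  have ts: "t g s ^ 3 = 1" if s: "s \<in> C - orb x" "g \<in> carrier G" for s g
  proof -
    have "card (orb s) \<le> card (C - orb x)" using orb_disjoint[OF x(1) s(1)] by (simp add: card_mono)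
    also have "\<dots> \<le> 2" using card_rest card_C_le by simp
    finally show ?thesis using per_le_2_cube[OF _ _ s(2), of s] s card_orb[of s] by simp
  qed
  show ?thesis
  proof (cases "C = orb x")
    case Co: True
    then have c4: "card C = 4" using card_orb x by simp
    then have c2: "card (UNIV - C) = 2" using card_Diff_subset[of C UNIV] card6 by simp
    then have "C \<noteq> UNIV" by auto
    then obtain k where k: "k \<notin> C" "\<sigma> k \<in> C" using cycle_successor_outside by blast
    define w where "w i = t u i ^ 192" for i
    have w: "invariant w" unfolding w_def by (rule invariant_power[OF invariant_t[OF u(1)]])
    have w_eq: "w i = t u ((\<sigma> ^^ 6) i) ^ 3" for i
      unfolding w_def invariant_\<sigma>6[OF invariant_t[OF u(1)]] by (simp flip: power_mult)
    have w5: "w i ^ 5 = 1" for i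
      using t15[OF u(1), of "(\<sigma> ^^ 6) i"] \<sigma>6_C[of i] Co by (simp add: w_eq flip: power_mult)
    have "w x \<noteq> 1"
    proof
      assume "w x = 1"
      then have "t u x ^ 192 = 1" by (simp add: w_def)
      then have "t u x ^ gcd 192 15 = 1" using t15[OF u(1) x_orb[OF x(1)]] by (rule power_eq_1_gcd)
      moreover have "gcd 192 (15::nat) = 3" by (simp add: gcd_non_0_nat)
      ultimately show False using u(2) by simp
    qed
    then have wj: "w x ^ j \<noteq> 1" if "0 < j" "j < 5" for j
    proof -
      have "prime (5::nat)" by simp
      then have "coprime j 5" using that by (metis coprime_commute prime_imp_coprime nat_dvd_not_less)
      then show ?thesis using root_order[of "w x" j 5] w5 \<open>w x \<noteq> 1\<close> by auto
    qed
    have "inj_on w (orb x)" using inj_on_orb[OF w x(1) refl wj w5] x(2) by simp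
    then have "inj_on w C" using Co by simp
    then obtain p a b l where l: "p \<in> C" "a \<in> {p, k}" "b \<in> {p, k}" "l \<notin> C" "l \<noteq> k" "R a b l"
      using conflict_outside_orbit[OF w _ _ w5 x(1) _ k(1)] k(2) Co x(2) by auto
    have "{k, l} \<subseteq> UNIV - C" "card {k, l} = 2" using k l by auto
    then have kl: "UNIV - C = {k, l}" using c2 card_subset_eq[of "UNIV - C" "{k, l}"] by auto
    have "H (insert k C) \<subseteq> H UNIV"
    proof
      fix g assume g: "g \<in> H (insert k C)"
      then have g1: "\<tau> g y = 1" if "y \<in> insert k C" for y using that by (auto simp: H_def)
      have gK: "g \<in> K" using g by (simp add: H_def)
      have "\<tau> g a * \<tau> g b * \<tau> g l = 1" using invariantD[OF invariant_\<tau>[OF gK] l(6)] .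
      moreover have "\<tau> g a = 1" "\<tau> g b = 1" using g1 l by auto
      ultimately have "\<tau> g l = 1" by simp
      have "\<tau> g y = 1" for y
      proof (cases "y \<in> C")
        case False
        then have "y \<in> {k, l}" using kl by blast
        then show ?thesis using g1 \<open>\<tau> g l = 1\<close> by auto
      qed (use g1 in simp)
      then show "g \<in> H UNIV" using gK by (simp add: H_def)
    qed
    then have "card (H (insert k C)) \<le> 1" using H_UNIV card_mono[of "H UNIV"] by fastforce
    then have K2: "card K \<le> 2" using card_H_step[OF k(2)] H_C by simp
    define Cm where "Cm = {#((\<lambda>g. t g x ^ 3), 5::nat)#}"
    obtain M where M: "embeds_in G (image_mset snd Cm + M)" "prod_mset M = card K" "two_powers M"
    proof (rule embeds_with_K[of Cm])
      fix \<xi> n assume "(\<xi>, n) \<in># Cm"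
      then show "character G \<xi>" unfolding Cm_def using character_t3 by auto
    next
      fix \<xi> n g assume "(\<xi>, n) \<in># Cm" "g \<in> carrier G"
      then show "\<xi> g ^ n = 1" unfolding Cm_def using t15[of g x] x_orb[OF x(1)] by (auto simp flip: power_mult)
    next
      fix \<xi> n g assume *: "(\<xi>, n) \<in># Cm" "g \<in> K"
      have "t g x ^ 3 = 1" using K_cube[OF *(2) x(1)] .
      then show "\<xi> g = 1" using *(1) unfolding Cm_def by auto
    next
      fix g assume g: "g \<in> carrier G" and *: "\<And>\<xi> n. (\<xi>, n) \<in># Cm \<Longrightarrow> \<xi> g = 1"
      have t3: "t g x ^ 3 = 1" using *[of "\<lambda>g. t g x ^ 3" 5] by (simp add: Cm_def)
      show "g \<in> K" by (rule K_if_const[OF g cube_const[OF g t3]]) (simp add: Co)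
    qed (auto simp: Cm_def)
    have "M = {#} \<or> M = {#2#}" by (rule two_powers_2[OF M(3)]) (use M(2) K2 in simp)
    then have "fits (image_mset snd Cm + M)"
      by (elim disjE) (auto simp: Cm_def fourfold_types_def insert_subset_eq_iff intro: fitsI[of "[2, 3, 5]"])
    then show ?thesis using M(1) by blast
  next
    case False
    then obtain s where s: "s \<in> C - orb x" using orb_C[OF x(1)] by blast
    have r15: "(t g x / t g s) ^ 15 = 1" if "g \<in> carrier G" for g
    proof -
      have "t g s ^ (3 * 5) = 1" using ts[OF s that] by (simp only: power_mult) simp
      then show ?thesis using t15[OF that x_orb[OF x(1)]] by (simp add: power_divide)
    qed
    define D where "D = image_mset (\<lambda>s'. ((\<lambda>g. t g s' / t g s), 3::nat)) (mset_set (C - orb x - {s}))"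
    have memD: "\<exists>s'. s' \<in> C - orb x \<and> \<xi> = (\<lambda>g. t g s' / t g s) \<and> n = 3" if "(\<xi>, n) \<in># D" for \<xi> n
      using that by (auto simp: D_def)
    define Cm where "Cm = add_mset ((\<lambda>g. t g x ^ 3), 5::nat) (add_mset ((\<lambda>g. (t g x / t g s) ^ 5), 3) D)"
    have mem: "\<xi> = (\<lambda>g. t g x ^ 3) \<and> n = 5 \<or> \<xi> = (\<lambda>g. (t g x / t g s) ^ 5) \<and> n = 3 \<or>
        (\<exists>s'. s' \<in> C - orb x \<and> \<xi> = (\<lambda>g. t g s' / t g s) \<and> n = 3)" if "(\<xi>, n) \<in># Cm" for \<xi> n
      using that memD[of \<xi> n] by (auto simp: Cm_def)
    obtain M where M: "embeds_in G (image_mset snd Cm + M)" "prod_mset M = card K" "two_powers M"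
    proof (rule embeds_with_K[of Cm])
      fix \<xi> n assume "(\<xi>, n) \<in># Cm"
      from mem[OF this] show "character G \<xi>"
        using character_t3 character_power[OF character_ratio] character_ratio by auto
    next
      fix \<xi> n g assume *: "(\<xi>, n) \<in># Cm" "g \<in> carrier G"
      from mem[OF *(1)] show "\<xi> g ^ n = 1"
        using t15[OF *(2) x_orb[OF x(1)]] r15[OF *(2)] ts[OF _ *(2)] s
        by (elim disjE exE) (auto simp: power_divide simp flip: power_mult)
    next
      fix \<xi> n g assume *: "(\<xi>, n) \<in># Cm" "g \<in> K"
      have "t g x ^ 3 = 1" using K_cube[OF *(2) x(1)] .
      moreover have "t g y / t g s = 1" if "y \<in> C" for y
        using K_const[OF *(2) that, of s] s t_nonzero[OF K_carrier[OF *(2)]] by simp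
      ultimately show "\<xi> g = 1" using mem[OF *(1)] x(1) by (elim disjE exE) auto
    next
      fix g assume g: "g \<in> carrier G" and *: "\<And>\<xi> n. (\<xi>, n) \<in># Cm \<Longrightarrow> \<xi> g = 1"
      have t3: "t g x ^ 3 = 1" using *[of "\<lambda>g. t g x ^ 3" 5] by (simp add: Cm_def)
      have "(t g x / t g s) ^ 5 = 1" using *[of "\<lambda>g. (t g x / t g s) ^ 5" 3] by (simp add: Cm_def)
      moreover have "(t g x / t g s) ^ 3 = 1" using t3 ts[OF s g] by (simp add: power_divide)
      moreover have "gcd 5 (3::nat) = 1" by (simp add: gcd_non_0_nat)
      ultimately have "t g x / t g s = 1" by (rule root_order)
      then have sx: "t g s = t g x" using t_nonzero[OF g] by simp
      show "g \<in> K"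
      proof (rule K_if_const[OF g])
        fix y assume y: "y \<in> C"
        show "t g y = t g x"
        proof (cases "y \<in> orb x \<or> y = s")
          case False
          then have "((\<lambda>g. t g y / t g s), 3) \<in># Cm" using y by (simp add: Cm_def D_def)
          from *[OF this] show ?thesis using sx t_nonzero[OF g] by simp
        next
          case True
          then show ?thesis using cube_const[OF g t3, of y] sx by (elim disjE) simp_all
        qed
      qed
    qed (auto simp: Cm_def D_def)
    define r where "r = card (C - orb x - {s})"
    have r: "card C = r + 5" using card_rest card.remove[OF finite s] unfolding r_def by simp
    have Cm: "image_mset snd Cm = add_mset 5 (add_mset 3 (replicate_mset r 3))"
      by (simp add: Cm_def D_def multiset.map_comp o_def image_mset_const_eq r_def)
    consider "r = 0" | "r = 1" using r card_C_le by linarith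
    then have "fits (image_mset snd Cm + M)"
    proof cases
      case 1
      have "M = {#} \<or> M = {#2#}" by (rule two_powers_2[OF M(3)]) (use M(2) card_K_le r 1 in simp)
      then show ?thesis unfolding Cm 1
        by (elim disjE) (auto simp: fourfold_types_def insert_subset_eq_iff intro: fitsI[of "[2, 3, 5]"])
    next
      case 2
      have "M = {#}" by (rule two_powers_1[OF M(3)]) (use M(2) card_K_le r 2 in simp)
      then show ?thesis unfolding Cm 2
        by (auto simp: fourfold_types_def insert_subset_eq_iff intro: fitsI[of "[3, 3, 5]"])
    qed
    then show ?thesis using M(1) by blast
  qed
qed

text \<open>If \<open>C\<close> is the cycle, the order of \<open>K\<close> suffices. If two cycles of length three occur with eigenvalues of order nine, \<open>K\<close> is trivial.
  Otherwise the other periodic indices have eigenvalues of order three, and what has to be excluded is a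
  Klein four-group as \<open>K\<close> in the presence of an element of order nine.\<close>

lemma per_3:
  assumes x: "x \<in> C" "per x = 3" and u: "u \<in> carrier G" "t u x ^ 3 \<noteq> 1"
  shows "\<exists>M. fits M \<and> embeds_in G M"
proof -
  have card_rest: "card C = card (C - orb x) + 3"
    using card_Diff_subset[of "orb x" C] card_mono[OF _ orb_C[OF x(1)]] orb_C[OF x(1)] card_orb[OF x(1)] x(2) by simp
  have t9: "t g y ^ 9 = 1" if "g \<in> carrier G" "y \<in> orb x" for g y
    using invariant_period(3)[OF invariant_t[OF that(1)] orb_period[OF x(1) that(2)]] x(2) by simp
  consider "C = orb x" | y h where "y \<in> C - orb x" "h \<in> carrier G" "t h y ^ 3 \<noteq> 1"
    | "C \<noteq> orb x" "\<And>y h. y \<in> C - orb x \<Longrightarrow> h \<in> carrier G \<Longrightarrow> t h y ^ 3 = 1" by blast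
  then show ?thesis
  proof cases
    case Co: 1
    define Cm where "Cm = {#((\<lambda>g. t g x ^ 3), 3::nat)#}"
    obtain M where M: "embeds_in G (image_mset snd Cm + M)" "prod_mset M = card K" "two_powers M"
    proof (rule embeds_with_K[of Cm])
      fix \<xi> n assume "(\<xi>, n) \<in># Cm"
      then show "character G \<xi>" unfolding Cm_def using character_t3 by auto
    next
      fix \<xi> n g assume "(\<xi>, n) \<in># Cm" "g \<in> carrier G"
      then show "\<xi> g ^ n = 1" unfolding Cm_def using t9[of g x] x_orb[OF x(1)] by (auto simp flip: power_mult)
    next
      fix \<xi> n g assume *: "(\<xi>, n) \<in># Cm" "g \<in> K"
      have "t g x ^ 3 = 1" using K_cube[OF *(2) x(1)] .
      then show "\<xi> g = 1" using *(1) unfolding Cm_def by auto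
    next
      fix g assume g: "g \<in> carrier G" and *: "\<And>\<xi> n. (\<xi>, n) \<in># Cm \<Longrightarrow> \<xi> g = 1"
      have t3: "t g x ^ 3 = 1" using *[of "\<lambda>g. t g x ^ 3" 3] by (simp add: Cm_def)
      show "g \<in> K" by (rule K_if_const[OF g cube_const[OF g t3]]) (simp add: Co)
    qed (auto simp: Cm_def)
    have "card C = 3" using Co card_orb x by simp
    then have "prod_mset M < 16" using M(2) card_K_le by simp
    from two_powers_8[OF M(3) this] have "fits (image_mset snd Cm + M)"
      by (elim disjE) (auto simp: Cm_def fourfold_types_def insert_subset_eq_iff
        intro: fitsI[of "[3, 3, 8]"] fitsI[of "[3, 3, 2, 4]"] fitsI[of "[3, 3, 2, 2, 2]"])
    then show ?thesis using M(1) by blast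
  next
    case (2 y h)
    have y: "y \<in> C" using 2 by simp
    have sub: "orb y \<subseteq> C - orb x" by (rule orb_disjoint[OF x(1) 2(1)])
    have "card (orb y) \<le> card (C - orb x)" using sub by (simp add: card_mono)
    then have "per y \<le> 3" using card_rest card_C_le card_orb[OF y] by simp
    moreover have "\<not> per y \<le> 2" using per_le_2_cube[OF y _ 2(2)] 2(3) by blast
    ultimately have py: "per y = 3" by simp
    have oy: "orb y = C - orb x"
      using sub card_orb[OF y] py card_rest card_C_le card_mono[OF _ sub] by (intro card_subset_eq) auto
    have "card C = 6" using card_rest oy card_orb[OF y] py by simp
    then have CU: "C = UNIV" using card6 by (intro card_subset_eq) auto
    have t9y: "t g y ^ 9 = 1" if "g \<in> carrier G" for g
      using invariant_period(3)[OF invariant_t[OF that] per(2)[OF y]] py by simp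
    define Cm where "Cm = {#((\<lambda>g. t g x ^ 3), 3::nat), ((\<lambda>g. t g x / t g y), 9)#}"
    obtain M where M: "embeds_in G (image_mset snd Cm + M)" "prod_mset M = card K" "two_powers M"
    proof (rule embeds_with_K[of Cm])
      fix \<xi> n assume "(\<xi>, n) \<in># Cm"
      then show "character G \<xi>" unfolding Cm_def using character_t3 character_ratio by auto
    next
      fix \<xi> n g assume "(\<xi>, n) \<in># Cm" "g \<in> carrier G"
      then show "\<xi> g ^ n = 1" unfolding Cm_def using t9[of g x] t9y[of g] x_orb[OF x(1)]
        by (auto simp: power_divide simp flip: power_mult)
    next
      fix \<xi> n g assume *: "(\<xi>, n) \<in># Cm" "g \<in> K"
      have "t g x ^ 3 = 1" using K_cube[OF *(2) x(1)] .
      moreover have "t g x / t g y = 1" using K_const[OF *(2) x(1) y] t_nonzero[OF K_carrier[OF *(2)]] by simp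
      ultimately show "\<xi> g = 1" using *(1) unfolding Cm_def by auto
    next
      fix g assume g: "g \<in> carrier G" and *: "\<And>\<xi> n. (\<xi>, n) \<in># Cm \<Longrightarrow> \<xi> g = 1"
      have t3: "t g x ^ 3 = 1" using *[of "\<lambda>g. t g x ^ 3" 3] by (simp add: Cm_def)
      have "t g x / t g y = 1" using *[of "\<lambda>g. t g x / t g y" 9] by (simp add: Cm_def)
      then have ty: "t g y = t g x" using t_nonzero[OF g] by simp
      then have t3y: "t g y ^ 3 = 1" using t3 by simp
      show "g \<in> K"
      proof (rule K_if_const[OF g])
        fix z assume "z \<in> C"
        then have "z \<in> orb x \<or> z \<in> orb y" using oy by auto
        then show "t g z = t g x" using cube_const[OF g t3, of z] cube_const[OF g t3y, of z] ty by (elim disjE) simp_all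
      qed
    qed (auto simp: Cm_def)
    have "M = {#}" by (rule card_K_1[OF CU M(2,3)])
    then have "fits (image_mset snd Cm + M)"
      by (auto simp: Cm_def fourfold_types_def insert_subset_eq_iff intro: fitsI[of "[3, 3, 9]"])
    then show ?thesis using M(1) by blast
  next
    case 3
    note ts = 3(2)
    obtain s where s: "s \<in> C - orb x" using 3(1) orb_C[OF x(1)] by blast
    have r9: "(t g y / t g s) ^ 9 = 1" if "g \<in> carrier G" "y \<in> C" for g y
    proof -
      have c: "t g z ^ 9 = 1" if "t g z ^ 3 = 1" for z
      proof -
        have "t g z ^ (3 * 3) = 1" by (simp only: power_mult that) simp
        then show ?thesis by simp
      qed
      have "t g s ^ 9 = 1" "t g y ^ 9 = 1"
        using c ts[OF s that(1)] t9[OF that(1), of y] ts[of y, OF _ that(1)] that(2) by auto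
      then show ?thesis by (simp add: power_divide)
    qed
    define D where "D = image_mset (\<lambda>s'. ((\<lambda>g. t g s' / t g s), 3::nat)) (mset_set (C - orb x - {s}))"
    have memD: "\<exists>s'. s' \<in> C - orb x \<and> \<xi> = (\<lambda>g. t g s' / t g s) \<and> n = 3" if "(\<xi>, n) \<in># D" for \<xi> n
      using that by (auto simp: D_def)
    define Cm where "Cm = add_mset ((\<lambda>g. t g x / t g s), 9::nat) D"
    have mem: "\<xi> = (\<lambda>g. t g x / t g s) \<and> n = 9 \<or>
        (\<exists>s'. s' \<in> C - orb x \<and> \<xi> = (\<lambda>g. t g s' / t g s) \<and> n = 3)" if "(\<xi>, n) \<in># Cm" for \<xi> n
      using that memD[of \<xi> n] by (auto simp: Cm_def)
    obtain M where M: "embeds_in G (image_mset snd Cm + M)" "prod_mset M = card K" "two_powers M" "2 ^ size M \<le> card E"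
    proof (rule embeds_with_K[of Cm])
      fix \<xi> n assume "(\<xi>, n) \<in># Cm"
      from mem[OF this] show "character G \<xi>" using character_ratio by auto
    next
      fix \<xi> n g assume *: "(\<xi>, n) \<in># Cm" "g \<in> carrier G"
      from mem[OF *(1)] show "\<xi> g ^ n = 1"
        using r9[OF *(2) x(1)] ts[OF _ *(2)] s by (elim disjE exE) (auto simp: power_divide)
    next
      fix \<xi> n g assume *: "(\<xi>, n) \<in># Cm" "g \<in> K"
      have "t g y / t g s = 1" if "y \<in> C" for y
        using K_const[OF *(2) that, of s] s t_nonzero[OF K_carrier[OF *(2)]] by simp
      then show "\<xi> g = 1" using mem[OF *(1)] x(1) by (elim disjE exE) auto
    next
      fix g assume g: "g \<in> carrier G" and *: "\<And>\<xi> n. (\<xi>, n) \<in># Cm \<Longrightarrow> \<xi> g = 1"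
      have "t g x / t g s = 1" using *[of "\<lambda>g. t g x / t g s" 9] by (simp add: Cm_def)
      then have sx: "t g s = t g x" using t_nonzero[OF g] by simp
      then have t3: "t g x ^ 3 = 1" using ts[OF s g] by simp
      show "g \<in> K"
      proof (rule K_if_const[OF g])
        fix y assume y: "y \<in> C"
        show "t g y = t g x"
        proof (cases "y \<in> orb x \<or> y = s")
          case False
          then have "((\<lambda>g. t g y / t g s), 3) \<in># Cm" using y by (simp add: Cm_def D_def)
          from *[OF this] show ?thesis using sx t_nonzero[OF g] by simp
        next
          case True
          then show ?thesis using cube_const[OF g t3, of y] sx by (elim disjE) simp_all
        qed
      qed
    qed (auto simp: Cm_def D_def)
    define r where "r = card (C - orb x - {s})"
    have r: "card C = r + 4" using card_rest card.remove[OF finite s] unfolding r_def by simp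
    have Cm: "image_mset snd Cm = add_mset 9 (replicate_mset r 3)"
      by (simp add: Cm_def D_def multiset.map_comp o_def image_mset_const_eq r_def)
    \<comment> \<open>The code of a Klein four-group would consist of all subsets of \<open>{k, k'}\<close>, so every monomial contains
      \<open>k\<close> an even number of times, and likewise \<open>k'\<close>. Neither index can be mapped into the cycle, by the
      conflict, nor both of them to the fixed index \<open>s\<close>.\<close>
    have not22: "M \<noteq> {#2, 2#}" if r0: "r = 0"
    proof
      assume "M = {#2, 2#}"
      then have c4: "card code \<ge> 4" using M(4) card_code by (simp add: numeral_2_eq_2)
      have "C - orb x = {s}" using r0 s unfolding r_def by auto
      then have Cs: "C = insert s (orb x)" using orb_C[OF x(1)] s by auto
      have c2: "card (UNIV - C) = 2" using card_Diff_subset[of C UNIV] card6 r r0 by simp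
      then obtain k k' where kk: "UNIV - C = {k, k'}" "k \<noteq> k'" by (auto simp: card_2_iff)
      have "code \<subseteq> Pow (UNIV - C)"
      proof
        fix S assume "S \<in> code"
        then obtain g where "g \<in> E" "S = neg g" by (auto simp: code_def)
        then have "S \<subseteq> UNIV - C" using \<tau>_C[OF E_K] by (auto simp: neg_def)
        then show "S \<in> Pow (UNIV - C)" by simp
      qed
      then have "code = Pow (UNIV - C)" by (intro card_seteq) (use c4 c2 in \<open>auto simp: card_Pow\<close>)
      then have codes: "{k} \<in> code" "{k'} \<in> code" unfolding kk(1) by auto
      have par: "((i = k) \<noteq> (j = k)) = (l = k)" "((i = k') \<noteq> (j = k')) = (l = k')" if "R i j l" for i j l
        using codes[THEN code_R, OF that] by auto
      have \<sigma>kC: "\<sigma> k \<in> C" "\<sigma> k' \<in> C" using par[OF R_\<sigma>] kk(1) by blast+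
      \<comment> \<open>Rescaled to 1 at \<open>s\<close>; the 64-th power is the value six steps further along \<open>\<sigma>\<close>, 
        so it has order dividing nine at all indices.\<close>
      define v where "v i = t u i / t u s" for i
      have v: "invariant v" unfolding invariant_def
      proof (intro allI impI)
        fix i j l assume "R i j l"
        then have "t u i * t u j * t u l = 1" by (rule R_t[OF u(1)])
        moreover have "v i * v j * v l = t u i * t u j * t u l / t u s ^ 3" by (simp add: v_def power3_eq_cube)
        ultimately show "v i * v j * v l = 1" using ts[OF s u(1)] by simp
      qed
      define w where "w i = v i ^ 64" for i
      have w: "invariant w" unfolding w_def by (rule invariant_power[OF v])
      have w_eq: "w i = v ((\<sigma> ^^ 6) i)" for i
        unfolding w_def invariant_\<sigma>6[OF v] ..
      have v9: "v y ^ 9 = 1" if "y \<in> C" for y unfolding v_def by (rule r9[OF u(1) that])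
      have w9: "w i ^ 9 = 1" for i using v9[OF \<sigma>6_C] by (simp add: w_eq)
      have w3: "w x ^ 3 \<noteq> 1"
      proof
        assume "w x ^ 3 = 1"
        then have "v x ^ 192 = 1" by (simp add: w_def flip: power_mult)
        then have "v x ^ gcd 192 9 = 1" using v9[OF x(1)] by (rule power_eq_1_gcd)
        moreover have "gcd 192 (9::nat) = 3" by (simp add: gcd_non_0_nat)
        ultimately have "v x ^ 3 = 1" by simp
        then show False using u(2) ts[OF s u(1)] by (simp add: v_def power_divide)
      qed
      have wj: "w x ^ j \<noteq> 1" if "0 < j" "j < 9" for j
      proof
        assume "w x ^ j = 1"
        then have *: "w x ^ gcd j 9 = 1" using w9 by (rule power_eq_1_gcd)
        have "gcd j 9 dvd 3 ^ 2" by simp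
        then obtain i where i: "i \<le> 2" "gcd j 9 = 3 ^ i" using divides_primepow_nat[of 3 "gcd j 9" 2] by auto
        have "gcd j 9 \<noteq> 9" using that by (metis gcd_dvd1 nat_dvd_not_less)
        then have "i = 0 \<or> i = 1" using i by (auto simp: le_Suc_eq numeral_2_eq_2)
        then have "gcd j 9 = 1 \<or> gcd j 9 = 3" using i(2) by auto
        then have "w x ^ 3 = 1" using * by auto
        then show False using w3 by simp
      qed
      have io: "inj_on w (orb x)" "\<forall>y\<in>orb x. w y \<noteq> 1" using inj_on_orb[OF w x(1) refl wj w9] x(2) by simp_all
      have ws: "w s = 1" using t_nonzero[OF u(1)] by (simp add: w_def v_def)
      have injC: "inj_on w C"
        unfolding Cs using io ws by (auto simp: inj_on_insert)
      have no_orb: "\<sigma> m \<notin> orb x" if m: "m = k \<or> m = k'" for m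
      proof
        assume "\<sigma> m \<in> orb x"
        moreover have "m \<notin> C" using m kk(1) by blast
        ultimately obtain p a b l where l: "p \<in> C" "a \<in> {p, m}" "b \<in> {p, m}" "l \<notin> C" "l \<noteq> m" "R a b l"
          using conflict_outside_orbit[OF w injC _ w9 x(1), of m] x(2) by auto
        have "l = k \<or> l = k'" using l(4) kk(1) by blast
        moreover have "p \<noteq> k" "p \<noteq> k'" using l(1) kk(1) by blast+
        ultimately show False using par[OF l(6)] l(2,3,5) m kk(2) by auto
      qed
      then have "\<sigma> k = s" "\<sigma> k' = s" using \<sigma>kC Cs by auto
      have "card {s} \<le> 2" "card {s} < card {k, k'}" using kk(2) by simp_all
      from nondeg[OF this] obtain a b l where l: "a \<in> {k, k'}" "b \<in> {k, k'}" "l \<notin> {s}" "R a b l" by blast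
      have ab: "a = b" using par[OF l(4)] l(1,2) kk(2) by auto
      then have lC: "l \<in> C" using par[OF l(4)] l(1,2) kk by blast
      have "(w a)\<^sup>2 * w (\<sigma> a) = 1" by (rule invariant_\<sigma>[OF w])
      then have wa2: "(w a)\<^sup>2 = 1" using l(1) \<open>\<sigma> k = s\<close> \<open>\<sigma> k' = s\<close> ws by auto
      have "w a * w b * w l = 1" by (rule invariantD[OF w l(4)])
      then have "w l = w s" using wa2 ab ws by (simp add: power2_eq_square)
      then show False using inj_onD[OF injC _ lC] s l(3) by simp
    qed
    consider "r = 0" | "r = 1" | "r = 2" using r card_C_le by linarith
    then have "fits (image_mset snd Cm + M)"
    proof cases
      case 1
      have "M = {#} \<or> M = {#2#} \<or> M = {#4#} \<or> M = {#2, 2#}"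
        by (rule two_powers_4[OF M(3)]) (use M(2) card_K_le r 1 in simp)
      then have "M = {#} \<or> M = {#2#} \<or> M = {#4#}" using not22[OF 1] by blast
      then show ?thesis unfolding Cm 1
        by (elim disjE) (auto simp: fourfold_types_def insert_subset_eq_iff intro: fitsI[of "[2, 3, 9]"] fitsI[of "[4, 9]"])
    next
      case 2
      have "M = {#} \<or> M = {#2#}" by (rule two_powers_2[OF M(3)]) (use M(2) card_K_le r 2 in simp)
      then show ?thesis unfolding Cm 2
        by (elim disjE) (auto simp: fourfold_types_def insert_subset_eq_iff intro: fitsI[of "[2, 3, 9]"])
    next
      case 3
      have "M = {#}" by (rule two_powers_1[OF M(3)]) (use M(2) card_K_le r 3 in simp)
      then show ?thesis unfolding Cm 3
        by (auto simp: fourfold_types_def insert_subset_eq_iff replicate_mset_small intro: fitsI[of "[3, 3, 9]"])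
    qed
    then show ?thesis using M(1) by blast
  qed
qed

theorem embeds_in_fourfold_type: "\<exists>ns\<in>fourfold_types. embeds_in G (mset ns)"
proof -
  have "\<exists>M. fits M \<and> embeds_in G M"
  proof (cases "\<forall>x\<in>C. \<forall>g\<in>carrier G. t g x ^ 3 = 1")
    case True
    then show ?thesis using embeds_if_cubes by blast
  next
    case False
    then obtain x u where x: "x \<in> C" and u: "u \<in> carrier G" "t u x ^ 3 \<noteq> 1" by blast
    have "\<not> per x \<le> 2" using per_le_2_cube[OF x _ u(1)] u(2) by blast
    moreover have "per x \<le> 6" using card_orb[OF x] card_mono[OF _ orb_C[OF x]] card_C_le by simp
    ultimately have "per x = 3 \<or> per x = 4 \<or> per x = 5 \<or> per x = 6" by linarith
    then show ?thesis using per_3[OF x _ u] per_4[OF x _ u] per_5[OF x _ u] per_6[OF x] by blast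
  qed
  then obtain M ns where "ns \<in> fourfold_types" "M \<subseteq># mset ns" "embeds_in G M" unfolding fits_def by blast
  then show ?thesis using embeds_in_mono by blast
qed

end

section \<open>Common zeros of two conics\<close>

lemma complex_poly_root:
  assumes "coeff p d \<noteq> (0::complex)" "d > 0" shows "\<exists>z. poly p z = 0"
proof (rule fundamental_theorem_of_algebra)
  have "degree p > 0" using le_degree[OF assms(1)] assms(2) by simp
  then show "\<not> constant (poly p)" by (simp add: constant_degree)
qed

text \<open>Eliminating \<open>x\<^sup>2\<close> between the two equations leaves \<open>x D + N = 0\<close> with forms \<open>D\<close>, \<open>N\<close> in \<open>y\<close>, \<open>z\<close>. Inserting \<open>x = - N / D\<close>
  into the second one gives the binary quartic \<open>P\<close>, which has a zero.\<close>

lemma two_conics_aux: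
  fixes a1 b1 c1 d1 e1 f1 a2 b2 c2 d2 e2 f2 :: complex
  assumes "a2 \<noteq> 0"
  shows "\<exists>x y z. (x, y, z) \<noteq> (0, 0, 0) \<and>
    a1 * x\<^sup>2 + b1 * y\<^sup>2 + c1 * z\<^sup>2 + d1 * x * y + e1 * x * z + f1 * y * z = 0 \<and>
    a2 * x\<^sup>2 + b2 * y\<^sup>2 + c2 * z\<^sup>2 + d2 * x * y + e2 * x * z + f2 * y * z = 0"
proof -
  define b c d e f where bcdef: "b = a2 * b1 - a1 * b2" "c = a2 * c1 - a1 * c2" "d = a2 * d1 - a1 * d2"
    "e = a2 * e1 - a1 * e2" "f = a2 * f1 - a1 * f2"
  define N D where "N y z = b * y\<^sup>2 + c * z\<^sup>2 + f * y * z" and "D y z = d * y + e * z" for y z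
  define P where "P y z = a2 * (N y z)\<^sup>2 - N y z * D y z * (d2 * y + e2 * z)
     + (D y z)\<^sup>2 * (b2 * y\<^sup>2 + c2 * z\<^sup>2 + f2 * y * z)" for y z
  have *: ?thesis if xyz: "(x, y, z) \<noteq> (0, 0, 0)" "x * D y z + N y z = 0"
    "a2 * x\<^sup>2 + b2 * y\<^sup>2 + c2 * z\<^sup>2 + d2 * x * y + e2 * x * z + f2 * y * z = 0" for x y z
  proof -
    have "a2 * (a1 * x\<^sup>2 + b1 * y\<^sup>2 + c1 * z\<^sup>2 + d1 * x * y + e1 * x * z + f1 * y * z)
      = a1 * (a2 * x\<^sup>2 + b2 * y\<^sup>2 + c2 * z\<^sup>2 + d2 * x * y + e2 * x * z + f2 * y * z) + (x * D y z + N y z)"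
      by (simp add: D_def N_def bcdef algebra_simps)
    then have "a1 * x\<^sup>2 + b1 * y\<^sup>2 + c1 * z\<^sup>2 + d1 * x * y + e1 * x * z + f1 * y * z = 0"
      using xyz assms by simp
    then show ?thesis using xyz by blast
  qed
  obtain y z where yz: "(y, z) \<noteq> (0, 0)" "P y z = 0"
  proof (cases "P 0 1 = 0")
    case False
    define p where "p = smult a2 ([:b, f, c:] * [:b, f, c:]) - [:b, f, c:] * [:d, e:] * [:d2, e2:]
      + [:d, e:] * [:d, e:] * [:b2, f2, c2:]"
    have "poly p t = P 1 t" for t
      by (simp add: p_def P_def N_def D_def algebra_simps power2_eq_square)
    moreover have "coeff p 4 = P 0 1"
      by (simp add: p_def P_def N_def D_def algebra_simps power2_eq_square numeral_eq_Suc)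
    ultimately show ?thesis using that[of 1] complex_poly_root[of p 4] False by auto
  qed (use that[of 0 1] in auto)
  show ?thesis
  proof (cases "D y z = 0 \<and> N y z = 0")
    case True
    obtain x where "poly [:b2 * y\<^sup>2 + c2 * z\<^sup>2 + f2 * y * z, d2 * y + e2 * z, a2:] x = 0"
      using complex_poly_root[of "[:b2 * y\<^sup>2 + c2 * z\<^sup>2 + f2 * y * z, d2 * y + e2 * z, a2:]" 2] assms
      by (auto simp: numeral_eq_Suc)
    then show ?thesis
      using yz True by (intro *[of x y z]) (auto simp: algebra_simps power2_eq_square)
  next
    case False
    have "a2 * (- N y z)\<^sup>2 + b2 * (y * D y z)\<^sup>2 + c2 * (z * D y z)\<^sup>2 + d2 * (- N y z) * (y * D y z)
      + e2 * (- N y z) * (z * D y z) + f2 * (y * D y z) * (z * D y z) = P y z"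
      by (simp add: P_def algebra_simps power2_eq_square)
    moreover have "- N y z * D (y * D y z) (z * D y z) + N (y * D y z) (z * D y z) = 0"
    proof -
      have "D (y * D y z) (z * D y z) = (D y z)\<^sup>2"
        by (simp add: D_def algebra_simps power2_eq_square)
      moreover have "N (y * r) (z * r) = N y z * r\<^sup>2" for r
        by (simp add: N_def algebra_simps power2_eq_square)
      ultimately show ?thesis by simp
    qed
    ultimately show ?thesis
      using False yz by (intro *[of "- N y z" "y * D y z" "z * D y z"]) auto
  qed
qed

lemma two_conics:
  fixes a1 b1 c1 d1 e1 f1 a2 b2 c2 d2 e2 f2 :: complex
  shows "\<exists>x y z. (x, y, z) \<noteq> (0, 0, 0) \<and>
    a1 * x\<^sup>2 + b1 * y\<^sup>2 + c1 * z\<^sup>2 + d1 * x * y + e1 * x * z + f1 * y * z = 0 \<and>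
    a2 * x\<^sup>2 + b2 * y\<^sup>2 + c2 * z\<^sup>2 + d2 * x * y + e2 * x * z + f2 * y * z = 0"
proof -
  consider "a1 \<noteq> 0" | "a2 \<noteq> 0" | "a1 = 0" "a2 = 0" by blast
  then show ?thesis
  proof cases
    case 1
    then show ?thesis using two_conics_aux[of a1 a2 b2 c2 d2 e2 f2 b1 c1 d1 e1 f1] by blast
  next
    case 3
    then show ?thesis by (intro exI[of _ 1] exI[of _ 0]) simp
  qed (rule two_conics_aux)
qed

section \<open>Cubic forms as symmetric trilinear forms\<close>

text \<open>A cubic form is represented by its polarization: \<open>F x = B x x x\<close>. Then \<open>3 * B x x v\<close> is the derivative of \<open>F\<close> in
  direction \<open>v\<close>.\<close>

locale sym_trilinear =
  fixes B :: "complex ^ 'n::finite \<Rightarrow> complex ^ 'n \<Rightarrow> complex ^ 'n \<Rightarrow> complex"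
  assumes sym12: "B x y z = B y x z" and sym23: "B x y z = B x z y"
    and add1: "B (x + x') y z = B x y z + B x' y z"
    and scale1: "B (c *s x) y z = c * B x y z"
begin

lemma add2: "B x (y + y') z = B x y z + B x y' z"
  using add1[of y y' x z] by (simp add: sym12)

lemma add3: "B x y (z + z') = B x y z + B x y z'"
  using add2[of x z z' y] by (simp add: sym23)

lemma scale2: "B x (c *s y) z = c * B x y z"
  using scale1[of c y x z] by (simp add: sym12)

lemma scale3: "B x y (c *s z) = c * B x y z"
  using scale2[of x c z y] by (simp add: sym23)

lemmas expand = add1 add2 add3 scale1 scale2 scale3

lemma sum3: "B x y (\<Sum>i\<in>A. c i *s b i) = (\<Sum>i\<in>A. c i * B x y (b i))"
proof -
  have "B x y 0 = 0" using scale3[of x y 0 0] by simp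
  then show ?thesis by (induction A rule: infinite_finite_induct) (auto simp: expand)
qed

lemma perm: "B y x z = B x y z" "B x z y = B x y z" "B y z x = B x y z" "B z x y = B x y z" "B z y x = B x y z"
  by (metis sym12 sym23)+

lemma cube_add:
  "B (x + s *s y) (x + s *s y) (x + s *s y) = B x x x + 3 * s * B x x y + 3 * s\<^sup>2 * B x y y + s ^ 3 * B y y y"
proof -
  have "B y x x = B x x y" "B x y x = B x x y" "B y x y = B x y y" "B y y x = B x y y"
    by (metis sym12 sym23)+
  then show ?thesis
    by (simp add: expand algebra_simps power2_eq_square power3_eq_cube)
qed

end

locale smooth_trilinear = sym_trilinear B
  for B :: "complex ^ 'n::finite \<Rightarrow> complex ^ 'n \<Rightarrow> complex ^ 'n \<Rightarrow> complex" +
  assumes smooth: "x \<noteq> 0 \<Longrightarrow> \<exists>v. B x x v \<noteq> 0"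
begin

text \<open>Otherwise, for \<open>w\<close> in the span of the \<open>b i\<close> with \<open>i \<in> S\<close>, the linear form \<open>B w w\<close> would vanish at all \<open>b l\<close> except
  the at most two with \<open>l \<in> U\<close>. Its values at these are quadratic forms in more variables than there are forms, so they
  have a common zero \<open>w\<close>, a singular point.\<close>

lemma monomial_exists:
  fixes b :: "'m::finite \<Rightarrow> complex ^ 'n"
  assumes indep: "\<And>c. (\<Sum>i\<in>UNIV. c i *s b i) = 0 \<Longrightarrow> \<forall>i. c i = 0"
    and span: "\<And>v. \<exists>c. v = (\<Sum>i\<in>UNIV. c i *s b i)"
    and "finite U" "finite S" "card U \<le> 2" "card U < card S"
  shows "\<exists>i\<in>S. \<exists>k\<in>S. \<exists>l. l \<notin> U \<and> B (b i) (b k) (b l) \<noteq> 0"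
proof (rule ccontr)
  assume "\<not> ?thesis"
  then have z: "B (b i) (b k) (b l) = 0" if "i \<in> S" "k \<in> S" "l \<notin> U" for i k l using that by blast
  have comb: "\<exists>c. (x *s b i + y *s b j + z *s b k) = (\<Sum>i\<in>UNIV. c i *s b i) \<and> c i = x \<and> c j = y \<and> c k = z"
    if "i \<noteq> j" "i \<noteq> k" "j \<noteq> k" for x y z i j k
  proof (intro exI conjI)
    let ?c = "\<lambda>l. if l = i then x else if l = j then y else if l = k then z else 0"
    have "(\<Sum>l\<in>UNIV. ?c l *s b l) = (\<Sum>l\<in>{i,j,k}. ?c l *s b l)"
      by (rule sum.mono_neutral_right) auto
    also have "\<dots> = x *s b i + y *s b j + z *s b k" using that by (simp add: add.assoc)
    finally show "x *s b i + y *s b j + z *s b k = (\<Sum>l\<in>UNIV. ?c l *s b l)" by simp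
  qed (use that in auto)
  have bad: False if "x \<noteq> 0" "\<And>l. B x x (b l) = 0" for x
  proof -
    from smooth[OF that(1)] obtain v where v: "B x x v \<noteq> 0" by blast
    obtain c where "v = (\<Sum>i\<in>UNIV. c i *s b i)" using span by blast
    then show False using v that(2) by (simp add: sum3)
  qed
  have bad3: False if "i \<in> S" "j \<in> S" "k \<in> S" "i \<noteq> j" "i \<noteq> k" "j \<noteq> k" "U \<subseteq> {l, m}" for i j k l m
  proof -
    let ?q = "\<lambda>l. \<lambda>x y z. B (b i) (b i) (b l) * x\<^sup>2 + B (b j) (b j) (b l) * y\<^sup>2 + B (b k) (b k) (b l) * z\<^sup>2
      + (2 * B (b i) (b j) (b l)) * x * y + (2 * B (b i) (b k) (b l)) * x * z + (2 * B (b j) (b k) (b l)) * y * z"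
    obtain x y z where xyz: "(x, y, z) \<noteq> (0, 0, 0)" "?q l x y z = 0" "?q m x y z = 0"
      using two_conics[of "B (b i) (b i) (b l)" "B (b j) (b j) (b l)" "B (b k) (b k) (b l)" "2 * B (b i) (b j) (b l)" "2 * B (b i) (b k) (b l)" "2 * B (b j) (b k) (b l)"
        "B (b i) (b i) (b m)" "B (b j) (b j) (b m)" "B (b k) (b k) (b m)" "2 * B (b i) (b j) (b m)" "2 * B (b i) (b k) (b m)" "2 * B (b j) (b k) (b m)"] by blast
    define w where "w = x *s b i + y *s b j + z *s b k"
    have Bw: "B w w (b r) = ?q r x y z" for r
    proof -
      have "B (b j) (b i) (b r) = B (b i) (b j) (b r)" "B (b k) (b i) (b r) = B (b i) (b k) (b r)"
        "B (b k) (b j) (b r) = B (b j) (b k) (b r)" by (rule sym12)+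
      then show ?thesis by (simp add: w_def expand algebra_simps power2_eq_square)
    qed
    have "w \<noteq> 0"
    proof
      assume "w = 0"
      then show False using comb[OF that(4-6), of x y z] indep xyz(1) unfolding w_def by (metis prod.inject)
    qed
    moreover have "B w w (b r) = 0" for r
    proof (cases "r \<in> U")
      case True
      then show ?thesis using that(7) xyz Bw by auto
    next
      case False
      then show ?thesis unfolding Bw using z that(1-3) by simp
    qed
    ultimately show False by (rule bad)
  qed
  \<comment> \<open>The case of one quadric; the equation \<open>z\<^sup>2 = 0\<close> serves as the second conic.\<close>
  have bad2: False if "i \<in> S" "j \<in> S" "i \<noteq> j" "U \<subseteq> {l}" for i j l
  proof -
    let ?q = "\<lambda>l. \<lambda>x y. B (b i) (b i) (b l) * x\<^sup>2 + B (b j) (b j) (b l) * y\<^sup>2 + 2 * B (b i) (b j) (b l) * x * y"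
    obtain x y z where xyz: "(x, y, z) \<noteq> (0, 0, 0)" 
      "B (b i) (b i) (b l) * x\<^sup>2 + B (b j) (b j) (b l) * y\<^sup>2 + 0 * z\<^sup>2 + (2 * B (b i) (b j) (b l)) * x * y + 0 * x * z + 0 * y * z = 0"
      "0 * x\<^sup>2 + 0 * y\<^sup>2 + 1 * z\<^sup>2 + 0 * x * y + 0 * x * z + 0 * y * z = 0"
      using two_conics[of "B (b i) (b i) (b l)" "B (b j) (b j) (b l)" 0 "2 * B (b i) (b j) (b l)" 0 0 0 0 1 0 0 0]
      by blast
    have z0: "z = 0" using xyz(3) by simp
    have xy: "(x, y) \<noteq> (0, 0)" "?q l x y = 0" using xyz z0 by simp_all
    define w where "w = x *s b i + y *s b j"
    have Bw: "B w w (b r) = ?q r x y" for r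
    proof -
      have "B (b j) (b i) (b r) = B (b i) (b j) (b r)" by (rule sym12)
      then show ?thesis by (simp add: w_def expand algebra_simps power2_eq_square)
    qed
    have "w \<noteq> 0"
    proof
      assume "w = 0"
      let ?c = "\<lambda>l. if l = i then x else if l = j then y else 0"
      have "(\<Sum>l\<in>UNIV. ?c l *s b l) = (\<Sum>l\<in>{i,j}. ?c l *s b l)"
        by (rule sum.mono_neutral_right) auto
      also have "\<dots> = w" using that by (simp add: w_def)
      also note \<open>w = 0\<close>
      finally have "\<forall>l. ?c l = 0" by (rule indep)
      then have "?c i = 0" "?c j = 0" by blast+
      then show False using xy(1) that(3) by simp
    qed
    moreover have "B w w (b r) = 0" for r
    proof (cases "r \<in> U")
      case True
      then show ?thesis using that(4) xy Bw by auto
    next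
      case False
      then show ?thesis unfolding Bw using z that(1-2) by simp
    qed
    ultimately show False by (rule bad)
  qed
  consider "card U = 0" | "card U = 1" | "card U = 2" using assms(5) by linarith
  then show False
  proof cases
    case 1
    then obtain i where i: "i \<in> S" using assms(6) by (metis all_not_in_conv card.empty less_not_refl)
    have "b i \<noteq> 0"
    proof
      assume "b i = 0"
      let ?c = "\<lambda>l. if l = i then 1 else 0"
      have "(\<Sum>l\<in>UNIV. ?c l *s b l) = (\<Sum>l\<in>{i}. ?c l *s b l)"
        by (rule sum.mono_neutral_right) auto
      also have "\<dots> = 0" using \<open>b i = 0\<close> by simp
      finally have "\<forall>l. ?c l = (0::complex)" by (rule indep)
      then show False by (metis one_neq_zero)
    qed
    then show False
    proof (rule bad)
      show "B (b i) (b i) (b l) = 0" for l using z[OF i i, of l] 1 \<open>finite U\<close> by simp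
    qed
  next
    case 2
    then obtain l where "U = {l}" by (auto simp: card_1_singleton_iff)
    moreover have "2 \<le> card S" using assms(6) 2 by simp
    then obtain T where "T \<subseteq> S" "card T = 2" by (metis obtain_subset_with_card_n)
    moreover from this obtain i j where "T = {i, j}" "i \<noteq> j" unfolding card_2_iff by blast
    ultimately show False using bad2[of i j l] by auto
  next
    case 3
    then obtain l m where "U = {l, m}" by (auto simp: card_2_iff)
    moreover have "3 \<le> card S" using assms(6) 3 by simp
    then obtain T where "T \<subseteq> S" "card T = 3" by (metis obtain_subset_with_card_n)
    moreover from this obtain i j k where "T = {i, j, k}" "i \<noteq> j" "i \<noteq> k" "j \<noteq> k"
      unfolding card_3_iff by blast
    ultimately show False using bad3[of i j k l m] by auto
  qed
qed

end

section \<open>Forms with the same zeros\<close>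

definition cubic_disc :: "'a::comm_ring_1 \<Rightarrow> 'a \<Rightarrow> 'a \<Rightarrow> 'a \<Rightarrow> 'a" where
  "cubic_disc a b c d = b^2 * c^2 - 4 * a * c^3 - 4 * b^3 * d - 27 * a^2 * d^2 + 18 * a * b * c * d"

lemma poly_eq_0_if_nonzero_roots:
  assumes "\<And>s. s \<noteq> 0 \<Longrightarrow> poly p s = (0::complex)" shows "p = 0"
proof (rule ccontr)
  assume "p \<noteq> 0"
  then have "finite {s. poly p s = 0}" by (rule poly_roots_finite)
  moreover have "UNIV - {0} \<subseteq> {s. poly p s = 0}" using assms by auto
  ultimately have "finite (UNIV - {0::complex})" by (rule finite_subset[rotated])
  then show False using infinite_UNIV_char_0[where 'a = complex] by simp
qed

text \<open>With three distinct roots in common, two cubic polynomials are proportional. Only the constant and the leading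
  coefficient are compared, because these become values of the two forms.\<close>

lemma cubic_vanishing_on_roots:
  fixes a b c d :: complex
  assumes a: "a \<noteq> 0" and disc: "cubic_disc a b c d \<noteq> 0"
    and van: "\<And>t. a * t^3 + b * t^2 + c * t + d = 0 \<Longrightarrow> a' * t^3 + b' * t^2 + c' * t + d' = 0"
  shows "a * d' = a' * d"
proof -
  obtain r1 where "poly [:d, c, b, a:] r1 = 0"
    using complex_poly_root[of "[:d, c, b, a:]" 3] a by (auto simp: numeral_eq_Suc)
  then have d: "d = - (a * r1^3 + b * r1^2 + c * r1)"
    by (simp add: algebra_simps power2_eq_square power3_eq_cube eq_neg_iff_add_eq_0)
  obtain r2 where "poly [:c + b * r1 + a * r1^2, b + a * r1, a:] r2 = 0"
    using complex_poly_root[of "[:c + b * r1 + a * r1^2, b + a * r1, a:]" 2] a by (auto simp: numeral_eq_Suc)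
  then have c: "c = - (b * r1 + a * r1^2 + r2 * (b + a * r1) + a * r2^2)"
    by (simp add: algebra_simps power2_eq_square eq_neg_iff_add_eq_0)
  define r3 where "r3 = - (b / a) - r1 - r2"
  have b: "b = - a * (r1 + r2 + r3)" using a by (simp add: r3_def field_simps)
  have c': "c = a * (r1 * r2 + r1 * r3 + r2 * r3)"
    unfolding c b by (simp add: algebra_simps power2_eq_square)
  have d': "d = - a * r1 * r2 * r3"
    unfolding d c' b by (simp add: algebra_simps power2_eq_square power3_eq_cube)
  have "cubic_disc a b c d = a^4 * ((r1 - r2) * (r1 - r3) * (r2 - r3))^2"
    unfolding b c' d' cubic_disc_def by Groebner_Basis.algebra
  then have ne: "r1 \<noteq> r2" "r1 \<noteq> r3" "r2 \<noteq> r3" using disc by auto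
  have fac: "a * t^3 + b * t^2 + c * t + d = a * (t - r1) * (t - r2) * (t - r3)" for t
    unfolding b c' d' by Groebner_Basis.algebra
  \<comment> \<open>The combination of the two cubics without cubic term vanishes at three points.\<close>
  define p where "p = a * b' - a' * b"
  have e: "p * t^2 + (a * c' - a' * c) * t + (a * d' - a' * d) = 0" if "t \<in> {r1, r2, r3}" for t
  proof -
    have f: "a * t^3 + b * t^2 + c * t + d = 0" using that unfolding fac by auto
    have "p * t^2 + (a * c' - a' * c) * t + (a * d' - a' * d)
      = a * (a' * t^3 + b' * t^2 + c' * t + d') - a' * (a * t^3 + b * t^2 + c * t + d)"
      unfolding p_def by Groebner_Basis.algebra
    then show ?thesis using f van[OF f] by simp
  qed
  have "(r1 - r2) * (p * (r1 + r2) + (a * c' - a' * c)) = 0"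
    using e[of r1] e[of r2] by simp Groebner_Basis.algebra
  moreover have "(r1 - r3) * (p * (r1 + r3) + (a * c' - a' * c)) = 0"
    using e[of r1] e[of r3] by simp Groebner_Basis.algebra
  ultimately have 2: "p * (r1 + r2) + (a * c' - a' * c) = 0" "p * (r1 + r3) + (a * c' - a' * c) = 0"
    using ne by auto
  then have "p * (r2 - r3) = 0" by Groebner_Basis.algebra
  then have "p = 0" using ne by simp
  then show ?thesis using 2 e[of r1] by simp
qed

context smooth_trilinear
begin

lemma nonzero_axes:
  fixes i1 i2 i3 :: 'n
  assumes "i1 \<noteq> i2" "i1 \<noteq> i3" "i2 \<noteq> i3" "(x, y, z) \<noteq> (0, 0, 0)"
  shows "x *s axis i1 1 + y *s axis i2 1 + z *s axis i3 1 \<noteq> (0 :: complex ^ 'n)"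
proof
  assume a: "x *s axis i1 1 + y *s axis i2 1 + z *s axis i3 1 = (0 :: complex ^ 'n)"
  have "(x *s axis i1 1 + y *s axis i2 1 + z *s axis i3 1) $ k = (0 :: complex ^ 'n) $ k" for k
    using a by simp
  from this[of i1] this[of i2] this[of i3] show False using assms by (auto simp: axis_def)
qed

lemma zero_exists:
  assumes "CARD('n) \<ge> 3" shows "\<exists>x. x \<noteq> 0 \<and> B x x x = 0"
proof -
  obtain T :: "'n set" where "card T = 3" using assms obtain_subset_with_card_n[of 3 UNIV] by auto
  then obtain i1 i2 i3 :: 'n where i: "i1 \<noteq> i2" "i1 \<noteq> i3" "i2 \<noteq> i3" by (auto simp: card_3_iff)
  define e1 e2 :: "complex ^ 'n" where "e1 = axis i1 1" "e2 = axis i2 1"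
  show ?thesis
  proof (cases "B e2 e2 e2 = 0")
    case True
    then show ?thesis using nonzero_axes[OF i, of 0 1 0] by (intro exI[of _ e2]) (simp add: e1_e2_def)
  next
    case False
    define p where "p = [:B e1 e1 e1, 3 * B e1 e1 e2, 3 * B e1 e2 e2, B e2 e2 e2:]"
    have "coeff p 3 \<noteq> 0" using False by (simp add: p_def numeral_eq_Suc)
    then obtain s where "poly p s = 0" using complex_poly_root[of p 3] by auto
    then have "B (e1 + s *s e2) (e1 + s *s e2) (e1 + s *s e2) = 0"
      by (simp add: cube_add p_def algebra_simps power2_eq_square power3_eq_cube)
    moreover have "e1 + s *s e2 \<noteq> 0" using nonzero_axes[OF i, of 1 s 0] by (simp add: e1_e2_def)
    ultimately show ?thesis by blast
  qed
qed

text \<open>The condition says that the plane through \<open>x\<close> and \<open>w\<close> meets \<open>F = 0\<close> in three distinct lines. If it always failed, then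
  \<open>F\<close> would be \<open>3/4\<close> times the product of the linear form \<open>B x x\<close> and the square of a linear form \<open>m\<close>, and
  any common zero of both would be a singular point.\<close>

lemma transversal_exists:
  assumes card: "CARD('n) \<ge> 3" and x: "x \<noteq> 0" "B x x x = 0"
  shows "\<exists>w. B x x w \<noteq> 0 \<and> 3 * (B x w w)^2 - 4 * B x x w * B w w w \<noteq> 0"
proof (rule ccontr)
  assume "\<not> ?thesis"
  then have deg: "3 * (B x w w)^2 = 4 * B x x w * B w w w" if "B x x w \<noteq> 0" for w using that by auto
  obtain u0 where u0: "B x x u0 \<noteq> 0" using smooth[OF x(1)] by blast
  define u where "u = (1 / B x x u0) *s u0"
  have u: "B x x u = 1" using u0 by (simp add: u_def expand)
  have Q0: "B x h h = 0" if "B x x h = 0" for h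
  proof -
    define p where "p = smult 3 ([:B x h h, 2 * B x h u, B x u u:] ^ 2)
      - [:0, 4:] * [:B h h h, 3 * B h h u, 3 * B h u u, B u u u:]"
    have "poly p s = 0" if "s \<noteq> 0" for s
    proof -
      have l: "B x x (h + s *s u) = s" using \<open>B x x h = 0\<close> u by (simp add: expand)
      have "B x (h + s *s u) (h + s *s u) = B x h h + 2 * s * B x h u + s\<^sup>2 * B x u u"
        using sym23[of x u h] by (simp add: expand algebra_simps power2_eq_square)
      then show ?thesis using deg[of "h + s *s u"] l that cube_add[of h s u]
        by (simp add: p_def algebra_simps power2_eq_square power3_eq_cube)
    qed
    then have "p = 0" by (rule poly_eq_0_if_nonzero_roots)
    then have "poly p 0 = 0" by simp
    then show ?thesis by (simp add: p_def)
  qed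
  define m where "m w = 2 * B x w u - B x x w * B x u u" for w
  have Qm: "B x w w = B x x w * m w" for w
  proof -
    have "B x x (w + (- B x x w) *s u) = 0" by (simp only: expand u) simp
    then have "B x (w + (- B x x w) *s u) (w + (- B x x w) *s u) = 0" by (rule Q0)
    moreover have "B x u w = B x w u" by (rule sym23)
    ultimately have "B x w w - 2 * B x x w * B x w u + (B x x w)\<^sup>2 * B x u u = 0"
      by (simp only: expand) Groebner_Basis.algebra
    then show ?thesis by (simp add: m_def algebra_simps power2_eq_square)
  qed
  have F: "4 * B w w w = 3 * B x x w * (m w)^2" if "B x x w \<noteq> 0" for w
    using deg[OF that] that unfolding Qm by (simp add: power2_eq_square mult_ac)
  obtain T :: "'n set" where "card T = 3" using card obtain_subset_with_card_n[of 3 UNIV] by auto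
  then obtain i1 i2 i3 :: 'n where i: "i1 \<noteq> i2" "i1 \<noteq> i3" "i2 \<noteq> i3" by (auto simp: card_3_iff)
  define e1 e2 e3 :: "complex ^ 'n" where e: "e1 = axis i1 1" "e2 = axis i2 1" "e3 = axis i3 1"
  let ?l = "B x x"
  \<comment> \<open>A common zero of the linear forms \<open>?l\<close> and \<open>m\<close>, found as a common zero of their squares.\<close>
  obtain a b c where abc: "(a, b, c) \<noteq> (0, 0, 0)"
    "(?l e1)^2 * a\<^sup>2 + (?l e2)^2 * b\<^sup>2 + (?l e3)^2 * c\<^sup>2 + (2 * ?l e1 * ?l e2) * a * b
       + (2 * ?l e1 * ?l e3) * a * c + (2 * ?l e2 * ?l e3) * b * c = 0"
    "(m e1)^2 * a\<^sup>2 + (m e2)^2 * b\<^sup>2 + (m e3)^2 * c\<^sup>2 + (2 * m e1 * m e2) * a * b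
       + (2 * m e1 * m e3) * a * c + (2 * m e2 * m e3) * b * c = 0"
    using two_conics[of "(?l e1)^2" "(?l e2)^2" "(?l e3)^2" "2 * ?l e1 * ?l e2" "2 * ?l e1 * ?l e3" "2 * ?l e2 * ?l e3"
      "(m e1)^2" "(m e2)^2" "(m e3)^2" "2 * m e1 * m e2" "2 * m e1 * m e3" "2 * m e2 * m e3"] by blast
  define w0 where "w0 = a *s e1 + b *s e2 + c *s e3"
  have "(?l w0)^2 = 0" using abc(2) by (simp add: w0_def expand algebra_simps power2_eq_square)
  then have l0: "?l w0 = 0" by simp
  have "m w0 = a * m e1 + b * m e2 + c * m e3"
    by (simp add: m_def w0_def expand algebra_simps)
  then have "(m w0)^2 = 0" using abc(3) by (simp add: algebra_simps power2_eq_square)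
  then have m0: "m w0 = 0" by simp
  have w0: "w0 \<noteq> 0" unfolding w0_def e by (rule nonzero_axes[OF i abc(1)])
  have van: "B w0 w0 v = 0" if v: "?l v \<noteq> 0" for v
  proof -
    define p where "p = [:4 * B w0 w0 w0, 12 * B w0 w0 v, 12 * B w0 v v, 4 * B v v v - 3 * ?l v * (m v)^2:]"
    have "poly p s = 0" if "s \<noteq> 0" for s
    proof -
      have l: "?l (w0 + s *s v) = s * ?l v" by (simp add: expand l0)
      have "m (w0 + s *s v) = m w0 + s * m v" by (simp add: m_def expand algebra_simps)
      then have "4 * (B w0 w0 w0 + 3 * s * B w0 w0 v + 3 * s\<^sup>2 * B w0 v v + s ^ 3 * B v v v)
          = 3 * (s * ?l v) * (s * m v)^2"
        using F[of "w0 + s *s v"] that v m0 l cube_add[of w0 s v] by simp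
      then show ?thesis
        by (simp add: p_def algebra_simps power2_eq_square power3_eq_cube)
    qed
    then have "p = 0" by (rule poly_eq_0_if_nonzero_roots)
    then show ?thesis by (simp add: p_def)
  qed
  obtain v where v: "B w0 w0 v \<noteq> 0" using smooth[OF w0] by blast
  show False
  proof (cases "?l v = 0")
    case True
    then have "?l (v + u) \<noteq> 0" "?l u \<noteq> 0" using u by (simp_all add: expand)
    then have "B w0 w0 (v + u) = 0" "B w0 w0 u = 0" using van by blast+
    then show False using v by (simp add: expand)
  qed (use van v in blast)
qed

text \<open>Choose a line of direction \<open>v\<close> through a point \<open>w\<close> on which \<open>F\<close> has three distinct zeros. Moving \<open>w\<close> along another line to an
  arbitrary point \<open>p\<close>, the discriminant stays nonzero except at finitely many places. Where it is nonzero the values of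
  \<open>F'\<close> and \<open>F\<close> are in the ratio \<open>F' v : F v\<close>, so a polynomial identity extends this to \<open>p\<close>.\<close>

theorem proportional_if_vanishing:
  fixes B' :: "complex ^ 'n \<Rightarrow> complex ^ 'n \<Rightarrow> complex ^ 'n \<Rightarrow> complex"
  assumes "sym_trilinear B'" and card: "CARD('n) \<ge> 3"
    and van: "\<And>x. B x x x = 0 \<Longrightarrow> B' x x x = 0"
  shows "\<exists>l. \<forall>x. B' x x x = l * B x x x"
proof -
  interpret B': sym_trilinear B' by fact
  obtain x where x: "x \<noteq> 0" "B x x x = 0" using zero_exists[OF card] by blast
  obtain w where w: "B x x w \<noteq> 0" "3 * (B x w w)^2 - 4 * B x x w * B w w w \<noteq> 0"
    using transversal_exists[OF card x] by blast
  define l b f where "l = B x x w" and "b = B x w w" and "f = B w w w"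
  define pm where "pm = [:3 * l, 3 * b, f:]"
  have "pm \<noteq> 0" using w by (auto simp: pm_def l_def)
  then have "finite {s. poly pm s = 0}" by (rule poly_roots_finite)
  then have "\<exists>\<mu>. \<mu> \<notin> insert 0 {s. poly pm s = 0}"
    by (intro ex_new_if_finite infinite_UNIV_char_0) simp
  then obtain \<mu> where \<mu>: "\<mu> \<noteq> 0" "poly pm \<mu> \<noteq> 0" by auto
  \<comment> \<open>The zero \<open>x\<close> itself is not admissible as direction, since the leading coefficient \<open>B v v v\<close> must not vanish.\<close>
  define v where "v = x + \<mu> *s w"
  have Bv: "B v v v = \<mu> * (3 * l + 3 * \<mu> * b + \<mu>^2 * f)"
    using x by (simp add: v_def cube_add l_def b_def f_def algebra_simps power2_eq_square power3_eq_cube)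
  have vne: "B v v v \<noteq> 0"
  proof -
    have "poly pm \<mu> = 3 * l + 3 * \<mu> * b + \<mu>^2 * f"
      by (simp add: pm_def algebra_simps power2_eq_square)
    then show ?thesis unfolding Bv using \<mu> by simp
  qed
  have Bwwv: "B w w v = b + \<mu> * f"
    using perm by (simp add: v_def expand b_def f_def)
  have Bwvv: "B w v v = l + 2 * \<mu> * b + \<mu>^2 * f"
  proof -
    have "B w x x = l" "B w x w = b" "B w w x = b" unfolding l_def b_def by (metis sym12 sym23)+
    then show ?thesis by (simp add: v_def expand f_def algebra_simps power2_eq_square)
  qed
  have disc: "cubic_disc (B v v v) (3 * B w v v) (3 * B w w v) (B w w w) \<noteq> 0"
  proof -
    have "cubic_disc (B v v v) (3 * B w v v) (3 * B w w v) (B w w w) = 27 * l^2 * (3 * b^2 - 4 * l * f)"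
      unfolding Bv Bwwv Bwvv f_def[symmetric] cubic_disc_def by Groebner_Basis.algebra
    then show ?thesis using w by (simp add: l_def b_def f_def)
  qed
  have main: "B v v v * B' p p p = B' v v v * B p p p" for p
  proof -
    define d where "d = p - w"
    define P where "P s = w + s *s d" for s
    define c2 where "c2 = [:3 * B w v v, 3 * B d v v:]"
    define c1 where "c1 = [:3 * B w w v, 6 * B w d v, 3 * B d d v:]"
    define c0 where "c0 = [:B w w w, 3 * B w w d, 3 * B w d d, B d d d:]"
    define c0' where "c0' = [:B' w w w, 3 * B' w w d, 3 * B' w d d, B' d d d:]"
    have c2: "poly c2 s = 3 * B (P s) v v" for s
      by (simp add: c2_def P_def expand algebra_simps)
    have c1: "poly c1 s = 3 * B (P s) (P s) v" for s
      using sym12[of d w v] by (simp add: c1_def P_def expand algebra_simps)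
    have c0: "poly c0 s = B (P s) (P s) (P s)" for s
      by (simp add: c0_def P_def cube_add algebra_simps power2_eq_square power3_eq_cube)
    have c0': "poly c0' s = B' (P s) (P s) (P s)" for s
      by (simp add: c0'_def P_def B'.cube_add algebra_simps power2_eq_square power3_eq_cube)
    define D where "D = cubic_disc [:B v v v:] c2 c1 c0"
    have D: "poly D s = cubic_disc (B v v v) (3 * B (P s) v v) (3 * B (P s) (P s) v) (B (P s) (P s) (P s))" for s
      by (simp add: D_def cubic_disc_def c2 c1 c0)
    define E where "E = smult (B v v v) c0' - smult (B' v v v) c0"
    have "poly (E * D) s = 0" for s
    proof (cases "poly D s = 0")
      case False
      have "B v v v * B' (P s) (P s) (P s) = B' v v v * B (P s) (P s) (P s)"
      proof (rule cubic_vanishing_on_roots[OF vne, of "3 * B (P s) v v" "3 * B (P s) (P s) v" _ _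
            "3 * B' (P s) v v" "3 * B' (P s) (P s) v"])
        show "cubic_disc (B v v v) (3 * B (P s) v v) (3 * B (P s) (P s) v) (B (P s) (P s) (P s)) \<noteq> 0"
          using False D by simp
        fix t assume "B v v v * t^3 + 3 * B (P s) v v * t^2 + 3 * B (P s) (P s) v * t + B (P s) (P s) (P s) = 0"
        then have "B (P s + t *s v) (P s + t *s v) (P s + t *s v) = 0"
          by (simp add: cube_add algebra_simps)
        then have "B' (P s + t *s v) (P s + t *s v) (P s + t *s v) = 0" by (rule van)
        then show "B' v v v * t^3 + 3 * B' (P s) v v * t^2 + 3 * B' (P s) (P s) v * t + B' (P s) (P s) (P s) = 0"
          by (simp add: B'.cube_add algebra_simps)
      qed
      then show ?thesis by (simp add: E_def c0 c0')
    qed simp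
    then have "E * D = 0" using poly_all_0_iff_0 by blast
    moreover have "poly D 0 \<noteq> 0" using disc by (simp add: D P_def)
    then have "D \<noteq> 0" by auto
    ultimately have "poly E 1 = 0" by simp
    then show ?thesis by (simp add: E_def c0 c0' P_def d_def)
  qed
  show ?thesis
  proof (intro exI allI)
    fix p show "B' p p p = (B' v v v / B v v v) * B p p p"
      using main[of p] vne by (simp add: field_simps)
  qed
qed

end

section \<open>Polarization\<close>

lemma form_partial_derivative:
  fixes x :: "complex ^ 'n::finite"
  shows "((\<lambda>s. form_eval d c (x + s *s axis i 1)) has_field_derivative form_partial d c i x) (at 0)"
proof -
  have mono: "((\<lambda>s. c m * (\<Prod>j\<in>UNIV. ((x + s *s axis i 1) $ j) ^ m j)) has_field_derivative
      c m * of_nat (m i) * (\<Prod>j\<in>UNIV. (x $ j) ^ (m(i := m i - 1)) j)) (at 0)" for m :: "'n \<Rightarrow> nat"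
  proof -
    define R where "R = (\<Prod>j\<in>UNIV - {i}. (x $ j) ^ m j)"
    have 1: "(\<Prod>j\<in>UNIV. ((x + s *s axis i 1) $ j) ^ m j) = (x $ i + s) ^ m i * R" for s
    proof -
      have "(\<Prod>j\<in>UNIV - {i}. ((x + s *s axis i 1) $ j) ^ m j) = R"
        unfolding R_def by (rule prod.cong) (auto simp: axis_def)
      then show ?thesis by (subst prod.remove[of _ i]) (auto simp: axis_def)
    qed
    have "(\<Prod>j\<in>UNIV - {i}. (x $ j) ^ (m(i := m i - 1)) j) = R"
      unfolding R_def by (rule prod.cong) auto
    then have 2: "(\<Prod>j\<in>UNIV. (x $ j) ^ (m(i := m i - 1)) j) = (x $ i) ^ (m i - 1) * R"
      by (subst prod.remove[of _ i]) auto
    show ?thesis unfolding 1 2 by (auto intro!: derivative_eq_intros)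
  qed
  show ?thesis unfolding form_eval_def form_partial_def by (rule DERIV_sum) (rule mono)
qed

text \<open>The exponent vector of \<open>x\<^sub>i x\<^sub>j x\<^sub>k\<close>.\<close>

definition exponent3 :: "'n \<Rightarrow> 'n \<Rightarrow> 'n \<Rightarrow> 'n \<Rightarrow> nat" where
  "exponent3 i j k t = of_bool (t = i) + of_bool (t = j) + of_bool (t = k)"

lemma prod_of_bool:
  fixes x :: "'n::finite \<Rightarrow> complex"
  shows "(\<Prod>t\<in>UNIV. x t ^ of_bool (t = i)) = x i"
proof -
  have "(\<Prod>t\<in>UNIV. x t ^ of_bool (t = i)) = (\<Prod>t\<in>UNIV. if t = i then x t else 1)"
    by (rule prod.cong) auto
  then show ?thesis by simp
qed

lemma prod_exponent3:
  fixes x :: "'n::finite \<Rightarrow> complex"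
  shows "(\<Prod>t\<in>UNIV. x t ^ exponent3 i j k t) = x i * x j * x k"
  by (simp add: exponent3_def power_add prod.distrib prod_of_bool)

lemma sum_exponent3: "(\<Sum>t\<in>(UNIV :: 'n::finite set). exponent3 i j k t) = 3"
  by (simp add: exponent3_def sum.distrib)

lemma sum_decrease:
  fixes m :: "'n::finite \<Rightarrow> nat"
  assumes "sum m UNIV = Suc d"
  obtains i m' where "sum m' UNIV = d" "m = (\<lambda>t. of_bool (t = i) + m' t)"
proof -
  have "\<exists>i. m i \<noteq> 0"
  proof (rule ccontr)
    assume "\<not> ?thesis"
    then have "sum m UNIV = 0" by simp
    then show False using assms by simp
  qed
  then obtain i where i: "m i \<noteq> 0" by blast
  define m' where "m' = m(i := m i - 1)"
  have m: "m = (\<lambda>t. of_bool (t = i) + m' t)" using i by (auto simp: m'_def)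
  have "sum m UNIV = 1 + sum m' UNIV" by (subst m) (simp add: sum.distrib)
  then show ?thesis using that m assms by simp
qed

lemma exponents_3: "exponents 3 = range (\<lambda>(i, j, k). exponent3 i j (k :: 'n::finite))"
proof (intro equalityI subsetI)
  fix m :: "'n \<Rightarrow> nat" assume "m \<in> exponents 3"
  then have "sum m UNIV = Suc 2" by (simp add: exponents_def)
  then obtain i m1 where 1: "sum m1 UNIV = 2" "m = (\<lambda>t. of_bool (t = i) + m1 t)" by (rule sum_decrease)
  from 1(1) have "sum m1 UNIV = Suc 1" by simp
  then obtain j m2 where 2: "sum m2 UNIV = 1" "m1 = (\<lambda>t. of_bool (t = j) + m2 t)" by (rule sum_decrease)
  from 2(1) have "sum m2 UNIV = Suc 0" by simp
  then obtain k m3 where 3: "sum m3 UNIV = 0" "m2 = (\<lambda>t. of_bool (t = k) + m3 t)" by (rule sum_decrease)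
  have "m = exponent3 i j k" using 1(2) 2(2) 3 by (auto simp: exponent3_def)
  then show "m \<in> range (\<lambda>(i, j, k). exponent3 i j k)"
    by (intro image_eqI[of _ _ "(i, j, k)"]) auto
qed (auto simp: exponents_def sum_exponent3)

lemma exponent3_sym: "exponent3 i j k = exponent3 j i k" "exponent3 i j k = exponent3 i k j"
  by (auto simp: exponent3_def)

text \<open>Each coefficient is distributed evenly over the \<open>N m\<close> ordered triples of indices with exponent vector \<open>m\<close>.\<close>

theorem polarization:
  fixes c :: "('n::finite \<Rightarrow> nat) \<Rightarrow> complex"
  shows "\<exists>B. sym_trilinear B \<and> (\<forall>x. form_eval 3 c x = B x x x) \<and>
    (\<forall>i x. form_partial 3 c i x = 3 * B x x (axis i 1))"
proof -
  define N where "N m = card {p :: 'n \<times> 'n \<times> 'n. (case p of (i, j, k) \<Rightarrow> exponent3 i j k) = m}" for m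
  define a where "a i j k = c (exponent3 i j k) / of_nat (N (exponent3 i j k))" for i j k
  define B where "B x y z = (\<Sum>i\<in>UNIV. \<Sum>j\<in>UNIV. \<Sum>k\<in>UNIV. a i j k * (x $ i) * (y $ j) * (z $ k))"
    for x y z :: "complex ^ 'n"
  have a_sym: "a i j k = a j i k" "a i j k = a i k j" for i j k
    unfolding a_def by (metis exponent3_sym(1)) (metis exponent3_sym(2))
  interpret B: sym_trilinear B
  proof
    fix x y z x' :: "complex ^ 'n" and r :: complex
    have "B x y z = (\<Sum>j\<in>UNIV. \<Sum>i\<in>UNIV. \<Sum>k\<in>UNIV. a i j k * (x $ i) * (y $ j) * (z $ k))"
      unfolding B_def by (rule sum.swap)
    also have "\<dots> = B y x z" unfolding B_def
      by (intro sum.cong refl) (metis a_sym(1) mult.assoc mult.commute)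
    finally show "B x y z = B y x z" .
    have "B x y z = (\<Sum>i\<in>UNIV. \<Sum>k\<in>UNIV. \<Sum>j\<in>UNIV. a i j k * (x $ i) * (y $ j) * (z $ k))"
      unfolding B_def by (rule sum.cong[OF refl], rule sum.swap)
    also have "\<dots> = B x z y" unfolding B_def
      by (intro sum.cong refl) (metis a_sym(2) mult.assoc mult.commute)
    finally show "B x y z = B x z y" .
    show "B (x + x') y z = B x y z + B x' y z"
      by (simp add: B_def algebra_simps sum.distrib)
    show "B (r *s x) y z = r * B x y z"
      by (simp add: B_def sum_distrib_left mult_ac)
  qed
  have eval: "form_eval 3 c x = B x x x" for x
  proof -
    let ?e = "\<lambda>(i, j, k). exponent3 i j (k :: 'n)"
    have fin: "finite (exponents 3 :: ('n \<Rightarrow> nat) set)" unfolding exponents_3 by simp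
    have "B x x x = (\<Sum>(i, j, k)\<in>UNIV. a i j k * (x $ i) * (x $ j) * (x $ k))"
      unfolding B_def by (simp add: sum.cartesian_product)
    also have "\<dots> = (\<Sum>p\<in>UNIV. c (?e p) / of_nat (N (?e p)) * (\<Prod>t\<in>UNIV. (x $ t) ^ ?e p t))"
      by (intro sum.cong refl) (auto simp: a_def prod_exponent3 mult_ac)
    also have "\<dots> = (\<Sum>m\<in>exponents 3. \<Sum>p | p \<in> UNIV \<and> ?e p = m. c (?e p) / of_nat (N (?e p)) * (\<Prod>t\<in>UNIV. (x $ t) ^ ?e p t))"
      using fin by (intro sum.group[symmetric]) (auto simp: exponents_3)
    also have "\<dots> = (\<Sum>m\<in>exponents 3. c m * (\<Prod>t\<in>UNIV. (x $ t) ^ m t))"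
    proof (rule sum.cong[OF refl])
      fix m :: "'n \<Rightarrow> nat" assume m: "m \<in> exponents 3"
      have "(\<Sum>p | p \<in> UNIV \<and> ?e p = m. c (?e p) / of_nat (N (?e p)) * (\<Prod>t\<in>UNIV. (x $ t) ^ ?e p t))
        = (\<Sum>p | p \<in> UNIV \<and> ?e p = m. c m / of_nat (N m) * (\<Prod>t\<in>UNIV. (x $ t) ^ m t))"
        by (intro sum.cong refl) auto
      also have "\<dots> = of_nat (N m) * (c m / of_nat (N m) * (\<Prod>t\<in>UNIV. (x $ t) ^ m t))"
        by (simp add: N_def)
      also have "N m \<noteq> 0"
        using m unfolding N_def exponents_3 by (auto simp: card_eq_0_iff)
      then have "of_nat (N m) * (c m / of_nat (N m) * (\<Prod>t\<in>UNIV. (x $ t) ^ m t)) = c m * (\<Prod>t\<in>UNIV. (x $ t) ^ m t)"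
        by simp
      finally show "(\<Sum>p | p \<in> UNIV \<and> ?e p = m. c (?e p) / of_nat (N (?e p)) * (\<Prod>t\<in>UNIV. (x $ t) ^ ?e p t))
        = c m * (\<Prod>t\<in>UNIV. (x $ t) ^ m t)" .
    qed
    finally show ?thesis by (simp add: form_eval_def)
  qed
  have "form_partial 3 c i x = 3 * B x x (axis i 1)" for i x
  proof -
    have "((\<lambda>s. B (x + s *s axis i 1) (x + s *s axis i 1) (x + s *s axis i 1))
        has_field_derivative 3 * B x x (axis i 1)) (at 0)"
      unfolding B.cube_add by (auto intro!: derivative_eq_intros)
    moreover have "((\<lambda>s. B (x + s *s axis i 1) (x + s *s axis i 1) (x + s *s axis i 1))
        has_field_derivative form_partial 3 c i x) (at 0)"
      using form_partial_derivative[of 3 c x i] by (simp add: eval)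
    ultimately show ?thesis by (rule DERIV_unique[symmetric])
  qed
  then show ?thesis using eval B.sym_trilinear_axioms by blast
qed

lemma smooth_trilinear_of_form:
  fixes c :: "('n::finite \<Rightarrow> nat) \<Rightarrow> complex"
  assumes "smooth_form 3 c"
  shows "\<exists>B. smooth_trilinear B \<and> (\<forall>x. form_eval 3 c x = B x x x)"
proof -
  obtain B where B: "sym_trilinear B" "\<forall>x. form_eval 3 c x = B x x x"
    "\<forall>i x. form_partial 3 c i x = 3 * B x x (axis i 1)" using polarization by blast
  have "smooth_trilinear B"
  proof (intro smooth_trilinear.intro smooth_trilinear_axioms.intro B(1))
    fix x :: "complex ^ 'n" assume x: "x \<noteq> 0"
    show "\<exists>v. B x x v \<noteq> 0"
      using assms x B(2,3) unfolding smooth_form_def by (metis mult_zero_right)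
  qed
  then show ?thesis using B(2) by blast
qed

section \<open>Simultaneous diagonalization\<close>

lemma common_eigenbasis:
  fixes F :: "(complex ^ 'n::finite \<Rightarrow> complex ^ 'n) set"
  assumes "finite F"
    and add: "\<And>f x y. f \<in> F \<Longrightarrow> f (x + y) = f x + f y"
    and hom: "\<And>f c x. f \<in> F \<Longrightarrow> f (c *s x) = c *s f x"
    and fin: "\<And>f. f \<in> F \<Longrightarrow> \<exists>n>0. f ^^ n = id"
    and comm: "\<And>f g x. f \<in> F \<Longrightarrow> g \<in> F \<Longrightarrow> f (g x) = g (f x)"
  shows "\<exists>b :: 'n \<Rightarrow> complex ^ 'n. (\<forall>c. (\<Sum>i\<in>UNIV. c i *s b i) = 0 \<longrightarrow> (\<forall>i. c i = 0)) \<and>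
    (\<forall>v. \<exists>c. v = (\<Sum>i\<in>UNIV. c i *s b i)) \<and> (\<forall>f\<in>F. \<forall>i. \<exists>c. f (b i) = c *s b i)"
proof -
  define V where "V = {w. \<forall>f\<in>F. \<exists>c. f w = c *s w}"
  have "v \<in> vec.span V" for v
    unfolding V_def
    by (rule common_eigenvectors_span[OF vec.vector_space_axioms \<open>finite F\<close>])
      (erule add, erule hom, erule fin, erule (1) comm)
  then have spanV: "vec.span V = UNIV" by auto
  obtain B where B: "B \<subseteq> V" "vec.independent B" "V \<subseteq> vec.span B" using vec.maximal_independent_subset by blast
  have spanB: "vec.span B = UNIV" using spanV B(3) vec.span_minimal[OF B(3) vec.subspace_span] by auto
  have finB: "finite B" using B(2) by (rule vec.finiteI_independent)
  have "card B = CARD('n)" using vec.dim_eq_card[of B UNIV] spanB B(2) vec_dim_card[where 'a = complex and 'n = 'n] by simp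
  then obtain b where b: "bij_betw b (UNIV :: 'n set) B"
    using finB finite_same_card_bij[of "UNIV :: 'n set" B] by auto
  have reindex: "(\<Sum>i\<in>UNIV. u (b i) *s b i) = (\<Sum>v\<in>B. u v *s v)" for u
    using sum.reindex_bij_betw[OF b, of "\<lambda>v. u v *s v"] .
  show ?thesis
  proof (intro exI[of _ b] conjI allI impI ballI)
    fix c :: "'n \<Rightarrow> complex" and i assume 0: "(\<Sum>i\<in>UNIV. c i *s b i) = 0"
    define u where "u v = c (inv_into UNIV b v)" for v
    have ub: "u (b i) = c i" for i using b by (simp add: u_def bij_betw_def)
    have "(\<Sum>v\<in>B. u v *s v) = 0" using reindex[of u] 0 by (simp add: ub)
    then have "u v = 0" if "v \<in> B" for v using vec.independentD[OF B(2) finB order_refl _ that] by blast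
    then show "c i = 0" using ub b by (metis bij_betwE UNIV_I)
  next
    fix v
    have "v \<in> range (\<lambda>u. \<Sum>v\<in>B. u v *s v)" using vec.span_finite[OF finB] spanB by auto
    then obtain u where "v = (\<Sum>v\<in>B. u v *s v)" by blast
    then show "\<exists>c. v = (\<Sum>i\<in>UNIV. c i *s b i)" using reindex[of u] by (intro exI[of _ "\<lambda>i. u (b i)"]) simp
  next
    fix f i assume "f \<in> F"
    have "b i \<in> V" using b B(1) by (auto simp: bij_betw_def)
    then show "\<exists>c. f (b i) = c *s b i" using \<open>f \<in> F\<close> by (auto simp: V_def)
  qed
qed

section \<open>Projective representations preserving a smooth cubic form\<close>

text \<open>Lifts of an abelian group of projective transformations which leave the smooth cubic form invariant. Two lifts of the
  same element differ by a cube root of unity, which is where the factor in \<open>\<rho>_mult\<close> comes from.\<close>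

locale cubic_representation = smooth_trilinear B + comm_group G
  for B :: "complex ^ 'n::finite \<Rightarrow> complex ^ 'n \<Rightarrow> complex ^ 'n \<Rightarrow> complex"
    and G :: "('a, 'b) monoid_scheme" (structure) +
  fixes \<rho> :: "'a \<Rightarrow> complex ^ 'n \<Rightarrow> complex ^ 'n"
  assumes finG: "finite (carrier G)" and cardn: "CARD('n) = 6"
    and \<rho>_add: "g \<in> carrier G \<Longrightarrow> \<rho> g (x + y) = \<rho> g x + \<rho> g y"
    and \<rho>_scale: "g \<in> carrier G \<Longrightarrow> \<rho> g (c *s x) = c *s \<rho> g x"
    and \<rho>_B: "g \<in> carrier G \<Longrightarrow> B (\<rho> g x) (\<rho> g y) (\<rho> g z) = B x y z"
    and \<rho>_mult: "g \<in> carrier G \<Longrightarrow> h \<in> carrier G \<Longrightarrow> \<exists>c. c ^ 3 = 1 \<and> (\<forall>x. \<rho> g (\<rho> h x) = c *s \<rho> (g \<otimes> h) x)"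
    and \<rho>_faithful: "g \<in> carrier G \<Longrightarrow> (\<And>x. \<rho> g x = c *s x) \<Longrightarrow> g = \<one>"
begin

lemma \<rho>_nonzero: assumes "g \<in> carrier G" "x \<noteq> 0" shows "\<rho> g x \<noteq> 0"
proof
  assume 0: "\<rho> g x = 0"
  have B0: "B 0 y z = 0" for y z using scale1[of 0 0 y z] by simp
  from smooth[OF assms(2)] obtain v where "B x x v \<noteq> 0" by blast
  then show False using \<rho>_B[OF assms(1), of x x v] 0 B0 by simp
qed

lemma scale_inj: assumes "c *s x = d *s (x :: complex ^ 'n)" "x \<noteq> 0" shows "c = d"
  using assms by simp

lemma \<rho>_one: "\<exists>c. c ^ 3 = 1 \<and> (\<forall>x. \<rho> \<one> x = c *s x)"
proof -
  from \<rho>_mult[OF one_closed one_closed] obtain c where c: "c ^ 3 = 1" "\<And>x. \<rho> \<one> (\<rho> \<one> x) = c *s \<rho> \<one> x" by auto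
  have "\<rho> \<one> x = c *s x" for x
  proof (rule ccontr)
    assume "\<rho> \<one> x \<noteq> c *s x"
    then have "\<rho> \<one> x + (- c) *s x \<noteq> 0" by (simp add: vec_eq_iff)
    then have "\<rho> \<one> (\<rho> \<one> x + (- c) *s x) \<noteq> 0" by (rule \<rho>_nonzero[OF one_closed])
    moreover have "\<rho> \<one> (\<rho> \<one> x + (- c) *s x) = c *s \<rho> \<one> x + (- c) *s \<rho> \<one> x"
      by (simp only: \<rho>_add[OF one_closed] \<rho>_scale[OF one_closed] c(2))
    moreover have "\<dots> = 0" by (simp add: vec_eq_iff)
    ultimately show False by metis
  qed
  then show ?thesis using c(1) by blast
qed

lemma \<rho>_power: assumes "g \<in> carrier G" shows "\<exists>c. c ^ 3 = 1 \<and> (\<forall>x. (\<rho> g ^^ n) x = c *s \<rho> (g [^] n) x)"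
proof (induction n)
  case 0
  obtain c where c: "c ^ 3 = 1" "\<And>x. \<rho> \<one> x = c *s x" using \<rho>_one by blast
  have "inverse c ^ 3 = 1" using c(1) by (simp add: power_inverse)
  moreover have "c \<noteq> 0" using c(1) by auto
  then have "x = inverse c *s \<rho> \<one> x" for x using c(2)[of x] by simp
  ultimately show ?case by auto
next
  case (Suc n)
  then obtain c where c: "c ^ 3 = 1" "\<And>x. (\<rho> g ^^ n) x = c *s \<rho> (g [^] n) x" by blast
  have gn: "g [^] n \<in> carrier G" using assms by simp
  from \<rho>_mult[OF assms gn] obtain d where d: "d ^ 3 = 1" "\<And>x. \<rho> g (\<rho> (g [^] n) x) = d *s \<rho> (g \<otimes> g [^] n) x" by blast
  have "g \<otimes> g [^] n = g [^] Suc n" using assms by (simp add: m_comm)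
  then have "(\<rho> g ^^ Suc n) x = (c * d) *s \<rho> (g [^] Suc n) x" for x
    using c(2) d(2) assms by (simp add: \<rho>_scale)
  moreover have "(c * d) ^ 3 = 1" using c(1) d(1) by (simp add: power_mult_distrib)
  ultimately show ?case by blast
qed

lemma \<rho>_finite_order: assumes "g \<in> carrier G" shows "\<exists>n>0. \<rho> g ^^ n = id"
proof -
  obtain c where c: "c ^ 3 = 1" "\<And>x. (\<rho> g ^^ Coset.order G) x = c *s \<rho> (g [^] Coset.order G) x" using \<rho>_power[OF assms] by blast
  obtain d where d: "d ^ 3 = 1" "\<And>x. \<rho> \<one> x = d *s x" using \<rho>_one by blast
  have s: "(\<rho> g ^^ Coset.order G) x = (c * d) *s x" for x using c(2) d(2) pow_order_eq_1[OF assms] by simp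
  have "(\<rho> g ^^ (Coset.order G + Coset.order G + Coset.order G)) x = ((c * d) ^ 3) *s x" for x
    by (simp only: funpow_add o_apply s) (simp add: power3_eq_cube vec_eq_iff)
  then have "\<rho> g ^^ (Coset.order G + Coset.order G + Coset.order G) = id"
    using c(1) d(1) by (simp add: power_mult_distrib fun_eq_iff)
  moreover have "Coset.order G > 0" using finG by (simp add: order_gt_0_iff_finite)
  ultimately show ?thesis by (metis add_gr_0)
qed

lemma commutator_ex:
  assumes "g \<in> carrier G" "h \<in> carrier G" shows "\<exists>c. c ^ 3 = 1 \<and> (\<forall>x. \<rho> g (\<rho> h x) = c *s \<rho> h (\<rho> g x))"
proof -
  from \<rho>_mult[OF assms] obtain c where c: "c ^ 3 = 1" "\<And>x. \<rho> g (\<rho> h x) = c *s \<rho> (g \<otimes> h) x" by blast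
  from \<rho>_mult[OF assms(2,1)] obtain d where d: "d ^ 3 = 1" "\<And>x. \<rho> h (\<rho> g x) = d *s \<rho> (h \<otimes> g) x" by blast
  have "d \<noteq> 0" using d(1) by auto
  then have "\<rho> g (\<rho> h x) = (c / d) *s \<rho> h (\<rho> g x)" for x
    using c(2)[of x] d(2)[of x] m_comm[OF assms] by (simp add: vec_eq_iff)
  moreover have "(c / d) ^ 3 = 1" using c(1) d(1) by (simp add: power_divide)
  ultimately show ?thesis by blast
qed

text \<open>The commutator pairing. It is alternating and multiplicative in both arguments.\<close>

definition \<kappa> :: "'a \<Rightarrow> 'a \<Rightarrow> complex" where
  "\<kappa> g h = (SOME c. c ^ 3 = 1 \<and> (\<forall>x. \<rho> g (\<rho> h x) = c *s \<rho> h (\<rho> g x)))"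

lemma \<kappa>:
  assumes "g \<in> carrier G" "h \<in> carrier G"
  shows "\<kappa> g h ^ 3 = 1" "\<rho> g (\<rho> h x) = \<kappa> g h *s \<rho> h (\<rho> g x)"
  using someI_ex[OF commutator_ex[OF assms]] unfolding \<kappa>_def by blast+

lemma nonzero_vector: "\<exists>x :: complex ^ 'n. x \<noteq> 0"
  by (rule exI[of _ "axis undefined 1"]) (simp add: axis_eq_0_iff)

lemma \<kappa>_mult:
  assumes "a \<in> carrier G" "g \<in> carrier G" "h \<in> carrier G" shows "\<kappa> a (g \<otimes> h) = \<kappa> a g * \<kappa> a h"
proof -
  from \<rho>_mult[OF assms(2,3)] obtain c where c: "c ^ 3 = 1" "\<And>x. \<rho> g (\<rho> h x) = c *s \<rho> (g \<otimes> h) x" by blast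
  obtain x :: "complex ^ 'n" where x: "x \<noteq> 0" using nonzero_vector by blast
  have c0: "c \<noteq> 0" using c(1) by auto
  have gh: "g \<otimes> h \<in> carrier G" using assms by simp
  have "c *s \<rho> a (\<rho> (g \<otimes> h) x) = \<rho> a (\<rho> g (\<rho> h x))" using c(2)[of x] \<rho>_scale[OF assms(1)] by simp
  also have "\<dots> = \<kappa> a g *s \<rho> g (\<rho> a (\<rho> h x))" by (rule \<kappa>(2)[OF assms(1,2)])
  also have "\<dots> = (\<kappa> a g * \<kappa> a h) *s \<rho> g (\<rho> h (\<rho> a x))"
    by (subst \<kappa>(2)[OF assms(1,3)]) (simp add: \<rho>_scale[OF assms(2)])
  also have "\<dots> = (\<kappa> a g * \<kappa> a h * c) *s \<rho> (g \<otimes> h) (\<rho> a x)" using c(2)[of "\<rho> a x"] by simp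
  finally have "(c * \<kappa> a (g \<otimes> h)) *s \<rho> (g \<otimes> h) (\<rho> a x) = (\<kappa> a g * \<kappa> a h * c) *s \<rho> (g \<otimes> h) (\<rho> a x)"
    by (subst (asm) \<kappa>(2)[OF assms(1) gh]) simp
  then have "c * \<kappa> a (g \<otimes> h) = \<kappa> a g * \<kappa> a h * c"
    by (rule scale_inj) (use \<rho>_nonzero assms x gh in blast)
  then show ?thesis using c0 by simp
qed

lemma character_\<kappa>: assumes "a \<in> carrier G" shows "character G (\<kappa> a)"
  unfolding character_def
proof (intro conjI ballI)
  fix g assume "g \<in> carrier G"
  then show "\<kappa> a g \<noteq> 0" using \<kappa>(1)[OF assms, of g] by auto
qed (use \<kappa>_mult[OF assms] in blast)

definition eigenbasis :: "'a set \<Rightarrow> ('n \<Rightarrow> complex ^ 'n) \<Rightarrow> ('a \<Rightarrow> 'n \<Rightarrow> complex) \<Rightarrow> bool" where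
  "eigenbasis Y b t \<longleftrightarrow> (\<forall>c. (\<Sum>i\<in>UNIV. c i *s b i) = 0 \<longrightarrow> (\<forall>i. c i = 0)) \<and>
     (\<forall>v. \<exists>c. v = (\<Sum>i\<in>UNIV. c i *s b i)) \<and> (\<forall>g\<in>Y. \<forall>i. \<rho> g (b i) = t g i *s b i)"

lemma eigenbasis_ex:
  assumes Y: "Y \<subseteq> carrier G" and comm: "\<And>g h. g \<in> Y \<Longrightarrow> h \<in> Y \<Longrightarrow> \<kappa> g h = 1"
  shows "\<exists>b t. eigenbasis Y b t"
proof -
  have "\<exists>b :: 'n \<Rightarrow> complex ^ 'n. (\<forall>c. (\<Sum>i\<in>UNIV. c i *s b i) = 0 \<longrightarrow> (\<forall>i. c i = 0)) \<and>
    (\<forall>v. \<exists>c. v = (\<Sum>i\<in>UNIV. c i *s b i)) \<and> (\<forall>f\<in>\<rho> ` Y. \<forall>i. \<exists>c. f (b i) = c *s b i)"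
  proof (rule common_eigenbasis)
    show "finite (\<rho> ` Y)" using finG Y finite_subset by blast
    show "f (g x) = g (f x)" if fg: "f \<in> \<rho> ` Y" "g \<in> \<rho> ` Y" for f g x
    proof -
      from fg obtain p q where pq: "p \<in> Y" "q \<in> Y" "f = \<rho> p" "g = \<rho> q" by blast
      then show ?thesis using \<kappa>(2)[of p q x] comm[OF pq(1,2)] Y by auto
    qed
    show "\<exists>n>0. f ^^ n = id" if "f \<in> \<rho> ` Y" for f using that \<rho>_finite_order Y by blast
    show "f (x + y) = f x + f y" if "f \<in> \<rho> ` Y" for f x y using that \<rho>_add Y by blast
    show "f (c *s x) = c *s f x" if "f \<in> \<rho> ` Y" for f c x using that \<rho>_scale Y by blast
  qed
  then obtain b :: "'n \<Rightarrow> complex ^ 'n" where b: "\<forall>c. (\<Sum>i\<in>UNIV. c i *s b i) = 0 \<longrightarrow> (\<forall>i. c i = 0)"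
    "\<forall>v. \<exists>c. v = (\<Sum>i\<in>UNIV. c i *s b i)" "\<forall>f\<in>\<rho> ` Y. \<forall>i. \<exists>c. f (b i) = c *s b i" by blast
  have "\<exists>t. \<forall>g\<in>Y. \<forall>i. \<rho> g (b i) = t g i *s b i"
  proof -
    have "\<exists>c. \<rho> g (b i) = c *s b i" if "g \<in> Y" for g i using b(3) that by blast
    then show ?thesis by metis
  qed
  then show ?thesis using b(1,2) unfolding eigenbasis_def by blast
qed

lemma eigenbasis_indep: "eigenbasis Y b t \<Longrightarrow> (\<Sum>i\<in>UNIV. c i *s b i) = 0 \<Longrightarrow> c i = 0"
  unfolding eigenbasis_def by (elim conjE allE[of _ c]) simp

lemma eigenbasis_nonzero: assumes "eigenbasis Y b t" shows "b i \<noteq> 0"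
proof
  assume 0: "b i = 0"
  have "(\<Sum>j\<in>UNIV. (if j = i then 1 else 0) *s b j) = 0"
    by (rule sum.neutral) (use 0 in auto)
  from eigenbasis_indep[OF assms this, of i] show False by simp
qed

lemma eigenbasis_expand:
  assumes e: "eigenbasis Y b t" and Y: "Y \<subseteq> carrier G"
  obtains c where "x = (\<Sum>i\<in>UNIV. c i *s b i)" "\<forall>g\<in>Y. \<rho> g x = (\<Sum>i\<in>UNIV. (c i * t g i) *s b i)"
proof -
  obtain c where c: "x = (\<Sum>i\<in>UNIV. c i *s b i)" using e unfolding eigenbasis_def by blast
  have "\<rho> g x = (\<Sum>i\<in>UNIV. (c i * t g i) *s b i)" if g: "g \<in> Y" for g
  proof -
    have gG: "g \<in> carrier G" using g Y by blast
    have t: "\<rho> g (b i) = t g i *s b i" for i using e g unfolding eigenbasis_def by blast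
    have "\<rho> g (\<Sum>i\<in>A. c i *s b i) = (\<Sum>i\<in>A. (c i * t g i) *s b i)" if "A \<noteq> {}" for A :: "'n set"
      using finite[of A] that
      by (induction A rule: finite_ne_induct) (auto simp: \<rho>_add[OF gG] \<rho>_scale[OF gG] t)
    then show ?thesis unfolding c by simp
  qed
  then show thesis using that c by blast
qed

lemma scalar_if_eigenvalues_equal:
  assumes e: "eigenbasis Y b t" and Y: "Y \<subseteq> carrier G" and g: "g \<in> Y" and eq: "\<And>i. t g i = c"
  shows "g = \<one>"
proof (rule \<rho>_faithful)
  fix x
  obtain d where d: "x = (\<Sum>i\<in>UNIV. d i *s b i)" "\<forall>g\<in>Y. \<rho> g x = (\<Sum>i\<in>UNIV. (d i * t g i) *s b i)"
    using eigenbasis_expand[OF e Y] by blast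
  have "\<rho> g x = (\<Sum>i\<in>UNIV. (d i * c) *s b i)" using d(2) g by (simp add: eq)
  also have "\<dots> = (\<Sum>i\<in>UNIV. c *s (d i *s b i))" by (simp add: mult.commute)
  also have "\<dots> = c *s x" unfolding d(1) by (rule vec.scale_sum_right[symmetric])
  finally show "\<rho> g x = c *s x" .
qed (use g Y in blast)

text \<open>A joint eigenvector has a nonzero coordinate, and the weight of that basis vector is the weight of the eigenvector.\<close>

lemma eigenvector_index:
  assumes e: "eigenbasis Y b t" and Y: "Y \<subseteq> carrier G" and v: "v \<noteq> 0" "\<And>g. g \<in> Y \<Longrightarrow> \<rho> g v = \<nu> g *s v"
  shows "\<exists>i. \<forall>g\<in>Y. t g i = \<nu> g"
proof -
  obtain c where c: "v = (\<Sum>i\<in>UNIV. c i *s b i)" "\<forall>g\<in>Y. \<rho> g v = (\<Sum>i\<in>UNIV. (c i * t g i) *s b i)"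
    using eigenbasis_expand[OF e Y] by blast
  have "\<exists>i. c i \<noteq> 0"
  proof (rule ccontr)
    assume "\<not> ?thesis"
    then have "v = 0" using c(1) by simp
    then show False using v(1) by simp
  qed
  then obtain i where i: "c i \<noteq> 0" by blast
  have "t g i = \<nu> g" if g: "g \<in> Y" for g
  proof -
    have "(\<Sum>i\<in>UNIV. (c i * t g i - \<nu> g * c i) *s b i) = \<rho> g v - \<nu> g *s v"
    proof -
      have "\<nu> g *s v = (\<Sum>i\<in>UNIV. (\<nu> g * c i) *s b i)" unfolding c(1) by (simp add: vec.scale_sum_right)
      then show ?thesis using c(2) g by (simp add: vec.scale_left_diff_distrib sum_subtractf)
    qed
    then have "(\<Sum>i\<in>UNIV. (c i * t g i - \<nu> g * c i) *s b i) = 0" using v(2)[OF g] by simp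
    then have "c i * t g i - \<nu> g * c i = 0" by (rule eigenbasis_indep[OF e])
    then show ?thesis using i by (simp add: mult.commute)
  qed
  then show ?thesis by blast
qed

lemma eigenbasis_monomial:
  assumes e: "eigenbasis Y b t" and "card U \<le> 2" "card U < card S"
  shows "\<exists>i\<in>S. \<exists>k\<in>S. \<exists>l. l \<notin> U \<and> B (b i) (b k) (b l) \<noteq> 0"
  by (rule monomial_exists) (use assms in \<open>auto simp: eigenbasis_def\<close>)

lemma eigenbasis_invariant:
  assumes e: "eigenbasis Y b t" and g: "g \<in> Y" "g \<in> carrier G" and nz: "B (b i) (b j) (b k) \<noteq> 0"
  shows "t g i * t g j * t g k = 1"
proof -
  have t: "\<rho> g (b i) = t g i *s b i" for i using e g unfolding eigenbasis_def by blast
  have "B (b i) (b j) (b k) = t g i * t g j * t g k * B (b i) (b j) (b k)"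
    using \<rho>_B[OF g(2), of "b i" "b j" "b k"] by (simp add: t expand mult_ac)
  then show ?thesis using nz by simp
qed

lemma commuting_case:
  assumes comm: "\<And>g h. g \<in> carrier G \<Longrightarrow> h \<in> carrier G \<Longrightarrow> \<kappa> g h = 1"
  shows "\<exists>ns\<in>fourfold_types. embeds_in G (mset ns)"
proof -
  obtain b t where e: "eigenbasis (carrier G) b t" using eigenbasis_ex comm by blast
  have t: "\<rho> g (b i) = t g i *s b i" if "g \<in> carrier G" for g i using e that unfolding eigenbasis_def by blast
  interpret D: diagonal_action G t "\<lambda>i j k. B (b i) (b j) (b k) \<noteq> 0"
  proof
    show "finite (carrier G)" by (rule finG)
    show "CARD('n) = 6" by (rule cardn)
    show "t g i * t g j * t g k = 1" if "g \<in> carrier G" "B (b i) (b j) (b k) \<noteq> 0" for g i j k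
      by (rule eigenbasis_invariant[OF e that(1) that])
    show "\<exists>c. c ^ 3 = 1 \<and> (\<forall>i. t (g \<otimes> h) i = c * t g i * t h i)" if gh: "g \<in> carrier G" "h \<in> carrier G" for g h
    proof -
      from \<rho>_mult[OF gh] obtain c where c: "c ^ 3 = 1" "\<And>x. \<rho> g (\<rho> h x) = c *s \<rho> (g \<otimes> h) x" by blast
      have c0: "c \<noteq> 0" using c(1) by auto
      have "t (g \<otimes> h) i = inverse c * t g i * t h i" for i
      proof -
        have "(t h i * t g i) *s b i = (c * t (g \<otimes> h) i) *s b i"
          using c(2)[of "b i"] gh by (simp add: t \<rho>_scale)
        then have "t h i * t g i = c * t (g \<otimes> h) i" using eigenbasis_nonzero[OF e] by (rule scale_inj)
        then show ?thesis using c0 by (simp add: field_simps)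
      qed
      moreover have "inverse c ^ 3 = 1" using c(1) by (simp add: power_inverse)
      ultimately show ?thesis by blast
    qed
    show "g = \<one>" if g: "g \<in> carrier G" and eq: "\<And>i j. t g i = t g j" for g
      by (rule scalar_if_eigenvalues_equal[OF e order_refl g eq])
    show "\<exists>i\<in>S. \<exists>k\<in>S. \<exists>l. l \<notin> U \<and> B (b i) (b k) (b l) \<noteq> 0" if "card U \<le> 2" "card U < card S" for U S
      by (rule eigenbasis_monomial[OF e that])
  qed
  show ?thesis by (rule D.embeds_in_fourfold_type)
qed

lemma \<kappa>_swap: assumes "g \<in> carrier G" "h \<in> carrier G" shows "\<kappa> g h * \<kappa> h g = 1"
proof -
  obtain x :: "complex ^ 'n" where x: "x \<noteq> 0" using nonzero_vector by blast
  have "1 *s \<rho> g (\<rho> h x) = (\<kappa> g h * \<kappa> h g) *s \<rho> g (\<rho> h x)"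
    using \<kappa>(2)[OF assms, of x] \<kappa>(2)[OF assms(2,1), of x] by simp
  then have "1 = \<kappa> g h * \<kappa> h g" by (rule scale_inj) (use \<rho>_nonzero assms x in blast)
  then show ?thesis by simp
qed

lemma \<kappa>_self: assumes "g \<in> carrier G" shows "\<kappa> g g = 1"
proof -
  obtain x :: "complex ^ 'n" where x: "x \<noteq> 0" using nonzero_vector by blast
  have "1 *s \<rho> g (\<rho> g x) = \<kappa> g g *s \<rho> g (\<rho> g x)" using \<kappa>(2)[OF assms assms, of x] by simp
  then have "1 = \<kappa> g g" by (rule scale_inj) (use \<rho>_nonzero assms x in blast)
  then show ?thesis by simp
qed

text \<open>Applying \<open>\<rho> q\<close> to an eigenvector of \<open>\<rho> p\<close> multiplies its eigenvalue by a primitive cube root of unity but does not change its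
  weight for \<open>Y\<close>, since \<open>\<rho> q\<close> commutes with \<open>Y\<close>. So every weight of \<open>Y\<close> occurs with three
  different eigenvalues of \<open>\<rho> p\<close>.\<close>

lemma eigenvector_class_size:
  assumes e: "eigenbasis (insert p Y) b t" and Y: "Y \<subseteq> carrier G" and pq: "p \<in> carrier G" "q \<in> carrier G" "\<kappa> p q \<noteq> 1"
    and Yq: "\<And>g. g \<in> Y \<Longrightarrow> \<kappa> g q = 1"
    and v: "v \<noteq> 0" "\<rho> p v = \<alpha> *s v" "\<And>g. g \<in> Y \<Longrightarrow> \<rho> g v = \<nu> g *s v"
  shows "card {i. \<forall>g\<in>Y. t g i = \<nu> g} \<ge> 3"
proof (cases "p \<in> Y")
  case True
  then show ?thesis using Yq pq by blast
next
  case False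
  define \<omega> where "\<omega> = \<kappa> p q"
  have \<omega>3: "\<omega> ^ 3 = 1" "\<omega> \<noteq> 1" using \<kappa>(1)[OF pq(1,2)] pq(3) by (auto simp: \<omega>_def)
  have pY: "insert p Y \<subseteq> carrier G" using Y pq by blast
  have \<alpha>0: "\<alpha> \<noteq> 0" using \<rho>_nonzero[OF pq(1) v(1)] v(2) by auto
  define P where "P w \<beta> \<longleftrightarrow> w \<noteq> 0 \<and> \<rho> p w = \<beta> *s w \<and> (\<forall>g\<in>Y. \<rho> g w = \<nu> g *s w)" for w \<beta>
  have step: "P (\<rho> q w) (\<omega> * \<beta>)" if "P w \<beta>" for w \<beta>
  proof -
    have "\<rho> p (\<rho> q w) = (\<omega> * \<beta>) *s \<rho> q w"
      using \<kappa>(2)[OF pq(1,2), of w] that \<rho>_scale[OF pq(2)] by (simp add: P_def \<omega>_def)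
    moreover have "\<rho> g (\<rho> q w) = \<nu> g *s \<rho> q w" if "g \<in> Y" for g
    proof -
      have "g \<in> carrier G" using that Y by blast
      then show ?thesis using \<kappa>(2)[of g q w] pq(2) Yq[OF that] \<open>P w \<beta>\<close> that \<rho>_scale[OF pq(2)] by (simp add: P_def)
    qed
    ultimately show ?thesis using \<rho>_nonzero[OF pq(2)] that by (simp add: P_def)
  qed
  have ex: "\<exists>i. t p i = \<beta> \<and> (\<forall>g\<in>Y. t g i = \<nu> g)" if "P w \<beta>" for w \<beta>
  proof -
    have "\<exists>i. \<forall>g\<in>insert p Y. t g i = (if g = p then \<beta> else \<nu> g)"
      by (rule eigenvector_index[OF e pY, of w]) (use that False in \<open>auto simp: P_def\<close>)
    then show ?thesis using False by auto
  qed
  have P0: "P v \<alpha>" using v by (simp add: P_def)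
  obtain i0 where i0: "t p i0 = \<alpha>" "\<forall>g\<in>Y. t g i0 = \<nu> g" using ex[OF P0] by blast
  obtain i1 where i1: "t p i1 = \<omega> * \<alpha>" "\<forall>g\<in>Y. t g i1 = \<nu> g" using ex[OF step[OF P0]] by blast
  obtain i2 where i2: "t p i2 = \<omega> * (\<omega> * \<alpha>)" "\<forall>g\<in>Y. t g i2 = \<nu> g" using ex[OF step[OF step[OF P0]]] by blast
  have \<omega>2: "\<omega> * \<omega> \<noteq> 1" "\<omega> \<noteq> 0" using \<omega>3 by (auto simp: power3_eq_cube)
  then have "i0 \<noteq> i1" "i0 \<noteq> i2" "i1 \<noteq> i2" using i0 i1 i2 \<alpha>0 \<omega>3 by auto
  then have "card {i0, i1, i2} = 3" by simp
  moreover have "{i0, i1, i2} \<subseteq> {i. \<forall>g\<in>Y. t g i = \<nu> g}" using i0 i1 i2 by auto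
  ultimately show ?thesis using card_mono[of "{i. \<forall>g\<in>Y. t g i = \<nu> g}" "{i0, i1, i2}"] by simp
qed

lemma three_classes:
  fixes A1 A2 A3 :: "'n set"
  assumes "card A1 \<ge> 3" "card A2 \<ge> 3" "card A3 \<ge> 3" "A1 \<inter> A2 = {}" "A1 \<inter> A3 = {}" "A2 \<inter> A3 = {}"
  shows False
proof -
  have "card (A1 \<union> A2 \<union> A3) = card A1 + card A2 + card A3"
    using assms by (subst card_Un_disjoint; auto simp: card_Un_disjoint)
  moreover have "card (A1 \<union> A2 \<union> A3) \<le> 6" using card_mono[of UNIV "A1 \<union> A2 \<union> A3"] cardn by simp
  ultimately show False using assms by linarith
qed

context
  fixes p q assumes p: "p \<in> carrier G" and q: "q \<in> carrier G" and pq: "\<kappa> p q \<noteq> 1"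
begin

text \<open>The common centralizer of \<open>p\<close> and \<open>q\<close> in the group generated by the lifts, modulo scalars.\<close>

definition Z :: "'a set" where "Z = {g \<in> carrier G. \<kappa> p g = 1 \<and> \<kappa> q g = 1}"

lemma Z_carrier: "Z \<subseteq> carrier G" by (auto simp: Z_def)

lemma Z_comm: assumes "g \<in> Z" shows "\<kappa> p g = 1" "\<kappa> g p = 1" "\<kappa> q g = 1" "\<kappa> g q = 1"
  using assms \<kappa>_swap[OF p, of g] \<kappa>_swap[OF q, of g] by (auto simp: Z_def)

text \<open>Two noncommuting elements of \<open>Z\<close> would produce three different weights, each of multiplicity at least three, in dimension
  six.\<close>

lemma Z_commutative: assumes gh: "g \<in> Z" "h \<in> Z" shows "\<kappa> g h = 1"
proof (rule ccontr)
  assume ne: "\<kappa> g h \<noteq> 1"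
  define \<zeta> where "\<zeta> = \<kappa> g h"
  have g: "g \<in> carrier G" and h: "h \<in> carrier G" using gh Z_carrier by auto
  have \<zeta>: "\<zeta> ^ 3 = 1" "\<zeta> \<noteq> 1" using \<kappa>(1)[OF g h] ne by (auto simp: \<zeta>_def)
  obtain b t where e: "eigenbasis (insert p {g}) b t"
    using eigenbasis_ex[of "insert p {g}"] Z_comm[OF gh(1)] \<kappa>_self p g by auto
  have size: "card {i. t g i = \<nu>} \<ge> 3" if "v \<noteq> 0" "\<rho> p v = \<alpha> *s v" "\<rho> g v = \<nu> *s v" for v \<alpha> \<nu>
    using eigenvector_class_size[OF e _ p q pq, of v \<alpha> "\<lambda>_. \<nu>"] that g Z_comm[OF gh(1)] by simp
  define P where "P w \<nu> \<longleftrightarrow> w \<noteq> 0 \<and> (\<exists>\<alpha>. \<rho> p w = \<alpha> *s w) \<and> \<rho> g w = \<nu> *s w" for w \<nu>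
  have step: "P (\<rho> h w) (\<zeta> * \<nu>)" if "P w \<nu>" for w \<nu>
  proof -
    from that obtain \<alpha> where \<alpha>: "\<rho> p w = \<alpha> *s w" unfolding P_def by blast
    have "\<rho> g (\<rho> h w) = (\<zeta> * \<nu>) *s \<rho> h w"
      using \<kappa>(2)[OF g h, of w] that \<rho>_scale[OF h] by (simp add: P_def \<zeta>_def)
    moreover have "\<rho> p (\<rho> h w) = \<alpha> *s \<rho> h w"
      using \<kappa>(2)[OF p h, of w] Z_comm[OF gh(2)] \<alpha> \<rho>_scale[OF h] by simp
    ultimately show ?thesis using \<rho>_nonzero[OF h] that by (auto simp: P_def)
  qed
  obtain \<nu> where P0: "P (b undefined) \<nu>"
    using e eigenbasis_nonzero[OF e] unfolding P_def eigenbasis_def by blast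
  have sizeP: "card {i. t g i = \<nu>} \<ge> 3" if "P w \<nu>" for w \<nu> using size that by (auto simp: P_def)
  have \<nu>0: "\<nu> \<noteq> 0"
  proof
    assume "\<nu> = 0"
    then have "\<rho> g (b undefined) = 0" "b undefined \<noteq> 0" using P0 by (simp_all add: P_def)
    then show False using \<rho>_nonzero[OF g] by blast
  qed
  have \<zeta>2: "\<zeta> * \<zeta> \<noteq> 1" "\<zeta> \<noteq> 0" using \<zeta> by (auto simp: power3_eq_cube)
  show False
    by (rule three_classes[OF sizeP[OF P0] sizeP[OF step[OF P0]] sizeP[OF step[OF step[OF P0]]]])
      (use \<nu>0 \<zeta> \<zeta>2 in auto)
qed

lemma Z_two_weights:
  "\<exists>b t i1 i2. eigenbasis Z b t \<and> (\<forall>j. (\<forall>g\<in>Z. t g j = t g i1) \<or> (\<forall>g\<in>Z. t g j = t g i2))"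
proof -
  have "\<exists>b t. eigenbasis (insert p Z) b t"
    by (rule eigenbasis_ex) (use Z_commutative Z_comm \<kappa>_self p Z_carrier in auto)
  then obtain b t where e: "eigenbasis (insert p Z) b t" by blast
  have eZ: "eigenbasis Z b t" using e by (auto simp: eigenbasis_def)
  have size: "card {i. \<forall>g\<in>Z. t g i = t g j} \<ge> 3" for j
    by (rule eigenvector_class_size[OF e Z_carrier p q pq Z_comm(4) eigenbasis_nonzero[OF e, of j], of "t p j"])
      (use e in \<open>auto simp: eigenbasis_def\<close>)
  define i0 :: 'n where "i0 = undefined"
  show ?thesis
  proof (cases "\<forall>j. \<forall>g\<in>Z. t g j = t g i0")
    case True
    then show ?thesis using eZ by blast
  next
    case False
    then obtain i2 where i2: "\<not> (\<forall>g\<in>Z. t g i2 = t g i0)" by blast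
    have "(\<forall>g\<in>Z. t g j = t g i0) \<or> (\<forall>g\<in>Z. t g j = t g i2)" for j
    proof (rule ccontr)
      assume n: "\<not> ?thesis"
      show False
        by (rule three_classes[OF size[of i0] size[of i2] size[of j]]) (use i2 n in \<open>force+\<close>)
    qed
    then show ?thesis using eZ by blast
  qed
qed

text \<open>The quotient \<open>z\<close> of the two weights determines an element of \<open>Z\<close> up to scalars, so it is injective. Smoothness
  provides for each of the two weights \<open>\<nu>\<close> another weight \<open>\<nu>'\<close> with \<open>\<nu>\<^sup>2 \<nu>' = 1\<close>; the four
  possible combinations give \<open>z\<^sup>2 = 1\<close> or \<open>z\<^sup>3 = 1\<close>.\<close>

lemma Z_character:
  "\<exists>z. (\<forall>g\<in>Z. \<forall>h\<in>Z. g \<otimes> h \<in> Z \<longrightarrow> z (g \<otimes> h) = z g * (z h :: complex)) \<and>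
    (\<forall>g\<in>Z. z g \<noteq> 0) \<and> (\<forall>g\<in>Z. z g = 1 \<longrightarrow> g = \<one>) \<and>
    ((\<forall>g\<in>Z. z g ^ 2 = 1) \<or> (\<forall>g\<in>Z. z g ^ 3 = 1))"
proof -
  obtain b t i1 i2 where e: "eigenbasis Z b t"
    and two: "\<forall>j. (\<forall>g\<in>Z. t g j = t g i1) \<or> (\<forall>g\<in>Z. t g j = t g i2)" using Z_two_weights by blast
  have tnz: "t g i \<noteq> 0" if "g \<in> Z" for g i
  proof
    assume "t g i = 0"
    then have "\<rho> g (b i) = 0" using e that by (simp add: eigenbasis_def)
    then show False using \<rho>_nonzero[of g] that Z_carrier eigenbasis_nonzero[OF e] by blast
  qed
  have inv: "\<exists>l. \<forall>g\<in>Z. t g i * t g i * t g l = 1" for i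
  proof -
    obtain l where "B (b i) (b i) (b l) \<noteq> 0" using eigenbasis_monomial[OF e, of "{}" "{i}"] by auto
    then show ?thesis using eigenbasis_invariant[OF e] Z_carrier by blast
  qed
  have inv2: "(\<forall>g\<in>Z. t g i * t g i * t g i1 = 1) \<or> (\<forall>g\<in>Z. t g i * t g i * t g i2 = 1)" for i
  proof -
    obtain l where l: "\<forall>g\<in>Z. t g i * t g i * t g l = 1" using inv by blast
    from two[rule_format, of l] show ?thesis
    proof
      assume "\<forall>g\<in>Z. t g l = t g i1" then show ?thesis using l by simp
    next
      assume "\<forall>g\<in>Z. t g l = t g i2" then show ?thesis using l by simp
    qed
  qed
  define z where "z g = t g i2 / t g i1" for g
  have "(\<forall>g\<in>Z. z g ^ 2 = 1) \<or> (\<forall>g\<in>Z. z g ^ 3 = 1)"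
  proof -
    consider "\<forall>g\<in>Z. t g i1 * t g i1 * t g i1 = 1" "\<forall>g\<in>Z. t g i2 * t g i2 * t g i2 = 1"
      | "\<forall>g\<in>Z. t g i1 * t g i1 * t g i1 = 1" "\<forall>g\<in>Z. t g i2 * t g i2 * t g i1 = 1"
      | "\<forall>g\<in>Z. t g i1 * t g i1 * t g i2 = 1" "\<forall>g\<in>Z. t g i2 * t g i2 * t g i2 = 1"
      | "\<forall>g\<in>Z. t g i1 * t g i1 * t g i2 = 1" "\<forall>g\<in>Z. t g i2 * t g i2 * t g i1 = 1"
      using inv2[of i1] inv2[of i2] by blast
    then show ?thesis
    proof cases
      case 1
      then show ?thesis using tnz by (simp add: z_def power3_eq_cube)
    next
      case 2
      have "z g ^ 2 = 1" if "g \<in> Z" for g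
      proof -
        have "t g i2 * t g i2 * t g i1 = t g i1 * t g i1 * t g i1" using 2 that by simp
        then have "t g i2 * t g i2 = t g i1 * t g i1" using tnz[OF that] by simp
        then show ?thesis using tnz[OF that] by (simp add: z_def power2_eq_square)
      qed
      then show ?thesis by blast
    next
      case 3
      have "z g ^ 2 = 1" if "g \<in> Z" for g
      proof -
        have "t g i1 * t g i1 * t g i2 = t g i2 * t g i2 * t g i2" using 3 that by simp
        then have "t g i1 * t g i1 = t g i2 * t g i2" using tnz[OF that] by simp
        then show ?thesis using tnz[OF that] by (simp add: z_def power2_eq_square)
      qed
      then show ?thesis by blast
    next
      case 4
      have "z g ^ 2 = 1" if "g \<in> Z" for g
      proof -
        have "t g i1 * (t g i1 * t g i2) = t g i2 * (t g i1 * t g i2)" using 4 that by (simp add: mult_ac)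
        then have "t g i1 = t g i2" using tnz[OF that] by simp
        then show ?thesis using tnz[OF that] by (simp add: z_def)
      qed
      then show ?thesis by blast
    qed
  qed
  moreover have "g = \<one>" if g: "g \<in> Z" and "z g = 1" for g
  proof -
    have "t g i2 = t g i1" using that tnz by (simp add: z_def)
    then have "t g j = t g i1" for j using two[rule_format, of j] g by auto
    then show ?thesis by (rule scalar_if_eigenvalues_equal[OF e Z_carrier g])
  qed
  moreover have "z (g \<otimes> h) = z g * z h" if gh: "g \<in> Z" "h \<in> Z" "g \<otimes> h \<in> Z" for g h
  proof -
    have gc: "g \<in> carrier G" "h \<in> carrier G" using gh Z_carrier by auto
    from \<rho>_mult[OF gc] obtain c where c: "c ^ 3 = 1" "\<And>x. \<rho> g (\<rho> h x) = c *s \<rho> (g \<otimes> h) x" by blast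
    have c0: "c \<noteq> 0" using c(1) by auto
    have t: "\<rho> g (b i) = t g i *s b i" if "g \<in> Z" for g i using e that unfolding eigenbasis_def by blast
    have "t g i * t h i = c * t (g \<otimes> h) i" for i
    proof -
      have "(t h i * t g i) *s b i = (c * t (g \<otimes> h) i) *s b i"
        using c(2)[of "b i"] by (simp add: t gh \<rho>_scale[OF gc(1)])
      then have "t h i * t g i = c * t (g \<otimes> h) i" using eigenbasis_nonzero[OF e] by (rule scale_inj)
      then show ?thesis by (simp add: mult.commute)
    qed
    then have "z g * z h = (c * t (g \<otimes> h) i2) / (c * t (g \<otimes> h) i1)" by (simp add: z_def)
    then show ?thesis using c0 by (simp add: z_def)
  qed
  moreover have "z g \<noteq> 0" if "g \<in> Z" for g using tnz[OF that] by (simp add: z_def)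
  ultimately show ?thesis by (intro exI[of _ z]) simp
qed

end

end

lemma three_powers:
  assumes "\<forall>m\<in>#M. m = 3 \<or> m = (9::nat)" "prod_mset M \<le> 27" shows "fits M"
proof -
  have pos: "prod_mset N > 0" if "\<forall>m\<in>#N. m = 3 \<or> m = (9::nat)" for N
    using that by (induction N) auto
  have t0: "N = {#}" if "\<forall>m\<in>#N. m = 3 \<or> m = (9::nat)" "prod_mset N < 3" for N
  proof (cases N)
    case (add m N')
    then have "m = 3 \<or> m = 9" "prod_mset N' > 0" using that pos[of N'] by auto
    then show ?thesis using that(2) add by auto
  qed
  have t1: "N = {#} \<or> N = {#3#}" if "\<forall>m\<in>#N. m = 3 \<or> m = (9::nat)" "prod_mset N < 9" for N
  proof (cases N)
    case (add m N')
    then have *: "m = 3 \<or> m = 9" "prod_mset N' > 0" "\<forall>m\<in>#N'. m = 3 \<or> m = 9" using that pos[of N'] by auto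
    then have "m = 3" "prod_mset N' < 3" using that(2) add by auto
    then show ?thesis using t0[OF *(3)] add by simp
  qed simp
  have t2: "N = {#} \<or> N = {#3#} \<or> N = {#9#} \<or> N = {#3, 3#}"
    if "\<forall>m\<in>#N. m = 3 \<or> m = (9::nat)" "prod_mset N < 27" for N
  proof (cases N)
    case (add m N')
    then have *: "m = 3 \<or> m = 9" "prod_mset N' > 0" "\<forall>m\<in>#N'. m = 3 \<or> m = 9" using that pos[of N'] by auto
    then have "m = 3 \<and> prod_mset N' < 9 \<or> m = 9 \<and> prod_mset N' < 3" using that(2) add by auto
    then show ?thesis using t0[OF *(3)] t1[OF *(3)] add by auto
  qed simp
  have "M = {#} \<or> M = {#3#} \<or> M = {#9#} \<or> M = {#3, 3#} \<or> M = {#3, 9#} \<or> M = {#3, 3, 3#}"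
  proof (cases M)
    case (add m N')
    then have *: "m = 3 \<or> m = 9" "prod_mset N' > 0" "\<forall>m\<in>#N'. m = 3 \<or> m = 9" using assms pos[of N'] by auto
    have "prod_mset M = m * prod_mset N'" using add by simp
    then have "m = 3 \<and> prod_mset N' \<le> 9 \<or> m = 9 \<and> prod_mset N' < 9" using * assms(2) by auto
    then have "m = 3 \<and> prod_mset N' < 27 \<and> prod_mset N' \<le> 9 \<or> m = 9 \<and> prod_mset N' < 9" by auto
    then show ?thesis using t1[OF *(3)] t2[OF *(3)] add by (auto simp: add_mset_commute)
  qed simp
  then show ?thesis
    by (elim disjE) (auto simp: fourfold_types_def insert_subset_eq_iff
      intro: fitsI[of "[3, 3, 9]"] fitsI[of "[3, 3, 3, 3, 3]"])
qed

context cubic_representation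
begin

text \<open>The pairings with \<open>p\<close> and \<open>q\<close> are two characters of order three with joint kernel \<open>Z\<close>. If \<open>Z\<close> has order at most two this
  gives the type 3, 3, 2. Otherwise \<open>Z\<close> has at most three elements, \<open>G\<close> at most 27, and \<open>G\<close> is a 3-group.\<close>

lemma noncommuting_case:
  assumes p: "p \<in> carrier G" and q: "q \<in> carrier G" and pq: "\<kappa> p q \<noteq> 1"
  shows "\<exists>ns\<in>fourfold_types. embeds_in G (mset ns)"
proof -
  define Y where "Y = Z p q"
  have Y: "g \<in> Y \<longleftrightarrow> g \<in> carrier G \<and> \<kappa> p g = 1 \<and> \<kappa> q g = 1" for g
    by (simp add: Y_def Z_def[OF p q pq])
  obtain z where z: "\<forall>g\<in>Y. \<forall>h\<in>Y. g \<otimes> h \<in> Y \<longrightarrow> z (g \<otimes> h) = z g * (z h :: complex)"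
    "\<forall>g\<in>Y. z g \<noteq> 0" "\<forall>g\<in>Y. z g = 1 \<longrightarrow> g = \<one>" "(\<forall>g\<in>Y. z g ^ 2 = 1) \<or> (\<forall>g\<in>Y. z g ^ 3 = 1)"
    using Z_character[OF p q pq] unfolding Y_def by blast
  have Y_mult: "g \<otimes> h \<in> Y" if "g \<in> Y" "h \<in> Y" for g h
    using that \<kappa>_mult[OF p] \<kappa>_mult[OF q] by (simp add: Y)
  have Y_inv: "inv g \<in> Y" if "g \<in> Y" for g
    using that character_inv[OF is_group character_\<kappa>[OF p]] character_inv[OF is_group character_\<kappa>[OF q]] by (simp add: Y)
  have \<kappa>_pow: "\<kappa> r (g [^] (n::nat)) = \<kappa> r g ^ n" if "r \<in> carrier G" "g \<in> carrier G" for r g n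
    by (rule character_pow[OF is_group character_\<kappa>[OF that(1)] that(2)])
  have "\<exists>M. fits M \<and> embeds_in G M" using z(4)
  proof
    assume z2: "\<forall>g\<in>Y. z g ^ 2 = 1"
    have "embeds_in (G\<lparr>carrier := Y\<rparr>) (image_mset snd {#(z, 2::nat)#})"
    proof (rule embeds_inI)
      fix \<xi> n assume "(\<xi>, n) \<in># {#(z, 2::nat)#}"
      then show "character (G\<lparr>carrier := Y\<rparr>) \<xi>" using z(1,2) Y_mult by (auto simp: character_def)
    qed (use z(3) z2 in auto)
    then have e2: "embeds_in (G\<lparr>carrier := Y\<rparr>) {#2#}" by simp
    have "embeds_in G (image_mset snd {#(\<kappa> p, 3::nat), (\<kappa> q, 3)#} + {#2#})"
    proof (rule embeds_in_split[where K = Y and q = 3])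
      show "Y = {x \<in> carrier G. \<forall>\<xi> n. (\<xi>, n) \<in># {#(\<kappa> p, 3::nat), (\<kappa> q, 3)#} \<longrightarrow> \<xi> x = 1}"
        by (auto simp: Y)
      show "character G \<xi>" if "(\<xi>, n) \<in># {#(\<kappa> p, 3::nat), (\<kappa> q, 3)#}" for \<xi> n
        using that character_\<kappa> p q by auto
      show "\<xi> x ^ n = 1" if "(\<xi>, n) \<in># {#(\<kappa> p, 3::nat), (\<kappa> q, 3)#}" "x \<in> carrier G" for \<xi> n x
        using that \<kappa>(1) p q by auto
    qed (use comm_group_axioms e2 in auto)
    moreover have "fits {#2, 3, 3#}"
      by (rule fitsI[of "[3, 3, 3, 3, 2]"]) (auto simp: fourfold_types_def insert_subset_eq_iff)
    ultimately show ?thesis by (intro exI[of _ "{#2, 3, 3#}"]) simp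
  next
    assume z3: "\<forall>g\<in>Y. z g ^ 3 = 1"
    have Yc: "Y \<subseteq> carrier G" by (auto simp: Y)
    have "inj_on z Y"
    proof (rule inj_onI)
      fix g h assume gh: "g \<in> Y" "h \<in> Y" "z g = z h"
      have gc: "g \<in> carrier G" "h \<in> carrier G" using gh Yc by auto
      have d: "g \<otimes> inv h \<in> Y" using gh Y_mult Y_inv by blast
      have "(g \<otimes> inv h) \<otimes> h = g" using gc by (simp add: m_assoc)
      then have "z g = z (g \<otimes> inv h) * z h" using z(1) d gh(1,2) by metis
      then have "z (g \<otimes> inv h) = 1" using gh(2,3) z(2) by simp
      then have "g \<otimes> inv h = \<one>" using z(3) d by blast
      then show "g = h" using gc by (metis inv_solve_right' l_one one_closed)
    qed
    moreover have "z ` Y \<subseteq> {w. w ^ 3 = 1}" using z3 by auto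
    ultimately have "card Y \<le> card {w::complex. w ^ 3 = 1}"
      by (intro card_inj_on_le[of z]) (auto intro: finite_roots_unity)
    also have "\<dots> = 3" by (rule card_roots_unity_eq) simp
    finally have cY: "card Y \<le> 3" .
    define W where "W = {w::complex. w ^ 3 = 1} \<times> {w::complex. w ^ 3 = 1}"
    have finW: "finite W" unfolding W_def by (intro finite_cartesian_product finite_roots_unity) simp_all
    have cW: "card W = 9" using card_roots_unity_eq[of 3] by (simp add: W_def card_cartesian_product)
    define fib where "fib w = {g \<in> carrier G. (\<kappa> p g, \<kappa> q g) = w}" for w
    have cfib: "card (fib w) \<le> card Y" for w
    proof (cases "fib w = {}")
      case False
      then obtain g0 where g0: "g0 \<in> fib w" by blast
      then have g0c: "g0 \<in> carrier G" by (simp add: fib_def)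
      show ?thesis
      proof (rule card_inj_on_le[of "\<lambda>g. g \<otimes> inv g0"])
        show "inj_on (\<lambda>g. g \<otimes> inv g0) (fib w)"
        proof (rule inj_onI)
          fix g h assume "g \<in> fib w" "h \<in> fib w" and eq: "g \<otimes> inv g0 = h \<otimes> inv g0"
          then have "g \<in> carrier G" "h \<in> carrier G" by (simp_all add: fib_def)
          then show "g = h" using eq right_cancel[of "inv g0" g h] g0c by simp
        qed
        show "(\<lambda>g. g \<otimes> inv g0) ` fib w \<subseteq> Y"
        proof clarify
          fix g assume "g \<in> fib w"
          then have "g \<in> carrier G" "(\<kappa> p g, \<kappa> q g) = w" by (simp_all add: fib_def)
          moreover have "(\<kappa> p g0, \<kappa> q g0) = w" using g0 by (simp add: fib_def)
          ultimately have g: "g \<in> carrier G" "\<kappa> p g = \<kappa> p g0" "\<kappa> q g = \<kappa> q g0" by (metis Pair_inject)+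
          have nz: "\<kappa> p g0 \<noteq> 0" "\<kappa> q g0 \<noteq> 0"
            using character_\<kappa>[OF p] character_\<kappa>[OF q] g0c by (auto simp: character_def)
          show "g \<otimes> inv g0 \<in> Y"
            using g g0c nz by (simp add: Y \<kappa>_mult[OF p] \<kappa>_mult[OF q]
              character_inv[OF is_group character_\<kappa>[OF p]] character_inv[OF is_group character_\<kappa>[OF q]])
        qed
        show "finite Y" using Yc finG finite_subset by blast
      qed
    qed simp
    have "carrier G = (\<Union>w\<in>W. fib w)" using \<kappa>(1)[OF p] \<kappa>(1)[OF q] unfolding W_def fib_def by blast
    then have "card (carrier G) \<le> (\<Sum>w\<in>W. card (fib w))" using card_UN_le[OF finW, of fib] by simp
    also have "\<dots> \<le> of_nat (card W) * card Y" by (rule sum_bounded_above) (rule cfib)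
    also have "\<dots> \<le> 27" using cY cW by simp
    finally have c27: "card (carrier G) \<le> 27" .
    have p9: "x [^] ((3::nat) ^ 2) = \<one>" if x: "x \<in> carrier G" for x
    proof -
      have y: "x [^] (3::nat) \<in> Y" using x p q \<kappa>(1) by (simp add: Y \<kappa>_pow)
      define y where "y = x [^] (3::nat)"
      have yY: "y \<in> Y" "y \<in> carrier G" using y Yc by (auto simp: y_def)
      have y3: "y \<otimes> y \<otimes> y = y [^] (3::nat)" using yY(2) by (simp add: numeral_3_eq_3)
      have "z (y \<otimes> y \<otimes> y) = z y ^ 3" using z(1) Y_mult yY(1) by (simp add: power3_eq_cube)
      then have "z (y \<otimes> y \<otimes> y) = 1" using z3 yY(1) by simp
      then have "y [^] (3::nat) = \<one>" using z(3) Y_mult yY(1) y3 by metis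
      then show ?thesis using x by (simp add: y_def nat_pow_pow)
    qed
    have p3: "prime (3::nat)" by simp
    obtain M where M: "embeds_in G M" "prod_mset M = card (carrier G)" "\<forall>m\<in>#M. \<exists>e\<in>{1..2}. m = 3 ^ e"
      using abelian_p_group_embeds_in[OF p3 comm_group_axioms finG p9] by blast
    have "\<forall>m\<in>#M. m = 3 \<or> m = 9"
    proof
      fix m assume "m \<in># M"
      then obtain e where e: "e \<in> {1..2}" "m = 3 ^ e" using M(3) by blast
      then have "e = 1 \<or> e = 2" by auto
      then show "m = 3 \<or> m = 9" using e(2) by auto
    qed
    then have "fits M" by (rule three_powers) (use M(2) c27 in simp)
    then show ?thesis using M(1) by blast
  qed
  then obtain M ns where "ns \<in> fourfold_types" "M \<subseteq># mset ns" "embeds_in G M" unfolding fits_def by blast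
  then show ?thesis using embeds_in_mono by blast
qed

theorem representation_embeds_in: "\<exists>ns\<in>fourfold_types. embeds_in G (mset ns)"
  using commuting_case noncommuting_case by blast

end

section \<open>Lifting the action\<close>

lemma mat_mult_vec:
  fixes A :: "complex ^ 'n ^ 'n"
  shows "(mat c ** A) *v x = c *s (A *v x)"
proof -
  have "mat c *v y = c *s y" for y :: "complex ^ 'n"
    by (simp add: vec_eq_iff matrix_vector_mult_def mat_def if_distrib if_distribR cong: if_cong)
  then show ?thesis by (simp flip: matrix_vector_mul_assoc)
qed

lemma PGL_coset:
  fixes M :: "(complex ^ 'n ^ 'n) set"
  assumes "M \<in> carrier PGL" shows "\<exists>A. invertible A \<and> M = {mat c ** A | c. c \<noteq> 0}"
  using assms by (auto simp: PGL_def FactGroup_def RCOSETS_def r_coset_def GL_def scalar_matrices_def)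

lemma PGL_mult: "M \<otimes>\<^bsub>PGL\<^esub> N = {A ** B | A B. A \<in> M \<and> B \<in> N}"
  by (auto simp: PGL_def FactGroup_def set_mult_def GL_def)

lemma mat_mult_mat: "mat c ** mat d = (mat (c * d) :: complex ^ 'n ^ 'n)"
proof -
  have "(mat c ** mat d) *v x = mat (c * d) *v x" for x :: "complex ^ 'n"
    using mat_mult_vec[of c "mat d" x] mat_mult_vec[of d "mat 1" x] mat_mult_vec[of "c * d" "mat 1" x]
    by (simp add: matrix_mul_rid)
  then show ?thesis by (simp add: matrix_eq)
qed

context sym_trilinear
begin

text \<open>A symmetric trilinear form is determined by the cubic form.\<close>

lemma zero_if_cubes_zero: assumes "\<And>x. B x x x = 0" shows "B x y z = 0"
proof -
  have xxy: "B x x y = 0" for x y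
  proof -
    have "3 * s * B x x y + 3 * s\<^sup>2 * B x y y = 0" for s
      using cube_add[of x s y] assms by simp
    from this[of 1] this[of "-1"] show ?thesis by (simp add: algebra_simps)
  qed
  have "B (x + y) (x + y) z = B x x z + 2 * B x y z + B y y z" using sym12[of y x z] by (simp add: expand)
  then show ?thesis by (simp add: xxy)
qed

end

context smooth_trilinear
begin

lemma nonzero_value: "\<exists>y. B y y y \<noteq> 0"
proof (rule ccontr)
  assume "\<not> ?thesis"
  then have "B x y z = 0" for x y z using zero_if_cubes_zero by blast
  moreover have "axis undefined 1 \<noteq> (0 :: complex ^ 'n)" by (simp add: axis_eq_0_iff)
  from smooth[OF this] obtain v where "B (axis undefined 1) (axis undefined 1) v \<noteq> 0" by blast
  ultimately show False by blast
qed

text \<open>The scalar is a cube root of the reciprocal of the factor in \<open>proportional_if_vanishing\<close>.\<close>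

lemma invariant_scaling:
  fixes A :: "complex ^ 'n ^ 'n"
  assumes "CARD('n) \<ge> 3" "invertible A" and van: "\<And>x. B x x x = 0 \<Longrightarrow> B (A *v x) (A *v x) (A *v x) = 0"
  shows "\<exists>c. c \<noteq> 0 \<and> (\<forall>x. B ((mat c ** A) *v x) ((mat c ** A) *v x) ((mat c ** A) *v x) = B x x x)"
proof -
  define B' where "B' x y z = B (A *v x) (A *v y) (A *v z)" for x y z
  have B': "sym_trilinear B'"
  proof
    fix x y z x' :: "complex ^ 'n" and r
    show "B' x y z = B' y x z" unfolding B'_def by (rule sym12)
    show "B' x y z = B' x z y" unfolding B'_def by (rule sym23)
    show "B' (x + x') y z = B' x y z + B' x' y z"
      unfolding B'_def matrix_vector_right_distrib by (rule add1)
    show "B' (r *s x) y z = r * B' x y z" unfolding B'_def vector_scalar_commute by (rule scale1)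
  qed
  obtain l where l: "\<And>x. B' x x x = l * B x x x"
    using proportional_if_vanishing[OF B' assms(1)] van by (auto simp: B'_def)
  obtain y where y: "B y y y \<noteq> 0" using nonzero_value by blast
  obtain A' where "A ** A' = mat 1" using assms(2) by (auto simp: invertible_def)
  then have "A *v (A' *v y) = y" by (simp add: matrix_vector_mul_assoc)
  then have "l \<noteq> 0" using l[of "A' *v y"] y by (auto simp: B'_def)
  have "\<exists>c. poly [:- (1 / l), 0, 0, 1:] c = 0"
    by (rule complex_poly_root[of _ 3]) (auto simp: numeral_eq_Suc)
  then obtain c where c: "poly [:- (1 / l), 0, 0, 1:] c = 0" by blast
  then have c3: "c ^ 3 * l = 1" using \<open>l \<noteq> 0\<close> by (simp add: field_simps power3_eq_cube)
  then have "c \<noteq> 0" by auto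
  moreover have "B ((mat c ** A) *v x) ((mat c ** A) *v x) ((mat c ** A) *v x) = B x x x" for x
  proof -
    have "B ((mat c ** A) *v x) ((mat c ** A) *v x) ((mat c ** A) *v x) = c ^ 3 * B' x x x"
      by (simp add: mat_mult_vec expand B'_def power3_eq_cube)
    then show ?thesis using l[of x] c3 by (simp flip: mult.assoc)
  qed
  ultimately show ?thesis by blast
qed

end

text \<open>The chosen representatives of the cosets satisfy the assumptions of \<open>cubic_representation\<close>: products agree up to a
  scalar, and comparing the values of the form at a point where it does not vanish shows that its
  cube is 1.\<close>

theorem embeds_in_if_acts:
  fixes G :: "('a, 'b) monoid_scheme"
  assumes "comm_group G" "finite (carrier G)" "acts_effectively_on_cubic_fourfold G"
  shows "\<exists>ns\<in>fourfold_types. embeds_in G (mset ns)"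
proof -
  interpret comm_group G by fact
  obtain \<phi> X where \<phi>: "\<phi> \<in> hom G (PGL :: (complex ^ 6 ^ 6) set monoid)" "inj_on \<phi> (carrier G)"
    and X: "smooth_cubic_fourfold X" "\<forall>g\<in>carrier G. proj_act (\<phi> g) ` X \<subseteq> X"
    using assms(3) unfolding acts_effectively_on_cubic_fourfold_def by blast
  obtain c where c: "smooth_form 3 c" "X = hypersurface 3 c" using X(1) unfolding smooth_cubic_fourfold_def by blast
  obtain B where B: "smooth_trilinear B" "\<forall>x. form_eval 3 c x = B x x x" using smooth_trilinear_of_form[OF c(1)] by blast
  interpret B: smooth_trilinear B by (rule B(1))
  have \<phi>c: "\<phi> g \<in> carrier PGL" if "g \<in> carrier G" for g using \<phi>(1) that by (auto simp: hom_def)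
  have coset: "\<exists>s. s \<noteq> 0 \<and> M = mat s ** N" if "g \<in> carrier G" "M \<in> \<phi> g" "N \<in> \<phi> g" for g M N
  proof -
    from PGL_coset[OF \<phi>c[OF that(1)]] obtain A where A: "\<phi> g = {mat c ** A | c. c \<noteq> 0}" by blast
    from that(2,3) obtain a b where ab: "a \<noteq> 0" "b \<noteq> 0" "M = mat a ** A" "N = mat b ** A" unfolding A by blast
    have "mat (a / b) ** N = M" using ab by (simp add: matrix_mul_assoc mat_mult_mat)
    then show ?thesis using ab by (intro exI[of _ "a / b"]) auto
  qed
  have van: "B (A *v x) (A *v x) (A *v x) = 0" if "g \<in> carrier G" "A \<in> \<phi> g" "B x x x = 0" for g A x
  proof (cases "x = 0")
    case True
    have "B 0 y z = 0" for y z using B.scale1[of 0 0 y z] by simp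
    then show ?thesis using True by simp
  next
    case False
    have hom3: "B (s *s y) (s *s y) (s *s y) = s ^ 3 * B y y y" for s y
      by (simp add: B.expand power3_eq_cube)
    have "vec.span {x} \<in> X"
    proof -
      have "B y y y = 0" if "y \<in> vec.span {x}" for y
        using that \<open>B x x x = 0\<close> hom3 by (auto simp: vec.span_singleton)
      then show ?thesis using False B(2) by (auto simp: c(2) hypersurface_def proj_space_def)
    qed
    then have "proj_act (\<phi> g) (vec.span {x}) \<in> X" using X(2) that(1) by blast
    moreover have "A *v x \<in> proj_act (\<phi> g) (vec.span {x})"
      using that(2) unfolding proj_act_def by (auto intro: vec.span_base)
    ultimately show ?thesis using B(2) by (auto simp: c(2) hypersurface_def)
  qed
  have "\<exists>A. A \<in> \<phi> g \<and> (\<forall>x. B (A *v x) (A *v x) (A *v x) = B x x x)" if g: "g \<in> carrier G" for g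
  proof -
    obtain A where A: "invertible A" "\<phi> g = {mat c ** A | c. c \<noteq> 0}" using PGL_coset[OF \<phi>c[OF g]] by blast
    have "A \<in> \<phi> g" unfolding A(2) by (intro CollectI exI[of _ 1]) simp
    then have "\<exists>c. c \<noteq> 0 \<and> (\<forall>x. B ((mat c ** A) *v x) ((mat c ** A) *v x) ((mat c ** A) *v x) = B x x x)"
      by (intro B.invariant_scaling A(1) van[OF g]) auto
    then show ?thesis unfolding A(2) by blast
  qed
  then obtain A where A: "\<And>g. g \<in> carrier G \<Longrightarrow> A g \<in> \<phi> g"
    "\<And>g x. g \<in> carrier G \<Longrightarrow> B (A g *v x) (A g *v x) (A g *v x) = B x x x" by metis
  have nontriv: "\<exists>x. B x x x \<noteq> 0" by (rule B.nonzero_value)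
  interpret R: cubic_representation B G "\<lambda>g x. A g *v x"
  proof
    show "finite (carrier G)" by fact
    show "CARD(6) = 6" by simp
    show "A g *v (x + y) = A g *v x + A g *v y" for g x y by (rule matrix_vector_right_distrib)
    show "A g *v (c *s x) = c *s (A g *v x)" for g c x by (rule vector_scalar_commute)
    show "B (A g *v x) (A g *v y) (A g *v z) = B x y z" if g: "g \<in> carrier G" for g x y z
    proof -
      define D where "D x y z = B (A g *v x) (A g *v y) (A g *v z) - B x y z" for x y z
      have "sym_trilinear D"
      proof
        fix x y z x' :: "complex ^ 6" and r
        show "D x y z = D y x z" unfolding D_def using B.sym12 by metis
        show "D x y z = D x z y" unfolding D_def using B.sym23 by metis
        show "D (x + x') y z = D x y z + D x' y z"
          by (simp add: D_def matrix_vector_right_distrib B.add1)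
        show "D (r *s x) y z = r * D x y z"
          by (simp add: D_def vector_scalar_commute B.scale1 algebra_simps)
      qed
      moreover have "D x x x = 0" for x using A(2)[OF g] by (simp add: D_def)
      ultimately have "D x y z = 0" by (rule sym_trilinear.zero_if_cubes_zero)
      then show ?thesis by (simp add: D_def)
    qed
    show "\<exists>c. c ^ 3 = 1 \<and> (\<forall>x. A g *v (A h *v x) = c *s (A (g \<otimes>\<^bsub>G\<^esub> h) *v x))"
      if gh: "g \<in> carrier G" "h \<in> carrier G" for g h
    proof -
      have "\<phi> (g \<otimes>\<^bsub>G\<^esub> h) = \<phi> g \<otimes>\<^bsub>PGL\<^esub> \<phi> h" using \<phi>(1) gh by (auto simp: hom_def)
      moreover have "A g ** A h \<in> {A ** B |A B. A \<in> \<phi> g \<and> B \<in> \<phi> h}"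
        using A(1)[OF gh(1)] A(1)[OF gh(2)] by blast
      ultimately have "A g ** A h \<in> \<phi> (g \<otimes>\<^bsub>G\<^esub> h)" unfolding PGL_mult by simp
      then obtain s where s: "A g ** A h = mat s ** A (g \<otimes>\<^bsub>G\<^esub> h)" using coset[OF m_closed[OF gh]] A(1)[OF m_closed[OF gh]] by blast
      have eq: "A g *v (A h *v x) = s *s (A (g \<otimes>\<^bsub>G\<^esub> h) *v x)" for x
        unfolding matrix_vector_mul_assoc s by (rule mat_mult_vec)
      obtain x where x: "B x x x \<noteq> 0" using nontriv by blast
      have "B x x x = B (A g *v (A h *v x)) (A g *v (A h *v x)) (A g *v (A h *v x))"
        using A(2) gh by simp
      also have "\<dots> = s ^ 3 * B x x x"
        unfolding eq using A(2)[OF m_closed[OF gh], of x] by (simp add: B.expand power3_eq_cube)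
      finally have "s ^ 3 = 1" using x by simp
      then show ?thesis using eq by blast
    qed
    show "g = \<one>\<^bsub>G\<^esub>" if g: "g \<in> carrier G" and s: "\<And>x. A g *v x = s *s x" for g s
    proof -
      have scal: "\<phi> h = scalar_matrices" if h: "h \<in> carrier G" and m: "mat r \<in> \<phi> h" "r \<noteq> 0" for h r
      proof -
        obtain M where M: "\<phi> h = {mat c ** M | c. c \<noteq> 0}" using PGL_coset[OF \<phi>c[OF h]] by blast
        obtain a where a: "a \<noteq> 0" "mat r = mat a ** M" using m(1) unfolding M by blast
        have "mat (1 / a) ** mat r = M" unfolding a(2) using a(1) by (simp add: matrix_mul_assoc mat_mult_mat)
        then have M2: "M = mat (r / a)" by (simp add: mat_mult_mat)
        show ?thesis unfolding M M2 mat_mult_mat scalar_matrices_def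
        proof (intro equalityI subsetI)
          fix N assume "N \<in> {mat c |c. c \<noteq> (0::complex)}"
          then obtain c where "N = mat c" "c \<noteq> 0" by blast
          then show "N \<in> {mat (c * (r / a)) |c. c \<noteq> 0}"
            using a(1) m(2) by (intro CollectI exI[of _ "c * a / r"]) simp
        qed (use a(1) m(2) in auto)
      qed
      have "A g = mat s"
      proof -
        have "A g *v x = mat s *v x" for x using s[of x] mat_mult_vec[of s "mat 1" x] by (simp add: matrix_mul_rid)
        then show ?thesis by (simp add: matrix_eq)
      qed
      moreover have "s \<noteq> 0"
      proof
        assume "s = 0"
        obtain x where x: "B x x x \<noteq> 0" using nontriv by blast
        have "B (A g *v x) (A g *v x) (A g *v x) = 0" using s[of x] \<open>s = 0\<close> B.scale1[of 0 0] by simp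
        then show False using A(2)[OF g, of x] x by simp
      qed
      ultimately have "\<phi> g = scalar_matrices" using scal[OF g] A(1)[OF g] by metis
      moreover have "\<phi> \<one>\<^bsub>G\<^esub> = scalar_matrices"
      proof -
        have "\<phi> (\<one>\<^bsub>G\<^esub> \<otimes>\<^bsub>G\<^esub> \<one>\<^bsub>G\<^esub>) = \<phi> \<one>\<^bsub>G\<^esub> \<otimes>\<^bsub>PGL\<^esub> \<phi> \<one>\<^bsub>G\<^esub>" using \<phi>(1) one_closed unfolding hom_def by blast
        then have p1: "\<phi> \<one>\<^bsub>G\<^esub> = \<phi> \<one>\<^bsub>G\<^esub> \<otimes>\<^bsub>PGL\<^esub> \<phi> \<one>\<^bsub>G\<^esub>" by simp
        obtain M where M: "invertible M" "\<phi> \<one>\<^bsub>G\<^esub> = {mat c ** M | c. c \<noteq> 0}" using PGL_coset[OF \<phi>c[OF one_closed]] by blast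
        have M1: "M \<in> \<phi> \<one>\<^bsub>G\<^esub>" unfolding M(2) by (intro CollectI exI[of _ 1]) simp
        then have "M ** M \<in> {A ** B |A B. A \<in> \<phi> \<one>\<^bsub>G\<^esub> \<and> B \<in> \<phi> \<one>\<^bsub>G\<^esub>}" by blast
        then have "M ** M \<in> \<phi> \<one>\<^bsub>G\<^esub>" using p1 unfolding PGL_mult by simp
        then obtain r where r: "r \<noteq> 0" "M ** M = mat r ** M" using coset[OF one_closed _ M1] by blast
        obtain N where N: "M ** N = mat 1" using M(1) by (auto simp: invertible_def)
        have "M ** M ** N = mat r ** M ** N" using r(2) by simp
        then have "M = mat r" using N by (simp flip: matrix_mul_assoc)
        then show ?thesis using scal[OF one_closed, of r] M1 r(1) by simp
      qed
      ultimately show ?thesis using inj_onD[OF \<phi>(2), of g "\<one>\<^bsub>G\<^esub>"] g by simp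
    qed
  qed
  show ?thesis by (rule R.representation_embeds_in)
qed

section \<open>Explicit cubic fourfolds\<close>

text \<open>The hypothesis is the vanishing of all partial derivatives of \<open>\<Sum>\<^sub>i x\<^sub>i\<^sup>2 x\<^bsub>s i\<^esub>\<close>. Let \<open>Z\<close> be the set of indices with
  \<open>x\<^sub>i \<noteq> 0\<close>. The equations force \<open>s\<close> to permute \<open>Z\<close> without fixed points, and there they read
  \<open>x\<^sub>k\<^sup>2 = - 2 x\<^bsub>s k\<^esub> x\<^bsub>s (s k)\<^esub>\<close>. Multiplying them over \<open>Z\<close> gives \<open>(-2) ^ card Z = 1\<close>, so \<open>Z\<close> is empty.\<close>

lemma graph_form_zero:
  fixes x :: "'n::finite \<Rightarrow> complex"
  assumes inj: "\<And>i k. s i = s k \<Longrightarrow> s i \<noteq> i \<Longrightarrow> s k \<noteq> k \<Longrightarrow> i = k"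
    and eq: "\<And>l. 2 * x l * x (s l) + (\<Sum>i | s i = l. (x i)\<^sup>2) = 0"
  shows "x l = 0"
proof -
  define Z where "Z = {i. x i \<noteq> 0}"
  have sum: "(\<Sum>i | s i = l. (x i)\<^sup>2) = (x l)\<^sup>2 * of_bool (s l = l) + (\<Sum>i | s i = l \<and> i \<noteq> l. (x i)\<^sup>2)" for l
  proof (cases "s l = l")
    case True
    then have "{i. s i = l} = insert l {i. s i = l \<and> i \<noteq> l}" by auto
    then show ?thesis using True by simp
  next
    case False
    then have "{i. s i = l} = {i. s i = l \<and> i \<noteq> l}" by auto
    then show ?thesis using False by simp
  qed
  have pre: "{i. s i = l \<and> i \<noteq> l} = {k}" if "s k = l" "k \<noteq> l" for k l
    using that inj by auto
  have fwd: "s k \<in> Z" if k: "k \<in> Z" for k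
  proof (cases "s k = k")
    case False
    have "x (s k) \<noteq> 0"
    proof
      assume 0: "x (s k) = 0"
      have "(\<Sum>i | s i = s k \<and> i \<noteq> s k. (x i)\<^sup>2) = 0" using eq[of "s k"] sum[of "s k"] 0 by simp
      then show False using pre[OF refl, of k] False k by (simp add: Z_def)
    qed
    then show ?thesis by (simp add: Z_def)
  qed (use k in simp)
  have bwd: "\<exists>k\<in>Z. s k = l \<and> k \<noteq> l" if l: "l \<in> Z" for l
  proof (rule ccontr)
    assume n: "\<not> ?thesis"
    have "(\<Sum>i | s i = l \<and> i \<noteq> l. (x i)\<^sup>2) = 0" by (rule sum.neutral) (use n in \<open>auto simp: Z_def\<close>)
    then have "2 * x l * x (s l) + (x l)\<^sup>2 * of_bool (s l = l) = 0" using eq[of l] sum[of l] by simp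
    moreover have "x l \<noteq> 0" "x (s l) \<noteq> 0" using l fwd[OF l] by (auto simp: Z_def)
    ultimately show False by (cases "s l = l") (auto simp: power2_eq_square)
  qed
  have surj: "s ` Z = Z" using fwd bwd by blast
  then have injZ: "inj_on s Z" by (intro eq_card_imp_inj_on) auto
  have nofix: "s l \<noteq> l" if "l \<in> Z" for l
  proof
    assume "s l = l"
    from bwd[OF that] obtain k where k: "k \<in> Z" "s k = l" "k \<noteq> l" by blast
    then show False using inj_onD[OF injZ, of k l] \<open>s l = l\<close> that by simp
  qed
  have rel: "(x k)\<^sup>2 = - 2 * x (s k) * x (s (s k))" if k: "k \<in> Z" for k
  proof -
    have "(\<Sum>i | s i = s k. (x i)\<^sup>2) = (x k)\<^sup>2"
      using sum[of "s k"] pre[OF refl, of k] nofix[OF k] nofix[OF fwd[OF k]] by auto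
    then show ?thesis using eq[of "s k"] by (simp add: eq_neg_iff_add_eq_0 add.commute)
  qed
  define P where "P = (\<Prod>k\<in>Z. x k)"
  have P0: "P \<noteq> 0" by (simp add: P_def Z_def)
  have shift: "(\<Prod>k\<in>Z. f (s k)) = (\<Prod>k\<in>Z. f k)" for f :: "'n \<Rightarrow> complex"
    using prod.reindex[OF injZ, of f] surj by simp
  have "P\<^sup>2 = (\<Prod>k\<in>Z. (x k)\<^sup>2)" by (simp add: P_def prod_power_distrib)
  also have "\<dots> = (\<Prod>k\<in>Z. (- 2) * (x (s k) * x (s (s k))))"
    by (intro prod.cong refl) (use rel in simp)
  also have "\<dots> = (- 2) ^ card Z * P\<^sup>2"
    using shift[of x] shift[of "\<lambda>k. x (s k)"] by (simp only: prod.distrib prod_constant P_def power2_eq_square)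
  finally have "((- 2) ^ card Z :: complex) = 1" using P0 by simp
  then have "norm ((- 2) ^ card Z :: complex) = 1" by simp
  then have "(2::real) ^ card Z = 1" by (simp add: norm_power)
  then have "card Z = 0" by (metis one_less_numeral_iff power_0 power_inject_exp semiring_norm(76))
  then show ?thesis by (simp add: Z_def)
qed

text \<open>The coefficients of \<open>\<Sum>\<^sub>i x\<^sub>i\<^sup>2 x\<^bsub>s i\<^esub>\<close>; the cardinality counts how often a monomial occurs in this sum.\<close>

definition graph_form :: "('n \<Rightarrow> 'n) \<Rightarrow> ('n \<Rightarrow> nat) \<Rightarrow> complex" where
  "graph_form s m = of_nat (card {i. exponent3 i i (s i) = m})"

lemma graph_form_eval:
  fixes x :: "complex ^ 'n::finite"
  shows "form_eval 3 (graph_form s) x = (\<Sum>i\<in>UNIV. (x $ i)\<^sup>2 * x $ (s i))"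
proof -
  have fin: "finite (exponents 3 :: ('n \<Rightarrow> nat) set)" unfolding exponents_3 by simp
  have "(\<Sum>i\<in>UNIV. (x $ i)\<^sup>2 * x $ (s i)) = (\<Sum>i\<in>UNIV. \<Prod>t\<in>UNIV. (x $ t) ^ exponent3 i i (s i) t)"
    by (simp add: prod_exponent3 power2_eq_square)
  also have "\<dots> = (\<Sum>m\<in>exponents 3. \<Sum>i | i \<in> UNIV \<and> exponent3 i i (s i) = m. \<Prod>t\<in>UNIV. (x $ t) ^ exponent3 i i (s i) t)"
    using fin by (intro sum.group[symmetric]) (auto simp: exponents_def sum_exponent3)
  also have "\<dots> = (\<Sum>m\<in>exponents 3. graph_form s m * (\<Prod>t\<in>UNIV. (x $ t) ^ m t))"
    by (intro sum.cong refl) (simp add: graph_form_def)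
  finally show ?thesis by (simp add: form_eval_def)
qed

lemma smooth_graph_form:
  fixes s :: "'n::finite \<Rightarrow> 'n"
  assumes inj: "\<And>i k. s i = s k \<Longrightarrow> s i \<noteq> i \<Longrightarrow> s k \<noteq> k \<Longrightarrow> i = k"
  shows "smooth_form 3 (graph_form s)"
  unfolding smooth_form_def
proof (intro allI impI)
  fix x :: "complex ^ 'n" assume x: "x \<noteq> 0"
  have partial: "form_partial 3 (graph_form s) l x = 2 * x $ l * x $ (s l) + (\<Sum>i | s i = l. (x $ i)\<^sup>2)" for l
  proof -
    have D1: "((\<lambda>t. \<Sum>i\<in>UNIV. ((x + t *s axis l 1) $ i)\<^sup>2 * (x + t *s axis l 1) $ (s i)) has_field_derivative
        (\<Sum>i\<in>UNIV. 2 * x $ i * of_bool (i = l) * x $ (s i) + (x $ i)\<^sup>2 * of_bool (s i = l))) (at 0)"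
    proof (rule DERIV_sum)
      fix i
      have a: "(x + t *s axis l 1) $ j = x $ j + t * of_bool (j = l)" for t j by (simp add: axis_def)
      show "((\<lambda>t. ((x + t *s axis l 1) $ i)\<^sup>2 * (x + t *s axis l 1) $ (s i)) has_field_derivative
        2 * x $ i * of_bool (i = l) * x $ (s i) + (x $ i)\<^sup>2 * of_bool (s i = l)) (at 0)"
        unfolding a by (auto intro!: derivative_eq_intros)
    qed
    have val: "(\<Sum>i\<in>UNIV. 2 * x $ i * of_bool (i = l) * x $ (s i) + (x $ i)\<^sup>2 * of_bool (s i = l))
      = 2 * x $ l * x $ (s l) + (\<Sum>i | s i = l. (x $ i)\<^sup>2)"
    proof -
      have "(\<Sum>i\<in>UNIV. 2 * x $ i * of_bool (i = l) * x $ (s i)) = (\<Sum>i\<in>UNIV. if i = l then 2 * x $ i * x $ (s i) else 0)"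
        by (intro sum.cong refl) simp
      moreover have "(\<Sum>i\<in>UNIV. (x $ i)\<^sup>2 * of_bool (s i = l)) = (\<Sum>i | s i = l. (x $ i)\<^sup>2)"
        by (simp add: of_bool_def if_distrib sum.If_cases cong: if_cong)
      ultimately show ?thesis by (simp add: sum.distrib)
    qed
    have D2: "((\<lambda>t. \<Sum>i\<in>UNIV. ((x + t *s axis l 1) $ i)\<^sup>2 * (x + t *s axis l 1) $ (s i)) has_field_derivative
        form_partial 3 (graph_form s) l x) (at 0)"
      using form_partial_derivative[of 3 "graph_form s" x l] by (simp only: graph_form_eval)
    show ?thesis using DERIV_unique[OF D2 D1] unfolding val .
  qed
  show "\<exists>l. form_partial 3 (graph_form s) l x \<noteq> 0"
  proof (rule ccontr)
    assume "\<not> ?thesis"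
    then have "2 * x $ l * x $ (s l) + (\<Sum>i | s i = l. (x $ i)\<^sup>2) = 0" for l using partial by metis
    then have "x $ l = 0" for l using graph_form_zero[of s "($) x"] inj by blast
    then show False using x by (simp add: vec_eq_iff)
  qed
qed

definition diag :: "('n \<Rightarrow> complex) \<Rightarrow> complex ^ 'n ^ 'n" where
  "diag d = (\<chi> i j. if i = j then d i else 0)"

lemma diag_vec: "diag d *v x = (\<chi> i. d i * x $ i)" for x :: "complex ^ 'n::finite"
  by (simp add: diag_def vec_eq_iff matrix_vector_mult_def if_distrib if_distribR cong: if_cong)

text \<open>The assumption \<open>inv\<close> says that all monomials of the form are multiplied by the same factor, and \<open>faithful\<close> that no element
  except the unit acts by a scalar.\<close>

lemma acts_if_diagonal_characters:
  fixes G :: "('a, 'b) monoid_scheme" (structure) and d :: "'a \<Rightarrow> 6 \<Rightarrow> complex"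
  assumes "group G"
    and inj: "\<And>i k. s i = s k \<Longrightarrow> s i \<noteq> i \<Longrightarrow> s k \<noteq> k \<Longrightarrow> i = k"
    and char: "\<And>i. character G (\<lambda>g. d g i)"
    and inv: "\<And>g i k. g \<in> carrier G \<Longrightarrow> (d g i)\<^sup>2 * d g (s i) = (d g k)\<^sup>2 * d g (s k)"
    and faithful: "\<And>g. g \<in> carrier G \<Longrightarrow> (\<And>i k. d g i = d g k) \<Longrightarrow> g = \<one>"
  shows "acts_effectively_on_cubic_fourfold G"
proof -
  interpret group G by fact
  define \<phi> where "\<phi> g = {mat c ** diag (d g) | c. c \<noteq> 0}" for g
  have nz: "d g i \<noteq> 0" if "g \<in> carrier G" for g i using char that by (simp add: character_def)
  have mult: "d (g \<otimes> h) i = d g i * d h i" if "g \<in> carrier G" "h \<in> carrier G" for g h i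
    using char that by (simp add: character_def)
  have act: "(mat c ** diag (d g)) *v x = (\<chi> i. c * d g i * x $ i)" for c g x
    unfolding mat_mult_vec diag_vec by (simp add: vec_eq_iff mult.assoc)
  have prod_eq: "(mat a ** diag (d g)) ** (mat b ** diag (d h)) = mat (a * b) ** diag (d (g \<otimes> h))"
    if "g \<in> carrier G" "h \<in> carrier G" for g h a b
  proof -
    have "((mat a ** diag (d g)) ** (mat b ** diag (d h))) *v x = (mat (a * b) ** diag (d (g \<otimes> h))) *v x" for x
      unfolding matrix_vector_mul_assoc[symmetric, of "mat a ** diag (d g)"] act
      by (simp add: vec_eq_iff mult[OF that] mult_ac)
    then show ?thesis by (simp add: matrix_eq)
  qed
  have mem: "diag (d g) \<in> \<phi> g" for g unfolding \<phi>_def by (intro CollectI exI[of _ 1]) simp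
  have \<phi>_carrier: "\<phi> g \<in> carrier PGL" if g: "g \<in> carrier G" for g
  proof -
    have "invertible (diag (d g))"
    proof -
      have 1: "diag (d g) ** diag (\<lambda>i. inverse (d g i)) = mat 1" "diag (\<lambda>i. inverse (d g i)) ** diag (d g) = mat 1"
        using nz[OF g] by (simp_all add: matrix_eq matrix_vector_mul_assoc[symmetric] diag_vec vec_eq_iff)
      then show ?thesis unfolding invertible_def by blast
    qed
    then show ?thesis
      by (auto simp: PGL_def FactGroup_def RCOSETS_def r_coset_def GL_def scalar_matrices_def \<phi>_def)
  qed
  have hom: "\<phi> \<in> hom G PGL"
  proof (rule homI)
    fix g h assume gh: "g \<in> carrier G" "h \<in> carrier G"
    show "\<phi> (g \<otimes> h) = \<phi> g \<otimes>\<^bsub>PGL\<^esub> \<phi> h"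
    proof (intro equalityI subsetI)
      fix M assume "M \<in> \<phi> (g \<otimes> h)"
      then obtain c where c: "c \<noteq> 0" "M = mat c ** diag (d (g \<otimes> h))" by (auto simp: \<phi>_def)
      then have "M = (mat c ** diag (d g)) ** (mat 1 ** diag (d h))" using prod_eq[OF gh, of c 1] by simp
      then have "M = (mat c ** diag (d g)) ** diag (d h)" by simp
      then show "M \<in> \<phi> g \<otimes>\<^bsub>PGL\<^esub> \<phi> h" unfolding PGL_mult using c(1) mem[of h] by (auto simp: \<phi>_def)
    next
      fix M assume "M \<in> \<phi> g \<otimes>\<^bsub>PGL\<^esub> \<phi> h"
      then obtain a b where "a \<noteq> 0" "b \<noteq> 0" "M = (mat a ** diag (d g)) ** (mat b ** diag (d h))"
        unfolding PGL_mult \<phi>_def by blast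
      then show "M \<in> \<phi> (g \<otimes> h)" using prod_eq[OF gh] by (auto simp: \<phi>_def intro!: exI[of _ "a * b"])
    qed
  qed (rule \<phi>_carrier)
  have "inj_on \<phi> (carrier G)"
  proof (rule inj_onI)
    fix g h assume gh: "g \<in> carrier G" "h \<in> carrier G" "\<phi> g = \<phi> h"
    then obtain c where c: "diag (d g) = mat c ** diag (d h)" using mem[of g] by (auto simp: \<phi>_def)
    have "diag (d g) *v (\<chi> i. 1) = (mat c ** diag (d h)) *v (\<chi> i. 1)" using c by simp
    then have dd: "d g i = c * d h i" for i unfolding act diag_vec by (simp add: vec_eq_iff)
    have "g \<otimes> inv h = \<one>"
    proof (rule faithful)
      fix i k
      have "d (g \<otimes> inv h) i = c" for i
        using gh nz[OF gh(2), of i] dd[of i] character_inv[OF is_group char, of h i] by (simp add: mult)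
      then show "d (g \<otimes> inv h) i = d (g \<otimes> inv h) k" by simp
    qed (use gh in simp)
    then show "g = h" using gh by (metis inv_equality inv_inv inv_closed)
  qed
  moreover have "smooth_cubic_fourfold (hypersurface 3 (graph_form s))"
    unfolding smooth_cubic_fourfold_def using smooth_graph_form[of s] inj by blast
  moreover have "proj_act (\<phi> g) ` hypersurface 3 (graph_form s) \<subseteq> hypersurface 3 (graph_form s)" if g: "g \<in> carrier G" for g
  proof clarify
    fix p assume p: "p \<in> hypersurface 3 (graph_form s)"
    then obtain x where x: "p = vec.span {x}" "x \<noteq> 0" by (auto simp: hypersurface_def proj_space_def)
    define y where "y = diag (d g) *v x"
    have y0: "y \<noteq> 0" using x(2) nz[OF g] by (auto simp: y_def diag_vec vec_eq_iff)
    have "proj_act (\<phi> g) p = vec.span {y}"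
    proof (intro equalityI subsetI)
      fix z assume "z \<in> proj_act (\<phi> g) p"
      then obtain c r where "z = (mat c ** diag (d g)) *v (r *s x)"
        unfolding proj_act_def x(1) vec.span_singleton \<phi>_def by blast
      then have "z = (c * r) *s y" unfolding mat_mult_vec vector_scalar_commute y_def by simp
      then show "z \<in> vec.span {y}" by (auto simp: vec.span_singleton)
    next
      fix z assume "z \<in> vec.span {y}"
      then obtain r where "z = r *s y" by (auto simp: vec.span_singleton)
      then have "z = diag (d g) *v (r *s x)" by (simp add: y_def vector_scalar_commute)
      then show "z \<in> proj_act (\<phi> g) p"
        unfolding proj_act_def x(1) vec.span_singleton using mem[of g] by blast
    qed
    moreover have "form_eval 3 (graph_form s) z = 0" if "z \<in> vec.span {y}" for z
    proof -
      obtain r where r: "z = r *s y" using \<open>z \<in> vec.span {y}\<close> by (auto simp: vec.span_singleton)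
      have "form_eval 3 (graph_form s) (r *s x) = 0"
        using p by (auto simp: hypersurface_def x(1) vec.span_singleton)
      moreover have "form_eval 3 (graph_form s) z = (\<Sum>i\<in>UNIV. ((d g i)\<^sup>2 * d g (s i)) * (((r *s x) $ i)\<^sup>2 * (r *s x) $ (s i)))"
        unfolding graph_form_eval r y_def diag_vec by (intro sum.cong refl) (simp add: power_mult_distrib mult_ac)
      moreover have "\<dots> = ((d g 0)\<^sup>2 * d g (s 0)) * form_eval 3 (graph_form s) (r *s x)"
        unfolding graph_form_eval sum_distrib_left by (intro sum.cong refl) (metis inv[OF g])
      ultimately show ?thesis by simp
    qed
    ultimately show "proj_act (\<phi> g) p \<in> hypersurface 3 (graph_form s)"
      using y0 by (auto simp: hypersurface_def proj_space_def)
  qed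
  ultimately show ?thesis unfolding acts_effectively_on_cubic_fourfold_def using hom by blast
qed

text \<open>Numerical data for a diagonal action of the sum of the cyclic groups of orders \<open>ns\<close>. The \<open>j\<close>-th generator acts on \<open>x\<^sub>i\<close>
  by a primitive root of unity of order \<open>ns ! j\<close> to the power \<open>W ! j ! i\<close>. The first three conditions concern the form and its invariance. The
  rows of \<open>U\<close> recover the coordinates of a group element from the diagonal entries, which shows
  that the action is faithful; their sums are divisible by a common multiple \<open>q\<close> of the orders, so they are insensitive to a scalar
  factor. All quantifiers range over explicit lists so that the simplifier can evaluate them.\<close>

definition certificate :: "nat list \<Rightarrow> nat \<Rightarrow> nat list \<Rightarrow> nat list list \<Rightarrow> nat list list \<Rightarrow> bool" where
  "certificate ns q s W U \<longleftrightarrow>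
     (\<forall>i\<in>set [0, 1, 2, 3, 4, 5]. s ! i < 6) \<and>
     (\<forall>i\<in>set [0, 1, 2, 3, 4, 5]. \<forall>k\<in>set [0, 1, 2, 3, 4, 5]. s ! i = s ! k \<longrightarrow> s ! i \<noteq> i \<longrightarrow> s ! k \<noteq> k \<longrightarrow> i = k) \<and>
     (\<forall>j\<in>set [0..<length ns]. \<forall>i\<in>set [0, 1, 2, 3, 4, 5].
        (2 * W ! j ! i + W ! j ! (s ! i)) mod (ns ! j) = (2 * W ! j ! 0 + W ! j ! (s ! 0)) mod (ns ! j)) \<and>
     (\<forall>j\<in>set [0..<length ns]. (\<Sum>i\<leftarrow>[0, 1, 2, 3, 4, 5]. U ! j ! i) mod q = 0 \<and> q mod (ns ! j) = 0) \<and>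
     (\<forall>j\<in>set [0..<length ns]. \<forall>l\<in>set [0..<length ns].
        (\<Sum>i\<leftarrow>[0, 1, 2, 3, 4, 5]. U ! j ! i * W ! l ! i) mod (ns ! l) = (if j = l then 1 else 0))"

lemma acts_if_certificate:
  fixes G :: "('a, 'b) monoid_scheme" (structure)
  assumes "group G" "isomorphic_to_subgroup G (cyclic_sum ns)" "\<forall>n\<in>set ns. n > 0"
    and cert: "certificate ns q s W U"
  shows "acts_effectively_on_cubic_fourfold G"
proof -
  interpret group G by fact
  obtain \<xi> where "(\<forall>j<length ns. character G (\<xi> j) \<and> (\<forall>x\<in>carrier G. \<xi> j x ^ (ns ! j) = 1)) \<and>
     (\<forall>x\<in>carrier G. (\<forall>j<length ns. \<xi> j x = 1) \<longrightarrow> x = \<one>)"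
    using embeds_in_if_isomorphic_to_subgroup[OF assms(1-3)] by blast
  then have char: "\<And>j. j < length ns \<Longrightarrow> character G (\<xi> j)"
    and ord: "\<And>j x. j < length ns \<Longrightarrow> x \<in> carrier G \<Longrightarrow> \<xi> j x ^ (ns ! j) = 1"
    and sep: "\<And>x. x \<in> carrier G \<Longrightarrow> (\<And>j. j < length ns \<Longrightarrow> \<xi> j x = 1) \<Longrightarrow> x = \<one>" by auto
  have I: "set [0, 1, 2, 3, 4, 5] = {..<6::nat}" by auto
  have SI: "(\<Sum>i\<leftarrow>[0, 1, 2, 3, 4, 5]. f i) = (\<Sum>i<6. f i)" for f :: "nat \<Rightarrow> nat"
    by (simp add: eval_nat_numeral)
  have L: "set [0..<length ns] = {..<length ns}" by auto
  note c = cert[unfolded certificate_def I SI L]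
  note c1 = c[THEN conjunct1] and c2 = c[THEN conjunct2, THEN conjunct1]
    and c3 = c[THEN conjunct2, THEN conjunct2, THEN conjunct1]
    and c4 = c[THEN conjunct2, THEN conjunct2, THEN conjunct2, THEN conjunct1]
    and c5 = c[THEN conjunct2, THEN conjunct2, THEN conjunct2, THEN conjunct2]
  have s6: "s ! i < 6" if "i < 6" for i
    using bspec[OF c1, of i] that by (simp only: lessThan_iff)
  have sinj: "i = k" if "i < 6" "k < 6" "s ! i = s ! k" "s ! i \<noteq> i" "s ! k \<noteq> k" for i k
    using bspec[OF bspec[OF c2, of i], of k] that by (simp only: lessThan_iff simp_thms)
  have sinv: "(2 * W ! j ! i + W ! j ! (s ! i)) mod (ns ! j) = (2 * W ! j ! 0 + W ! j ! (s ! 0)) mod (ns ! j)"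
    if "j < length ns" "i < 6" for j i
    using bspec[OF bspec[OF c3, of j], of i] that by (simp only: lessThan_iff simp_thms)
  have Uq: "(\<Sum>i<6. U ! j ! i) mod q = 0" and nq: "q mod (ns ! j) = 0" if "j < length ns" for j
    using bspec[OF c4, of j] that by (simp_all only: lessThan_iff simp_thms)
  have UW: "(\<Sum>i<6. U ! j ! i * W ! l ! i) mod (ns ! l) = (if j = l then 1 else 0)"
    if "j < length ns" "l < length ns" for j l
    using bspec[OF bspec[OF c5, of j], of l] that by (simp only: lessThan_iff simp_thms)
  have pow_mod: "\<xi> j x ^ a = \<xi> j x ^ b" if "j < length ns" "x \<in> carrier G" "a mod (ns ! j) = b mod (ns ! j)" for j x a b
  proof -
    have *: "\<xi> j x ^ c = \<xi> j x ^ (c mod (ns ! j))" for c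
    proof -
      have "\<xi> j x ^ c = \<xi> j x ^ (ns ! j * (c div (ns ! j)) + c mod (ns ! j))" by simp
      also have "\<dots> = (\<xi> j x ^ (ns ! j)) ^ (c div (ns ! j)) * \<xi> j x ^ (c mod (ns ! j))" by (simp only: power_add power_mult)
      finally show ?thesis using ord[OF that(1,2)] by simp
    qed
    show ?thesis using *[of a] *[of b] that(3) by simp
  qed
  define \<tau> where "\<tau> i x = (\<Prod>j<length ns. \<xi> j x ^ (W ! j ! i))" for i x
  have \<tau>_char: "character G (\<tau> i)" for i
    unfolding \<tau>_def by (rule character_prod) (auto intro: character_power char)
  have \<tau>_inv: "(\<tau> i x)\<^sup>2 * \<tau> (s ! i) x = (\<tau> 0 x)\<^sup>2 * \<tau> (s ! 0) x" if "i < 6" "x \<in> carrier G" for i x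
  proof -
    have *: "(\<tau> k x)\<^sup>2 * \<tau> (s ! k) x = (\<Prod>j<length ns. \<xi> j x ^ (2 * W ! j ! k + W ! j ! (s ! k)))" for k
      unfolding \<tau>_def prod_power_distrib prod.distrib[symmetric]
      by (intro prod.cong refl) (simp only: power_add power_mult mult.commute[of 2])
    show ?thesis
      unfolding * by (intro prod.cong refl, rule pow_mod[OF _ that(2) sinv[OF _ that(1)]]) simp_all
  qed
  have \<tau>_faithful: "x = \<one>" if x: "x \<in> carrier G" and eq: "\<And>i. i < 6 \<Longrightarrow> \<tau> i x = \<tau> 0 x" for x
  proof (rule sep[OF x])
    fix j assume j: "j < length ns"
    have q1: "\<tau> 0 x ^ q = 1"
    proof -
      have "\<xi> l x ^ (W ! l ! 0 * q) = 1" if "l < length ns" for l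
        using pow_mod[OF that x, of "W ! l ! 0 * q" 0] nq[OF that] by (simp add: mod_eq_0_iff_dvd)
      then show ?thesis
        unfolding \<tau>_def prod_power_distrib power_mult[symmetric] by (intro prod.neutral) auto
    qed
    have "(\<Prod>i<6. \<tau> i x ^ (U ! j ! i)) = (\<Prod>i<6. \<tau> 0 x ^ (U ! j ! i))"
    proof (rule prod.cong[OF refl])
      fix i :: nat assume "i \<in> {..<6}"
      then have "\<tau> i x = \<tau> 0 x" using eq by blast
      then show "\<tau> i x ^ (U ! j ! i) = \<tau> 0 x ^ (U ! j ! i)" by (rule arg_cong)
    qed
    also have "\<dots> = \<tau> 0 x ^ (\<Sum>i<6. U ! j ! i)" by (simp add: power_sum)
    also have "\<dots> = 1"
    proof -
      obtain k where "(\<Sum>i<6. U ! j ! i) = q * k" using Uq[OF j] by (metis mod_eq_0_iff_dvd dvd_def)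
      then show ?thesis using q1 by (simp add: power_mult)
    qed
    finally have 1: "(\<Prod>i<6. \<tau> i x ^ (U ! j ! i)) = 1" .
    have "(\<Prod>i<6. \<tau> i x ^ (U ! j ! i)) = (\<Prod>i<6. \<Prod>l<length ns. \<xi> l x ^ (U ! j ! i * W ! l ! i))"
      unfolding \<tau>_def prod_power_distrib power_mult[symmetric] by (simp only: mult.commute)
    also have "\<dots> = (\<Prod>l<length ns. \<Prod>i<6. \<xi> l x ^ (U ! j ! i * W ! l ! i))" by (rule prod.swap)
    also have "\<dots> = (\<Prod>l<length ns. \<xi> l x ^ (\<Sum>i<6. U ! j ! i * W ! l ! i))" by (simp add: power_sum)
    also have "\<dots> = (\<Prod>l<length ns. if l = j then \<xi> l x else 1)"
    proof (rule prod.cong[OF refl])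
      fix l assume "l \<in> {..<length ns}"
      then have l: "l < length ns" by simp
      have "\<xi> l x ^ (\<Sum>i<6. U ! j ! i * W ! l ! i) = \<xi> l x ^ ((\<Sum>i<6. U ! j ! i * W ! l ! i) mod (ns ! l))"
        by (rule pow_mod[OF l x]) simp
      then show "\<xi> l x ^ (\<Sum>i<6. U ! j ! i * W ! l ! i) = (if l = j then \<xi> l x else 1)"
        unfolding UW[OF j l] by simp
    qed
    also have "\<dots> = \<xi> j x" using j by simp
    finally show "\<xi> j x = 1" using 1 by simp
  qed
  have "\<exists>f. bij_betw f (UNIV :: 6 set) {..<6::nat}"
    by (rule finite_same_card_bij) auto
  then obtain f where f: "bij_betw f (UNIV :: 6 set) {..<6::nat}" by blast
  have f6: "f i < 6" for i using f by (auto simp: bij_betw_def)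
  define \<sigma> where "\<sigma> i = inv_into UNIV f (s ! f i)" for i
  have f\<sigma>: "f (\<sigma> i) = s ! f i" for i
    unfolding \<sigma>_def by (rule bij_betw_inv_into_right[OF f]) (use s6[OF f6] in simp)
  have finj: "f i = f k \<longleftrightarrow> i = k" for i k using f by (auto simp: bij_betw_def inj_on_def)
  show ?thesis
  proof (rule acts_if_diagonal_characters[where s = \<sigma> and d = "\<lambda>x i. \<tau> (f i) x"])
    show "group G" by fact
    show "i = k" if "\<sigma> i = \<sigma> k" "\<sigma> i \<noteq> i" "\<sigma> k \<noteq> k" for i k
      using sinj[OF f6 f6, of i k] that unfolding f\<sigma>[symmetric] finj by blast
    show "character G (\<lambda>x. \<tau> (f i) x)" for i using \<tau>_char by simp
    show "(\<tau> (f i) g)\<^sup>2 * \<tau> (f (\<sigma> i)) g = (\<tau> (f k) g)\<^sup>2 * \<tau> (f (\<sigma> k)) g" if "g \<in> carrier G" for g i k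
      unfolding f\<sigma> using \<tau>_inv[OF f6 that] by simp
    show "g = \<one>" if "g \<in> carrier G" and eq: "\<And>i k. \<tau> (f i) g = \<tau> (f k) g" for g
    proof (rule \<tau>_faithful[OF that(1)])
      fix i :: nat assume "i < 6"
      then obtain a b where "f a = i" "f b = 0" using f by (metis bij_betw_imp_surj_on imageE lessThan_iff zero_less_numeral)
      then show "\<tau> i g = \<tau> 0 g" using eq[of a b] by simp
    qed
  qed
qed

text \<open>The maps \<open>s\<close> are unions of cycles and of chains ending in fixed points. A cycle of length 3, 4, 5, 6 accounts for the
  factor 9, 5, 11, 7, and a chain of \<open>k\<close> indices for a cyclic factor of order \<open>2 ^ (k - 1)\<close>.\<close>

lemma certificates:
  "certificate [3, 3, 3, 3, 3] 3 [0, 1, 2, 3, 4, 5]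
    [[0, 1, 1, 0, 2, 0], [0, 2, 0, 0, 0, 0], [0, 0, 2, 1, 0, 0], [0, 0, 1, 1, 1, 2], [0, 0, 0, 2, 0, 0]]
    [[2, 0, 0, 0, 2, 2], [0, 2, 0, 0, 2, 2], [1, 0, 2, 0, 2, 1], [1, 0, 0, 0, 0, 2], [0, 0, 2, 2, 2, 0]]"
  "certificate [3, 3, 3, 3, 2] 6 [1, 1, 2, 3, 4, 5]
    [[0, 0, 0, 2, 0, 0], [0, 0, 0, 0, 0, 1], [0, 0, 1, 0, 0, 0], [0, 0, 1, 2, 1, 1], [0, 1, 1, 1, 1, 1]]
    [[0, 5, 0, 5, 2, 0], [0, 0, 0, 0, 5, 1], [0, 0, 1, 0, 5, 0], [0, 5, 0, 0, 1, 0], [5, 1, 0, 0, 0, 0]]"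
  "certificate [3, 3, 3, 4] 12 [1, 2, 2, 3, 4, 5]
    [[0, 0, 0, 2, 0, 0], [0, 0, 0, 0, 1, 0], [0, 0, 0, 0, 0, 2], [0, 3, 1, 1, 1, 1]]
    [[0, 0, 1, 11, 0, 0], [0, 0, 11, 0, 1, 0], [0, 0, 1, 0, 0, 11], [11, 0, 1, 0, 0, 0]]"
  "certificate [3, 3, 3, 2, 2] 6 [1, 1, 3, 3, 4, 5]
    [[0, 0, 1, 1, 1, 0], [0, 0, 0, 0, 0, 1], [0, 0, 0, 0, 1, 0], [0, 0, 1, 0, 0, 0], [0, 1, 0, 1, 1, 1]]
    [[0, 5, 0, 1, 0, 0], [0, 5, 0, 0, 0, 1], [0, 0, 0, 5, 1, 0], [5, 1, 1, 5, 0, 0], [5, 1, 0, 0, 0, 0]]"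
  "certificate [3, 3, 8] 24 [1, 2, 3, 3, 4, 5]
    [[0, 0, 0, 0, 2, 0], [0, 0, 0, 0, 0, 1], [0, 3, 5, 1, 1, 1]]
    [[0, 0, 0, 1, 23, 0], [0, 0, 0, 23, 0, 1], [23, 0, 0, 1, 0, 0]]"
  "certificate [3, 3, 2, 4] 12 [1, 1, 3, 4, 4, 5]
    [[0, 0, 0, 0, 0, 2], [0, 0, 1, 1, 1, 0], [0, 1, 0, 1, 1, 1], [0, 0, 1, 2, 0, 0]]
    [[0, 1, 0, 0, 0, 11], [10, 1, 2, 11, 0, 0], [11, 1, 0, 0, 0, 0], [1, 11, 11, 1, 0, 0]]"
  "certificate [3, 3, 2, 2, 2] 6 [1, 1, 3, 3, 5, 5]
    [[0, 0, 1, 1, 0, 0], [0, 0, 0, 0, 1, 1], [0, 0, 0, 0, 1, 0], [0, 0, 1, 0, 1, 0], [0, 1, 0, 1, 0, 1]]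
    [[0, 5, 0, 1, 0, 0], [0, 5, 0, 0, 0, 1], [0, 0, 5, 1, 1, 5], [5, 1, 1, 5, 0, 0], [5, 1, 0, 0, 0, 0]]"
  "certificate [3, 16] 48 [1, 2, 3, 4, 4, 5]
    [[0, 0, 0, 0, 0, 1], [0, 3, 13, 9, 1, 1]]
    [[0, 0, 0, 0, 47, 1], [47, 0, 0, 0, 1, 0]]"
  "certificate [3, 2, 8] 24 [1, 1, 3, 4, 5, 5]
    [[0, 0, 1, 1, 1, 1], [0, 1, 1, 1, 1, 1], [0, 0, 3, 2, 4, 0]]
    [[0, 23, 22, 3, 0, 0], [23, 1, 0, 0, 0, 0], [0, 0, 1, 23, 0, 0]]"
  "certificate [3, 4, 4] 12 [1, 2, 2, 4, 5, 5]
    [[0, 0, 0, 1, 1, 1], [0, 0, 0, 1, 2, 0], [0, 3, 1, 1, 1, 1]]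
    [[0, 0, 11, 2, 11, 0], [0, 0, 0, 11, 1, 0], [11, 0, 1, 0, 0, 0]]"
  "certificate [32] 32 [1, 2, 3, 4, 5, 5]
    [[0, 3, 29, 9, 17, 1]]
    [[31, 0, 0, 0, 0, 1]]"
  "certificate [3, 3, 9] 9 [0, 1, 2, 4, 5, 3]
    [[0, 1, 2, 0, 0, 0], [0, 0, 2, 0, 0, 0], [0, 0, 0, 1, 7, 4]]
    [[8, 1, 0, 0, 0, 0], [8, 2, 8, 0, 0, 0], [8, 0, 0, 1, 0, 0]]"
  "certificate [2, 3, 9] 18 [1, 1, 2, 4, 5, 3]
    [[0, 1, 1, 1, 1, 1], [0, 0, 1, 0, 0, 0], [0, 0, 0, 7, 4, 1]]
    [[17, 1, 0, 0, 0, 0], [0, 17, 1, 0, 0, 0], [0, 17, 0, 0, 0, 1]]"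
  "certificate [4, 9] 36 [1, 2, 2, 4, 5, 3]
    [[0, 3, 1, 1, 1, 1], [0, 0, 0, 4, 1, 7]]
    [[35, 0, 1, 0, 0, 0], [0, 0, 35, 0, 1, 0]]"
  "certificate [3, 3, 5] 15 [0, 1, 3, 4, 5, 2]
    [[0, 1, 0, 0, 0, 0], [0, 0, 1, 1, 1, 1], [0, 0, 1, 3, 4, 2]]
    [[14, 1, 0, 0, 0, 0], [14, 0, 2, 0, 0, 14], [0, 0, 14, 0, 0, 1]]"
  "certificate [2, 3, 5] 30 [1, 1, 3, 4, 5, 2]
    [[0, 1, 1, 1, 1, 1], [0, 0, 1, 1, 1, 1], [0, 0, 4, 2, 1, 3]]
    [[29, 1, 0, 0, 0, 0], [0, 29, 27, 0, 0, 4], [0, 0, 1, 0, 0, 29]]"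
  "certificate [3, 7] 21 [1, 2, 3, 4, 5, 0]
    [[0, 1, 2, 0, 1, 2], [0, 4, 3, 5, 1, 2]]
    [[16, 14, 0, 4, 8, 0], [1, 2, 0, 20, 19, 0]]"
  "certificate [3, 11] 33 [0, 2, 3, 4, 5, 1]
    [[0, 1, 1, 1, 1, 1], [0, 9, 4, 3, 5, 1]]
    [[32, 1, 9, 0, 24, 0], [0, 0, 32, 0, 1, 0]]"
  by (simp_all add: certificate_def upt_rec)

theorem acts_if_isomorphic_to_subgroup:
  fixes G :: "('a, 'b) monoid_scheme"
  assumes "group G" "ns \<in> fourfold_types" "isomorphic_to_subgroup G (cyclic_sum ns)"
  shows "acts_effectively_on_cubic_fourfold G"
proof -
  have pos: "\<forall>n\<in>set ns. n > 0" using assms(2) by (auto simp: fourfold_types_def)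
  have "\<exists>q s W U. certificate ns q s W U"
    using assms(2) unfolding fourfold_types_def
    by (elim insertE emptyE; hypsubst) (rule exI, rule exI, rule exI, rule exI, rule certificates)+
  then show ?thesis using acts_if_certificate[OF assms(1,3) pos] by blast
qed

theorem mainTheorem1:
  fixes G :: "('a, 'b) monoid_scheme"
  assumes "comm_group G" and "finite (carrier G)"
  shows "acts_effectively_on_cubic_fourfold G \<longleftrightarrow>
    (\<exists>ns \<in> {[3, 3, 3, 3, 3], [3, 3, 3, 3, 2], [3, 3, 3, 4], [3, 3, 3, 2, 2],
             [3, 3, 8], [3, 3, 2, 4], [3, 3, 2, 2, 2], [3, 16],
             [3, 2, 8], [3, 4, 4], [32],
             [3, 3, 9], [2, 3, 9], [4, 9],
             [3, 3, 5], [2, 3, 5], [3, 7], [3, 11]}.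
       isomorphic_to_subgroup G (cyclic_sum ns))"
  unfolding fourfold_types_def[symmetric]
proof
  interpret comm_group G by fact
  show "\<exists>ns\<in>fourfold_types. isomorphic_to_subgroup G (cyclic_sum ns)" if "acts_effectively_on_cubic_fourfold G"
  proof -
    from embeds_in_if_acts[OF assms that]
    obtain ns where ns: "ns \<in> fourfold_types" "embeds_in G (mset ns)" by blast
    have "\<forall>n\<in>set ns. n > 0" using ns(1) by (auto simp: fourfold_types_def)
    then have "isomorphic_to_subgroup G (cyclic_sum ns)"
      by (rule isomorphic_to_subgroup_if_embeds_in[OF is_group ns(2)])
    then show ?thesis using ns(1) by blast
  qed
  show "acts_effectively_on_cubic_fourfold G" if "\<exists>ns\<in>fourfold_types. isomorphic_to_subgroup G (cyclic_sum ns)"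
    using that acts_if_isomorphic_to_subgroup[OF is_group] by blast
qed

end
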